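(* There exists a universal constant $\alpha\in(0,\tfrac12)$ such that the following holds. Let $\frac{1-\alpha}{2}<s\le\frac12$, let $\theta_0\in L^2(\mathbb{R})$, and let $\theta$ be a solution (in the vanishing viscosity sense) in $\mathbb{R}\times[0,+\infty)$ of the fractional Burgers equation $$\theta_t+\theta\,\theta_x+(-\Delta)^s\theta=0$$ with initial data $\theta_0$. Then there exists $T^*>0$, depending only on $\|\theta_0\|_{L^2}$, such that for every $t>T^*$ the function $\theta(\cdot,t)$ is $C^\alpha$ (Hölder continuous with exponent $\alpha$) on $\mathbb{R}$.
   Context: Here $x\in\mathbb{R}$, $\theta$ is real-valued, and $(-\Delta)^s$ is the fractional Laplacian in the variable $x$, $(-\Delta)^s f(x)=C_s\,\mathrm{p.v.}\!\int_{\mathbb{R}}\frac{f(x)-f(y)}{|x-y|^{1+2s}}\,dy$, with $C_s>0$ the usual normalizing constant (Fourier symbol $|\xi|^{2s}$). A solution of $\theta_t+\theta\theta_x+(-\Delta)^s\theta=0$ with initial data $\theta_0\in L^2(\mathbb{R})$ means a weak solution (in the sense of distributions) obtained through the vanishing viscosity method, i.e. a limit, along some sequence $\varepsilon_1\to0^+$, of the solutions $\theta^{\varepsilon_1}$ (which are $C^\infty$ for $t>0$) of $$\theta_t+\theta\theta_x+(-\Delta)^s\theta-\varepsilon_1\Delta\theta=0,\qquad \theta(\cdot,0)=\theta_0,$$ where $\Delta=\partial_x^2$. The convergence is weak in $L^\infty(L^2)\cap L^2(\dot H^s)$ and weak-$*$ in $L^\infty(\mathbb{R}\times(t,+\infty))$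 for every $t>0$. As usual for weak solutions, functions are identified when they agree almost everywhere. *)

theory Defs
  imports "HOL-Analysis.Analysis"
begin

text \<open>
  Space-time points are pairs \<open>(x, t)\<close>; functions on the half plane \<open>t > 0\<close> are total
  functions on \<open>real \<times> real\<close> whose values for \<open>t \<le> 0\<close> are irrelevant.
\<close>

abbreviation spacetime :: "(real \<times> real) set" where
  "spacetime \<equiv> UNIV \<times> {0<..}"


subsection \<open>Function spaces\<close>

definition in_L2 :: "(real \<Rightarrow> real) \<Rightarrow> bool" where
  "in_L2 f \<longleftrightarrow> f \<in> borel_measurable lborel \<and> integrable lborel (\<lambda>x. (f x)\<^sup>2)"

definition L2_norm :: "(real \<Rightarrow> real) \<Rightarrow> real" where
  "L2_norm f = sqrt (LINT x|lborel. (f x)\<^sup>2)"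

definition holder_continuous :: "real \<Rightarrow> (real \<Rightarrow> real) \<Rightarrow> bool" where
  "holder_continuous \<alpha> f \<longleftrightarrow> (\<exists>C. \<forall>x y. \<bar>f x - f y\<bar> \<le> C * \<bar>x - y\<bar> powr \<alpha>)"

text \<open>For open \<open>S\<close> in a finite-dimensional space, this is the usual class \<open>C\<^sup>k\<close>.\<close>

primrec Ck_on :: "nat \<Rightarrow> 'a::real_normed_vector set \<Rightarrow> ('a \<Rightarrow> real) \<Rightarrow> bool" where
  "Ck_on 0 S f \<longleftrightarrow> continuous_on S f"
| "Ck_on (Suc k) S f \<longleftrightarrow>
     (\<forall>x\<in>S. f differentiable (at x)) \<and> (\<forall>v. Ck_on k S (\<lambda>x. frechet_derivative f (at x) v))"

definition smooth_on :: "'a::real_normed_vector set \<Rightarrow> ('a \<Rightarrow> real) \<Rightarrow> bool" where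
  "smooth_on S f \<longleftrightarrow> (\<forall>k. Ck_on k S f)"

text \<open>The space \<open>L\<^sup>\<infinity>(0,\<infinity>; L\<^sup>2(\<real>))\<close>.\<close>

definition in_Linf_L2 :: "(real \<times> real \<Rightarrow> real) \<Rightarrow> bool" where
  "in_Linf_L2 u \<longleftrightarrow> set_borel_measurable lborel spacetime u \<and>
     (\<exists>C. AE t in lborel. 0 < t \<longrightarrow> (\<integral>\<^sup>+x. ennreal ((u (x, t))\<^sup>2) \<partial>lborel) \<le> ennreal C)"

text \<open>The space \<open>L\<^sup>1(0,\<infinity>; L\<^sup>2(\<real>))\<close>, the predual of the previous one.\<close>

definition in_L1_L2 :: "(real \<times> real \<Rightarrow> real) \<Rightarrow> bool" where
  "in_L1_L2 u \<longleftrightarrow> set_borel_measurable lborel spacetime u \<and>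
     (AE t in lborel. 0 < t \<longrightarrow> integrable lborel (\<lambda>x. (u (x, t))\<^sup>2)) \<and>
     set_integrable lborel {0<..} (\<lambda>t. L2_norm (\<lambda>x. u (x, t)))"

text \<open>
  The space \<open>L\<^sup>2(0,\<infinity>; H)\<close> with \<open>H\<close> the homogeneous Sobolev space of order \<open>s \<in> (0,1)\<close>, through
  the Gagliardo seminorm, which is a constant multiple of the \<open>L\<^sup>2\<close> norm of \<open>(-\<Delta>)\<^sup>s\<^sup>/\<^sup>2 u\<close>.
  The integration variable is \<open>(t, x, y)\<close>; on the diagonal the quotients are \<open>0 / 0 = 0\<close>.
\<close>

definition in_L2_Hdot :: "real \<Rightarrow> (real \<times> real \<Rightarrow> real) \<Rightarrow> bool" where
  "in_L2_Hdot s u \<longleftrightarrow> set_borel_measurable lborel spacetime u \<and>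
     set_nn_integral lborel ({0<..} \<times> UNIV)
       (\<lambda>(t, x, y). ennreal ((u (x, t) - u (y, t))\<^sup>2 / \<bar>x - y\<bar> powr (1 + 2 * s))) < \<infinity>"

definition L2_Hdot_inner ::
    "real \<Rightarrow> (real \<times> real \<Rightarrow> real) \<Rightarrow> (real \<times> real \<Rightarrow> real) \<Rightarrow> real" where
  "L2_Hdot_inner s u v = set_lebesgue_integral lborel ({0<..} \<times> UNIV)
     (\<lambda>(t, x, y). (u (x, t) - u (y, t)) * (v (x, t) - v (y, t)) / \<bar>x - y\<bar> powr (1 + 2 * s))"

text \<open>The space \<open>L\<^sup>\<infinity>(\<real> \<times> (t,\<infinity>))\<close>.\<close>

definition in_Linf_after :: "real \<Rightarrow> (real \<times> real \<Rightarrow> real) \<Rightarrow> bool" where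
  "in_Linf_after t u \<longleftrightarrow> set_borel_measurable lborel (UNIV \<times> {t<..}) u \<and>
     (\<exists>C. AE p in lborel. t < snd p \<longrightarrow> \<bar>u p\<bar> \<le> C)"


subsection \<open>The fractional Laplacian\<close>

text \<open>
  This normalization is the one for which \<open>(-\<Delta>)\<^sup>s\<close> has Fourier symbol \<open>|\<xi>|\<^sup>2\<^sup>s\<close>, as one sees by
  applying the operator to \<open>cos (\<xi> x)\<close> at \<open>x = 0\<close>.
\<close>

definition frac_lap_const :: "real \<Rightarrow> real" where
  "frac_lap_const s = inverse (LINT z|lborel. (1 - cos z) / \<bar>z\<bar> powr (1 + 2 * s))"

text \<open>
  For \<open>0 < s < 1\<close>, the limit exists for every smooth \<open>f\<close> that is bounded or in \<open>L\<^sup>2\<close>; the operator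
  is only applied to such functions.
\<close>

definition frac_lap :: "real \<Rightarrow> (real \<Rightarrow> real) \<Rightarrow> real \<Rightarrow> real" where
  "frac_lap s f x = frac_lap_const s *
     Lim (at_right 0)
       (\<lambda>\<delta>. LINT y:{y. \<delta> < \<bar>x - y\<bar>}|lborel. (f x - f y) / \<bar>x - y\<bar> powr (1 + 2 * s))"


subsection \<open>Solutions of the fractional Burgers equation\<close>

definition dx :: "(real \<times> real \<Rightarrow> real) \<Rightarrow> real \<times> real \<Rightarrow> real" where
  "dx u p = deriv (\<lambda>y. u (y, snd p)) (fst p)"

definition dt :: "(real \<times> real \<Rightarrow> real) \<Rightarrow> real \<times> real \<Rightarrow> real" where
  "dt u p = deriv (\<lambda>\<tau>. u (fst p, \<tau>)) (snd p)"

text \<open>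
  The solution of \<open>u\<^sub>t + u u\<^sub>x + (-\<Delta>)\<^sup>s u - \<epsilon> u\<^sub>x\<^sub>x = 0\<close> with initial data \<open>\<theta>\<^sub>0 \<in> L\<^sup>2\<close>: it is smooth
  for \<open>t > 0\<close>, solves the equation pointwise there, attains the initial data in \<open>L\<^sup>2\<close>, and lies in
  the energy space of the equation (in which the solution is unique).
\<close>

definition viscous_solution ::
    "real \<Rightarrow> real \<Rightarrow> (real \<Rightarrow> real) \<Rightarrow> (real \<times> real \<Rightarrow> real) \<Rightarrow> bool" where
  "viscous_solution s \<epsilon> \<theta>\<^sub>0 u \<longleftrightarrow>
     smooth_on spacetime u \<and>
     (\<forall>x t. 0 < t \<longrightarrow>
        dt u (x, t) + u (x, t) * dx u (x, t) + frac_lap s (\<lambda>y. u (y, t)) x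
          - \<epsilon> * dx (dx u) (x, t) = 0) \<and>
     in_Linf_L2 u \<and> in_L2_Hdot s u \<and>
     set_nn_integral lborel spacetime (\<lambda>p. ennreal ((dx u p)\<^sup>2)) < \<infinity> \<and>
     ((\<lambda>t. \<integral>\<^sup>+x. ennreal ((u (x, t) - \<theta>\<^sub>0 x)\<^sup>2) \<partial>lborel) \<longlongrightarrow> 0) (at_right 0)"

definition test_function :: "(real \<times> real \<Rightarrow> real) \<Rightarrow> bool" where
  "test_function \<phi> \<longleftrightarrow> smooth_on UNIV \<phi> \<and> compact (closure {p. \<phi> p \<noteq> 0})"

text \<open>
  The nonlinear term is \<open>\<theta> \<theta>\<^sub>x = (\<theta>\<^sup>2 / 2)\<^sub>x\<close>. Test functions need not vanish at \<open>t = 0\<close>, which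
  encodes the initial data.
\<close>

definition weak_solution ::
    "real \<Rightarrow> (real \<Rightarrow> real) \<Rightarrow> (real \<times> real \<Rightarrow> real) \<Rightarrow> bool" where
  "weak_solution s \<theta>\<^sub>0 \<theta> \<longleftrightarrow> in_Linf_L2 \<theta> \<and>
     (\<forall>\<phi>. test_function \<phi> \<longrightarrow>
        (LINT p:spacetime|lborel.
            \<theta> p * dt \<phi> p + (\<theta> p)\<^sup>2 / 2 * dx \<phi> p
              - \<theta> p * frac_lap s (\<lambda>y. \<phi> (y, snd p)) (fst p))
          + (LINT x|lborel. \<theta>\<^sub>0 x * \<phi> (x, 0)) = 0)"

text \<open>
  As \<open>L\<^sup>\<infinity>(L\<^sup>2)\<close> is the dual of \<open>L\<^sup>1(L\<^sup>2)\<close>, weak convergence in it is tested against \<open>L\<^sup>1(L\<^sup>2)\<close>.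
\<close>

definition weak_conv_Linf_L2 ::
    "(nat \<Rightarrow> real \<times> real \<Rightarrow> real) \<Rightarrow> (real \<times> real \<Rightarrow> real) \<Rightarrow> bool" where
  "weak_conv_Linf_L2 u \<theta> \<longleftrightarrow> (\<forall>k. in_Linf_L2 (u k)) \<and> in_Linf_L2 \<theta> \<and>
     (\<forall>\<psi>. in_L1_L2 \<psi> \<longrightarrow>
        (\<lambda>k. LINT p:spacetime|lborel. u k p * \<psi> p)
          \<longlonglongrightarrow> (LINT p:spacetime|lborel. \<theta> p * \<psi> p))"

definition weak_conv_L2_Hdot ::
    "real \<Rightarrow> (nat \<Rightarrow> real \<times> real \<Rightarrow> real) \<Rightarrow> (real \<times> real \<Rightarrow> real) \<Rightarrow> bool" where
  "weak_conv_L2_Hdot s u \<theta> \<longleftrightarrow> (\<forall>k. in_L2_Hdot s (u k)) \<and> in_L2_Hdot s \<theta> \<and>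
     (\<forall>\<psi>. in_L2_Hdot s \<psi> \<longrightarrow> (\<lambda>k. L2_Hdot_inner s (u k) \<psi>) \<longlonglongrightarrow> L2_Hdot_inner s \<theta> \<psi>)"

definition weak_star_conv_Linf_after ::
    "real \<Rightarrow> (nat \<Rightarrow> real \<times> real \<Rightarrow> real) \<Rightarrow> (real \<times> real \<Rightarrow> real) \<Rightarrow> bool" where
  "weak_star_conv_Linf_after t u \<theta> \<longleftrightarrow> (\<forall>k. in_Linf_after t (u k)) \<and> in_Linf_after t \<theta> \<and>
     (\<forall>\<psi>. set_integrable lborel (UNIV \<times> {t<..}) \<psi> \<longrightarrow>
        (\<lambda>k. LINT p:UNIV \<times> {t<..}|lborel. u k p * \<psi> p)
          \<longlonglongrightarrow> (LINT p:UNIV \<times> {t<..}|lborel. \<theta> p * \<psi> p))"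

definition vanishing_viscosity_solution ::
    "real \<Rightarrow> (real \<Rightarrow> real) \<Rightarrow> (real \<times> real \<Rightarrow> real) \<Rightarrow> bool" where
  "vanishing_viscosity_solution s \<theta>\<^sub>0 \<theta> \<longleftrightarrow> weak_solution s \<theta>\<^sub>0 \<theta> \<and>
     (\<exists>\<epsilon> u. (\<forall>k. 0 < \<epsilon> k) \<and> \<epsilon> \<longlonglongrightarrow> 0 \<and>
        (\<forall>k. viscous_solution s (\<epsilon> k) \<theta>\<^sub>0 (u k)) \<and>
        weak_conv_Linf_L2 u \<theta> \<and> weak_conv_L2_Hdot s u \<theta> \<and>
        (\<forall>t>0. weak_star_conv_Linf_after t u \<theta>))"

text \<open>
  A solution is only determined up to null sets of space-time, so that a single time slice of it
  has no meaning by itself. The slice at time \<open>t\<close> is understood as that of a version of \<open>\<theta>\<close> which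
  is weakly continuous in time with values in \<open>L\<^sup>2\<close>; it determines the slice at every \<open>t > 0\<close> up to
  null sets of \<open>\<real>\<close>.
\<close>

definition time_continuous_version ::
    "(real \<times> real \<Rightarrow> real) \<Rightarrow> (real \<times> real \<Rightarrow> real) \<Rightarrow> bool" where
  "time_continuous_version \<theta> \<theta>' \<longleftrightarrow>
     set_borel_measurable lborel spacetime \<theta>' \<and>
     (AE p in lborel. 0 < snd p \<longrightarrow> \<theta>' p = \<theta> p) \<and>
     (\<forall>t>0. in_L2 (\<lambda>x. \<theta>' (x, t))) \<and>
     (\<forall>g. in_L2 g \<longrightarrow> continuous_on {0<..} (\<lambda>t. LINT x|lborel. \<theta>' (x, t) * g x))"

end

theory Submission
  imports Defs
begin

text \<open>
  The vanishing viscosity solutions are smooth, so that everything can be read off at touching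
  points of the maximum principle. The means of \<open>u\<close> over intervals of length \<open>h\<close> never exceed
  \<open>\<parallel>\<theta>\<^sub>0\<parallel> / sqrt h\<close>, because the nonlinear term vanishes where such a mean is maximal. At a maximum
  of \<open>u\<close> this smallness of the means forces a dissipation which makes \<open>u\<close> decay like
  \<open>t\<^bsup>-1/(4s)\<^esup>\<close>. Once \<open>u\<close> is small, a time dependent modulus of continuity \<open>(\<xi> + \<rho> (t))\<^bsup>\<alpha>\<^esup> / 10\<close>, with
  \<open>\<rho>\<close> decreasing from 1 to 0, is preserved (in the spirit of Kiselev's nonlocal maximum principles):
  the jump at \<open>\<xi> = 0\<close> that it allows is absorbed by the dissipation in bounded time. All estimates
  are uniform in the viscosity.

  For the limit, Oleinik's inequality makes \<open>u - x / t\<close> nonincreasing in space. Together with the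
  equicontinuity in time of the means, it gives convergence at all but countably many points of each
  time slice, and hence a weakly continuous version of the weak-* limit.
\<close>

section \<open>The kernel of the fractional Laplacian\<close>

text \<open>All constants come from one competition. Where the modulus \<omega> is touched by a pair
  of points at distance \<xi> with difference N, dissipation gains about N * \<xi> powr (-2 * s),
  while the nonlinear term costs N times the slope of \<omega>. For the exponent \<alpha> and
  amplitude 1/10 this slope is at most \<alpha> / 10 * \<xi> powr (\<alpha> - 1). For \<xi> < 1 the
  gain wins if 2 * s \<ge> 1 - \<alpha> and the amplitude is small; \<alpha> = 1/10 gives s > 9/20.
  An amplitude that small fits general data only after u has decayed, hence the waiting time. At
  that moment nothing is known about u at short distances, so the modulus has to begin with a jump.
  The other obstacle is that suprema over the real line need not be attained. Every comparison
  therefore carries a penalty \<eta> times a logarithmic weight plus a linear function of time, and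
  \<eta> is made small at the end. The bound on an individual solution influences only how fast the
  penalty must grow, or how soon a comparison starts, not the resulting estimate.\<close>

definition frac_ker :: "real \<Rightarrow> real \<Rightarrow> real" where
  "frac_ker s z = (if 0 < z then z powr (-1 - 2 * s) else 0)"

text \<open>A common majorant, up to factors, for second differences of bounded C2 functions and for
  the penalty ln (1 + z^2). The growth sqrt z, instead of a constant, makes room for the logarithm.
  Integrability of z powr (-1/2 - 2 * s) at infinity is the source of the recurring hypothesis 1/4 <
  s.\<close>

definition dom_fun :: "real \<Rightarrow> real" where
  "dom_fun z = (if z \<le> 1 then z\<^sup>2 else sqrt z)"

lemma frac_ker_nonneg [simp]: "0 \<le> frac_ker s z"
  by (simp add: frac_ker_def)

lemma frac_ker_measurable [measurable]: "frac_ker s \<in> borel_measurable borel"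
  unfolding frac_ker_def by measurable

lemma dom_fun_measurable [measurable]: "dom_fun \<in> borel_measurable borel"
  unfolding dom_fun_def by measurable

lemma dom_fun_nonneg [simp]: "0 \<le> dom_fun z"
  by (simp add: dom_fun_def)

lemma frac_ker_antimono: "0 < s \<Longrightarrow> 0 < z \<Longrightarrow> z \<le> w \<Longrightarrow> frac_ker s w \<le> frac_ker s z"
  by (auto simp: frac_ker_def intro!: powr_mono2')

lemma integrable_powr_01:
  assumes "-1 < (a::real)"
  shows "integrable lborel (\<lambda>z. indicator {0..1} z * z powr a)" (is ?A)
    and "(LINT z|lborel. indicator {0..1} z * z powr a) = 1 / (a + 1)" (is ?B)
proof -
  have h: "((\<lambda>z. z powr a) has_integral (1 powr (a+1) / (a+1))) {0..1}"
    by (rule has_integral_powr_from_0) (use assms in auto)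
  then have "(\<lambda>z. z powr a) absolutely_integrable_on {0..1}"
    by (intro nonnegative_absolutely_integrable_1) (auto simp: has_integral_iff)
  then have i: "set_integrable lborel {0..1} (\<lambda>z. z powr a)"
    unfolding set_integrable_def by (subst (asm) integrable_completion) auto
  then show ?A by (simp add: set_integrable_def)
  have "(LINT z:{0..1}|lborel. z powr a) = integral {0..1} (\<lambda>z. z powr a)"
    by (rule set_borel_integral_eq_integral(2)[OF i])
  then show ?B using h by (simp add: set_lebesgue_integral_def has_integral_iff)
qed

lemma integrable_powr_1inf:
  assumes "(a::real) < -1"
  shows "integrable lborel (\<lambda>z. indicator {1..} z * z powr a)" (is ?A)
    and "(LINT z|lborel. indicator {1..} z * z powr a) = - 1 / (a + 1)" (is ?B)
proof -
  have h: "((\<lambda>z. z powr a) has_integral (- (1 powr (a+1)) / (a+1))) {1..}"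
    by (rule has_integral_powr_to_inf) (use assms in auto)
  then have "(\<lambda>z. z powr a) absolutely_integrable_on {1..}"
    by (intro nonnegative_absolutely_integrable_1) (auto simp: has_integral_iff)
  then have i: "set_integrable lborel {1..} (\<lambda>z. z powr a)"
    unfolding set_integrable_def by (subst (asm) integrable_completion) auto
  then show ?A by (simp add: set_integrable_def)
  have "(LINT z:{1..}|lborel. z powr a) = integral {1..} (\<lambda>z. z powr a)"
    by (rule set_borel_integral_eq_integral(2)[OF i])
  then show ?B using h by (simp add: set_lebesgue_integral_def has_integral_iff)
qed

lemma integrable_dom_fun_frac_ker:
  assumes "1/4 < s" "s < 1"
  shows "integrable lborel (\<lambda>z. dom_fun z * frac_ker s z)"
proof (rule Bochner_Integration.integrable_bound)
  show "integrable lborel (\<lambda>z::real. indicator {0..1} z * z powr (1 - 2 * s) + indicator {1..} z * z powr (-1/2 - 2 * s))"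
    using assms by (intro Bochner_Integration.integrable_add integrable_powr_01 integrable_powr_1inf) auto
  show "(\<lambda>z. dom_fun z * frac_ker s z) \<in> borel_measurable lborel" by measurable
  show "AE z in lborel. norm (dom_fun z * frac_ker s z) \<le> norm (indicator {0..1} z * z powr (1 - 2 * s) + indicator {1..} z * z powr (-1/2 - 2 * s))"
  proof (rule AE_I2)
    fix z :: real
    have 1: "z\<^sup>2 * z powr (-1-2 * s) = z powr (1 - 2 * s)" if "0 < z"
      using that by (simp flip: powr_numeral powr_add)
    have 2: "sqrt z * z powr (-1-2 * s) = z powr (-1/2 - 2 * s)" if "0 < z"
      using that by (simp flip: powr_half_sqrt powr_add)
    show "norm (dom_fun z * frac_ker s z) \<le> norm (indicator {0..1} z * z powr (1 - 2 * s) + indicator {1..} z * z powr (-1/2 - 2 * s))"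
      using 1 2 by (auto simp: dom_fun_def frac_ker_def indicator_def)
  qed
qed

lemma ln_le_dom_fun:
  assumes "0 < z" shows "ln (1 + z\<^sup>2) \<le> 4 * dom_fun z"
proof (cases "z \<le> 1")
  case True
  have "ln (1 + z\<^sup>2) \<le> z\<^sup>2" by (rule ln_add_one_self_le_self) auto
  also have "\<dots> \<le> 4 * z\<^sup>2" by auto
  finally show ?thesis using True by (simp add: dom_fun_def)
next
  case False
  have "ln (1 + z\<^sup>2) \<le> ln (2 * z\<^sup>2)" using False one_le_power[of z 2] by (subst ln_le_cancel_iff) (auto intro: add_pos_pos)
  also have "\<dots> = ln 2 + 4 * ln (sqrt z)" using False assms by (simp add: ln_mult ln_sqrt power2_eq_square)
  also have "ln (2::real) \<le> 2 - 1" by (rule ln_le_minus_one) auto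
  also have "ln (sqrt z) \<le> sqrt z - 1" by (rule ln_le_minus_one) (use assms in auto)
  finally show ?thesis using False by (simp add: dom_fun_def)
qed

lemma integrable_ln_frac_ker:
  assumes "1/4 < s" "s < 1"
  shows "integrable lborel (\<lambda>z. ln (1 + z\<^sup>2) * frac_ker s z)"
proof (rule Bochner_Integration.integrable_bound)
  show "integrable lborel (\<lambda>z. 4 * (dom_fun z * frac_ker s z))"
    using integrable_dom_fun_frac_ker[OF assms] by simp
  show "AE z in lborel. norm (ln (1 + z\<^sup>2) * frac_ker s z) \<le> norm (4 * (dom_fun z * frac_ker s z))"
    using ln_le_dom_fun by (intro AE_I2) (auto simp: frac_ker_def abs_mult)
qed measurable

text \<open>Keeps the dissipation from degenerating as s varies; the later numerical constants rest
  on this 1/10. The integral being inverted is small because 1 - cos z is at most z^2 / 2 near 0 and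
  at most 2 elsewhere.\<close>

lemma frac_lap_const_ge:
  assumes s: "9/20 < s" "s \<le> 1/2"
  shows "1/10 \<le> frac_lap_const s"
proof -
  let ?F = "\<lambda>z::real. (1 - cos z) / \<bar>z\<bar> powr (1 + 2 * s)"
  let ?G = "\<lambda>z::real. indicator {0..1} z * z powr (1 - 2 * s) / 2 + 2 * (indicator {1..} z * z powr (-1 - 2 * s))"
  have G: "integrable lborel ?G"
    using s by (intro Bochner_Integration.integrable_add integrable_mult_right integrable_divide integrable_powr_01 integrable_powr_1inf) auto
  have intG: "(LINT z|lborel. ?G z) = 1 / (4 - 4 * s) + 1 / s"
  proof -
    have 1: "(LINT z|lborel. indicator {0..1} z * z powr (1 - 2 * s) / 2) = 1 / (4 - 4 * s)"
      using integrable_powr_01(2)[of "1 - 2 * s"] s by (simp add: field_simps)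
    have 2: "(LINT z|lborel. 2 * (indicator {1..} z * z powr (-1 - 2 * s))) = 1 / s"
      using integrable_powr_1inf(2)[of "-1 - 2 * s"] s by simp
    show ?thesis
      using s by (subst Bochner_Integration.integral_add, unfold 1 2)
        (auto intro!: integrable_mult_right integrable_divide integrable_powr_01 integrable_powr_1inf)
  qed
  have G': "integrable lborel (\<lambda>z. ?G (- z))" "(LINT z|lborel. ?G (- z)) = (LINT z|lborel. ?G z)"
    using lborel_integrable_real_affine[OF G, of "-1" 0] lborel_integral_real_affine[of "-1" ?G 0] by auto
  have dom: "0 \<le> ?F z" "?F z \<le> ?G z + ?G (- z)" for z
  proof -
    show "0 \<le> ?F z" by simp
    have pos: "?F z \<le> ?G z" if z: "0 < z" for z :: real
    proof (cases "z \<le> 1")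
      case True
      have "1 - cos z \<le> z\<^sup>2 / 2"
      proof -
        have "cos z = 1 - 2 * (sin (z/2))\<^sup>2" using cos_double_sin[of "z/2"] by simp
        moreover have "(sin (z/2))\<^sup>2 \<le> (z/2)\<^sup>2"
          using abs_sin_x_le_abs_x[of "z/2"] by (rule abs_le_square_iff[THEN iffD1])
        ultimately show ?thesis by (simp add: power2_eq_square)
      qed
      then have "(1 - cos z) / z powr (1 + 2 * s) \<le> (z\<^sup>2 / 2) / z powr (1 + 2 * s)"
        by (rule divide_right_mono) simp
      then have "?F z \<le> (z\<^sup>2 / 2) / z powr (1 + 2 * s)" using z by simp
      also have "\<dots> = z powr (1 - 2 * s) / 2"
      proof -
        have "z powr (1 - 2 * s) = z powr 2 / z powr (1 + 2 * s)"
          by (subst powr_diff[symmetric]) (simp add: algebra_simps)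
        then show ?thesis using z by simp
      qed
      also have "\<dots> \<le> ?G z" using True z by (auto simp: indicator_def)
      finally show ?thesis .
    next
      case False
      have "?F z \<le> 2 / z powr (1 + 2 * s)"
        using z cos_ge_minus_one[of z] by (auto intro!: divide_right_mono)
      also have "\<dots> = 2 * z powr (-1 - 2 * s)"
        by (simp add: divide_powr_uminus)
      also have "\<dots> = ?G z" using False by (auto simp: indicator_def)
      finally show ?thesis .
    qed
    have Gnn: "0 \<le> ?G z" for z by (auto simp: indicator_def)
    consider "z > 0" | "z < 0" | "z = 0" by linarith
    then show "?F z \<le> ?G z + ?G (- z)"
    proof cases
      case 1 then show ?thesis using pos[of z] Gnn[of "-z"] by linarith
    next
      case 2 then show ?thesis using pos[of "-z"] Gnn[of z] by simp
    next
      case 3 then show ?thesis using Gnn[of 0] by simp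
    qed
  qed
  have F: "integrable lborel ?F"
  proof (rule Bochner_Integration.integrable_bound)
    show "integrable lborel (\<lambda>z. ?G z + ?G (- z))" using G G'(1) by (rule Bochner_Integration.integrable_add)
    show "AE z in lborel. norm (?F z) \<le> norm (?G z + ?G (- z))"
    proof (rule AE_I2)
      fix z show "norm (?F z) \<le> norm (?G z + ?G (- z))" unfolding real_norm_def using dom[of z] by linarith
    qed
  qed measurable
  have "(LINT z|lborel. ?F z) \<le> (LINT z|lborel. ?G z + ?G (- z))"
    by (rule integral_mono[OF F]) (use G G' dom in \<open>auto intro!: Bochner_Integration.integrable_add\<close>)
  also have "\<dots> = (LINT z|lborel. ?G z) + (LINT z|lborel. ?G z)"
    unfolding Bochner_Integration.integral_add[OF G G'(1)] G'(2) ..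
  also have "\<dots> \<le> (1 / 2 + 1 / (9/20)) + (1 / 2 + 1 / (9/20))"
  proof -
    have "1 / (4 - 4 * s) \<le> 1 / 2" "1 / s \<le> 1 / (9/20)"
      using s by (auto simp: divide_simps)
    then show ?thesis unfolding intG by (intro add_mono)
  qed
  finally have le: "(LINT z|lborel. ?F z) \<le> 10" by simp
  \<comment> \<open>Since \<open>inverse 0 = 0\<close>, the upper bound on the integral bounds its
    inverse from below only once the integral is known to be positive.\<close>
  have "(LINT z|lborel. ?F z) \<noteq> 0"
  proof
    assume "(LINT z|lborel. ?F z) = 0"
    then have "AE z in lborel. ?F z = 0"
      using integral_nonneg_eq_0_iff_AE[OF F] dom by auto
    then have "AE z in lborel. z \<notin> {1..2::real}"
    proof eventually_elim
      case (elim z)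
      have "cos z < 1" if "z \<in> {1..2}"
        using cos_monotone_0_pi[of 0 z] that pi_gt3 by auto
      then show ?case using elim by auto
    qed
    then have "emeasure lborel {1..2::real} = 0"
      by (subst (asm) AE_iff_measurable[of "{1..2}"]) auto
    then show False by simp
  qed
  moreover have "0 \<le> (LINT z|lborel. ?F z)" by (intro integral_nonneg_AE AE_I2) (use dom in auto)
  ultimately have pos: "0 < (LINT z|lborel. ?F z)" by linarith
  have "inverse 10 \<le> inverse (LINT z|lborel. ?F z)" by (rule le_imp_inverse_le[OF le pos])
  then show ?thesis by (simp add: frac_lap_const_def)
qed

section \<open>The fractional Laplacian as an integral of second differences\<close>

definition sdiff :: "(real \<Rightarrow> real) \<Rightarrow> real \<Rightarrow> real \<Rightarrow> real" where
  "sdiff f x z = f (x + z) + f (x - z) - 2 * f x"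

text \<open>Up to the factor \<open>- frac_lap_const s\<close> this is the fractional Laplacian; taking second differences
  turns the principal value into an absolutely convergent integral.\<close>

definition frac_diff :: "real \<Rightarrow> (real \<Rightarrow> real) \<Rightarrow> real \<Rightarrow> real" where
  "frac_diff s f x = (LINT z|lborel. sdiff f x z * frac_ker s z)"

definition bdd_C2 :: "(real \<Rightarrow> real) \<Rightarrow> (real \<Rightarrow> real) \<Rightarrow> (real \<Rightarrow> real) \<Rightarrow> bool" where
  "bdd_C2 f f' f'' \<longleftrightarrow> (\<forall>x. (f has_real_derivative f' x) (at x)) \<and>
     (\<forall>x. (f' has_real_derivative f'' x) (at x)) \<and> continuous_on UNIV f'' \<and> (\<exists>B. \<forall>x. \<bar>f x\<bar> \<le> B)"

lemma bdd_C2_continuous: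
  assumes "bdd_C2 f f' f''"
  shows "continuous_on A f" "continuous_on A f'" "continuous_on A f''"
    "f \<in> borel_measurable borel"
proof -
  have d: "(f has_real_derivative f' x) (at x)" "(f' has_real_derivative f'' x) (at x)" for x
    using assms unfolding bdd_C2_def by blast+
  show f: "continuous_on A f" for A
    by (rule DERIV_continuous_on[OF has_field_derivative_at_within[OF d(1)]])
  show "continuous_on A f'"
    by (rule DERIV_continuous_on[OF has_field_derivative_at_within[OF d(2)]])
  show "continuous_on A f''"
    using assms continuous_on_subset by (auto simp: bdd_C2_def)
  show "f \<in> borel_measurable borel"
    using f[of UNIV] by (rule borel_measurable_continuous_onI)
qed

text \<open>The mean value theorem twice: in z for the symmetric sum, then for f' between x - w and
  x + w.\<close>

lemma sdiff_le_square:
  assumes f: "\<And>y. (f has_real_derivative f' y) (at y)" "\<And>y. (f' has_real_derivative f'' y) (at y)"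
    and C: "\<And>y. y \<in> {x - z..x + z} \<Longrightarrow> \<bar>f'' y\<bar> \<le> C" and z: "0 < z"
  shows "\<bar>sdiff f x z\<bar> \<le> 2 * C * z\<^sup>2"
proof -
  have C0: "0 \<le> C" using C[of x] z by force
  have d: "((\<lambda>z. f (x + z) + f (x - z)) has_real_derivative f' (x + w) - f' (x - w)) (at w)" for w
    by (auto intro!: derivative_eq_intros f DERIV_chain2[where f = f])
  obtain w where w: "0 < w" "w < z"
      "(f (x + z) + f (x - z)) - (f (x + 0) + f (x - 0)) = (z - 0) * (f' (x + w) - f' (x - w))"
    using MVT2[OF z, of "\<lambda>z. f (x + z) + f (x - z)" "\<lambda>w. f' (x + w) - f' (x - w)"] d by blast
  have "x - w < x + w" using w by simp
  then obtain v where v: "x - w < v" "v < x + w" "f' (x + w) - f' (x - w) = (x + w - (x - w)) * f'' v"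
    using MVT2[of "x - w" "x + w" f' f''] f by blast
  have "\<bar>sdiff f x z\<bar> = z * (2 * w * \<bar>f'' v\<bar>)"
    using w v z by (simp add: sdiff_def abs_mult)
  also have "\<dots> \<le> z * (2 * z * C)"
    using w v z C[of v] C0 by (intro mult_mono) auto
  finally show ?thesis by (simp add: power2_eq_square algebra_simps)
qed

text \<open>As f'' is merely continuous, the constant is uniform only over compact sets of x. This
  uniformity is what Fubini over a segment of base points needs later.\<close>

lemma sdiff_le_dom_fun:
  assumes f: "bdd_C2 f f' f''"
  obtains C where "0 \<le> C" "\<And>x z. x \<in> {a..b} \<Longrightarrow> 0 < z \<Longrightarrow> \<bar>sdiff f x z\<bar> \<le> C * dom_fun z"
proof -
  obtain B where B: "\<And>x. \<bar>f x\<bar> \<le> B" using f by (auto simp: bdd_C2_def)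
  have "compact (f'' ` {a - 1..b + 1})"
    by (intro compact_continuous_image bdd_C2_continuous[OF f]) auto
  then obtain C where C: "\<And>y. y \<in> {a - 1..b + 1} \<Longrightarrow> \<bar>f'' y\<bar> \<le> C"
    using compact_imp_bounded bounded_iff by (metis imageI real_norm_def)
  have B0: "0 \<le> B" using B[of 0] by linarith
  show thesis
  proof
    show "0 \<le> 2 * \<bar>C\<bar> + 4 * B" using B0 by auto
    fix x z :: real assume x: "x \<in> {a..b}" and z: "0 < z"
    show "\<bar>sdiff f x z\<bar> \<le> (2 * \<bar>C\<bar> + 4 * B) * dom_fun z"
    proof (cases "z \<le> 1")
      case True
      have "\<bar>sdiff f x z\<bar> \<le> 2 * \<bar>C\<bar> * z\<^sup>2"
      proof (rule sdiff_le_square[OF _ _ _ z])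
        fix y assume "y \<in> {x - z..x + z}"
        then show "\<bar>f'' y\<bar> \<le> \<bar>C\<bar>" using C[of y] x True by auto
      qed (use f in \<open>auto simp: bdd_C2_def\<close>)
      also have "\<dots> \<le> (2 * \<bar>C\<bar> + 4 * B) * z\<^sup>2" using B0 by (intro mult_right_mono) auto
      finally show ?thesis using True by (simp add: dom_fun_def)
    next
      case False
      have "\<bar>sdiff f x z\<bar> \<le> 4 * B"
        using B[of "x + z"] B[of "x - z"] B[of x] unfolding sdiff_def by linarith
      also have "\<dots> \<le> (2 * \<bar>C\<bar> + 4 * B) * sqrt z"
        using False B0 mult_mono[of "4 * B" "2 * \<bar>C\<bar> + 4 * B" 1 "sqrt z"] by auto
      finally show ?thesis using False by (simp add: dom_fun_def)
    qed
  qed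
qed

lemma sdiff_measurable [measurable]:
  assumes [measurable]: "f \<in> borel_measurable borel"
  shows "(\<lambda>z. sdiff f x z) \<in> borel_measurable borel"
  unfolding sdiff_def by measurable

lemma abs_mult_frac_ker_le:
  assumes "0 < z \<Longrightarrow> \<bar>w\<bar> \<le> C"
  shows "\<bar>w * frac_ker s z\<bar> \<le> C * frac_ker s z"
proof (cases "0 < z")
  case True
  from mult_right_mono[OF assms[OF this] frac_ker_nonneg] show ?thesis by (simp add: abs_mult)
qed (simp add: frac_ker_def)

lemma integrable_sdiff_frac_ker:
  assumes f: "bdd_C2 f f' f''" and s: "1/4 < s" "s < 1"
  shows "integrable lborel (\<lambda>z. sdiff f x z * frac_ker s z)"
proof -
  obtain C where C: "0 \<le> C" "\<And>y z. y \<in> {x..x} \<Longrightarrow> 0 < z \<Longrightarrow> \<bar>sdiff f y z\<bar> \<le> C * dom_fun z"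
    by (rule sdiff_le_dom_fun[OF f, where a = x and b = x]) (rule that)
  note [measurable] = bdd_C2_continuous(4)[OF f]
  show ?thesis
  proof (rule Bochner_Integration.integrable_bound)
    show "integrable lborel (\<lambda>z. C * (dom_fun z * frac_ker s z))"
      using integrable_dom_fun_frac_ker[OF s] by simp
    show "AE z in lborel. norm (sdiff f x z * frac_ker s z) \<le> norm (C * (dom_fun z * frac_ker s z))"
    proof (rule AE_I2)
      fix z :: real
      from abs_mult_frac_ker_le[OF C(2)[of x z], where s = s and z = z]
      show "norm (sdiff f x z * frac_ker s z) \<le> norm (C * (dom_fun z * frac_ker s z))"
        using C(1) by (simp add: mult.assoc abs_mult)
    qed
  qed measurable
qed

text \<open>The truncated integral splits into y > x and y < x. The substitutions y = x + z and y =
  x - z carry both parts to z > \<delta>, where they add up to a second difference; only then is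
  \<delta> sent to 0.\<close>

lemma frac_lap_eq_frac_diff:
  assumes f: "bdd_C2 f f' f''" and s: "1/4 < s" "s < 1"
  shows "frac_lap s f x = - frac_lap_const s * frac_diff s f x"
proof -
  note [measurable] = bdd_C2_continuous(4)[OF f]
  obtain B where B: "\<And>x. \<bar>f x\<bar> \<le> B" using f by (auto simp: bdd_C2_def)
  have B0: "0 \<le> B" using B[of 0] by linarith
  have eq: "(LINT y:{y. \<delta> < \<bar>x - y\<bar>}|lborel. (f x - f y) / \<bar>x - y\<bar> powr (1 + 2 * s))
      = (LINT z|lborel. indicator {\<delta><..} z * - (sdiff f x z * frac_ker s z))" if \<delta>: "0 < \<delta>" for \<delta>
  proof -
    let ?H = "\<lambda>(\<sigma>::real) z. indicator {\<delta><..} z * ((f x - f (x + \<sigma> * z)) * frac_ker s z)"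
    have H: "integrable lborel (?H \<sigma>)" for \<sigma>
    proof (rule Bochner_Integration.integrable_bound)
      let ?m = "min (\<delta>\<^sup>2) 1"
      show "integrable lborel (\<lambda>z. (2 * B / ?m) * (dom_fun z * frac_ker s z))"
        using integrable_dom_fun_frac_ker[OF s] by simp
      show "AE z in lborel. norm (?H \<sigma> z) \<le> norm ((2 * B / ?m) * (dom_fun z * frac_ker s z))"
      proof (rule AE_I2)
        fix z :: real
        have "?m \<le> dom_fun z" if "\<delta> < z"
        proof (cases "z \<le> 1")
          case True
          have "?m \<le> \<delta>\<^sup>2" by simp
          also have "\<dots> \<le> z\<^sup>2" using that \<delta> by (intro power_mono) auto
          finally show ?thesis using True by (simp add: dom_fun_def)
        next
          case False
          have "?m \<le> 1" by simp
          also have "1 \<le> sqrt z" using False by simp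
          finally show ?thesis using False by (simp add: dom_fun_def)
        qed
        then have "2 * B \<le> (2 * B / ?m) * dom_fun z" if "\<delta> < z"
          using that \<delta> B0 mult_left_mono[of ?m "dom_fun z" "2 * B"] by (simp add: field_simps)
        moreover have "\<bar>f x - f (x + \<sigma> * z)\<bar> \<le> 2 * B"
          using B[of x] B[of "x + \<sigma> * z"] by linarith
        ultimately have "\<bar>f x - f (x + \<sigma> * z)\<bar> \<le> (2 * B / ?m) * dom_fun z" if "\<delta> < z" using that by force
        then have "\<bar>f x - f (x + \<sigma> * z)\<bar> * frac_ker s z \<le> ((2 * B / ?m) * dom_fun z) * frac_ker s z" if "\<delta> < z"
          using that by (intro mult_right_mono) auto
        then show "norm (?H \<sigma> z) \<le> norm ((2 * B / ?m) * (dom_fun z * frac_ker s z))"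
          using B0 \<delta> by (auto simp: indicator_def abs_mult mult.assoc)
      qed
    qed measurable
    have H1: "integrable lborel (\<lambda>y. ?H \<sigma> (- \<sigma> * x + \<sigma> * y))"
       "(LINT y|lborel. ?H \<sigma> (- \<sigma> * x + \<sigma> * y)) = (LINT z|lborel. ?H \<sigma> z)" if "\<sigma> = 1 \<or> \<sigma> = -1" for \<sigma>
      using lborel_integrable_real_affine[OF H[of \<sigma>], where c = \<sigma> and t = "- \<sigma> * x"] lborel_integral_real_affine[of \<sigma> "?H \<sigma>" "- \<sigma> * x"] that by auto
    have "(LINT y:{y. \<delta> < \<bar>x - y\<bar>}|lborel. (f x - f y) / \<bar>x - y\<bar> powr (1 + 2 * s))
       = (LINT y|lborel. ?H 1 (- 1 * x + 1 * y) + ?H (-1) (- (-1) * x + (-1) * y))"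
      unfolding set_lebesgue_integral_def
    proof (rule Bochner_Integration.integral_cong[OF refl])
      fix y
      have p: "w powr (-1 - 2 * s) = 1 / w powr (1 + 2 * s)" for w :: real
      proof -
        have "-1 - 2 * s = - (1 + 2 * s)" by simp
        then show ?thesis by (simp only: powr_minus_divide)
      qed
      show "indicator {y. \<delta> < \<bar>x - y\<bar>} y *\<^sub>R ((f x - f y) / \<bar>x - y\<bar> powr (1 + 2 * s))
         = ?H 1 (- 1 * x + 1 * y) + ?H (-1) (- (-1) * x + (-1) * y)"
        using \<delta> by (auto simp: indicator_def frac_ker_def p)
    qed
    also have "\<dots> = (LINT z|lborel. ?H 1 z) + (LINT z|lborel. ?H (-1) z)"
      using Bochner_Integration.integral_add[OF H1(1)[of 1] H1(1)[of "-1"]] H1(2)[of 1] H1(2)[of "-1"] by simp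
    also have "\<dots> = (LINT z|lborel. ?H 1 z + ?H (-1) z)"
      by (rule Bochner_Integration.integral_add[OF H[of 1] H[of "-1"], symmetric])
    also have "\<dots> = (LINT z|lborel. indicator {\<delta><..} z * - (sdiff f x z * frac_ker s z))"
      by (rule Bochner_Integration.integral_cong) (auto simp: sdiff_def algebra_simps)
    finally show ?thesis .
  qed
  \<comment> \<open>Dominated convergence, with \<delta> written as inverse t and t tending to
    infinity.\<close>
  have "((\<lambda>t. LINT z|lborel. indicator {inverse t<..} z * - (sdiff f x z * frac_ker s z)) \<longlongrightarrow>
      (LINT z|lborel. - (sdiff f x z * frac_ker s z))) at_top"
  proof (rule integral_dominated_convergence_at_top)
    show "integrable lborel (\<lambda>z. \<bar>sdiff f x z * frac_ker s z\<bar>)"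
      using integrable_sdiff_frac_ker[OF f s] by (rule integrable_abs)
    show "AE z in lborel. ((\<lambda>t. indicator {inverse t<..} z * - (sdiff f x z * frac_ker s z)) \<longlongrightarrow> - (sdiff f x z * frac_ker s z)) at_top"
    proof (rule AE_I2)
      fix z :: real
      show "((\<lambda>t. indicator {inverse t<..} z * - (sdiff f x z * frac_ker s z)) \<longlongrightarrow> - (sdiff f x z * frac_ker s z)) at_top"
      proof (cases "0 < z")
        case True
        have "\<forall>\<^sub>F t in at_top. inverse t < z"
          using order_tendstoD(2)[OF tendsto_inverse_0_at_top[OF filterlim_ident] True] .
        then have "\<forall>\<^sub>F t in at_top. indicator {inverse t<..} z * - (sdiff f x z * frac_ker s z) = - (sdiff f x z * frac_ker s z)"
          by eventually_elim simp
        then show ?thesis by (rule tendsto_eventually)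
      qed (simp add: frac_ker_def)
    qed
    show "\<forall>\<^sub>F t in at_top. AE z in lborel. norm (indicator {inverse t<..} z * - (sdiff f x z * frac_ker s z)) \<le> \<bar>sdiff f x z * frac_ker s z\<bar>"
      by (intro always_eventually allI AE_I2) (auto simp: indicator_def)
  qed measurable
  then have "((\<lambda>\<delta>. LINT z|lborel. indicator {\<delta><..} z * - (sdiff f x z * frac_ker s z)) \<longlongrightarrow> - frac_diff s f x) (at_right 0)"
    by (simp add: filterlim_at_right_to_top frac_diff_def)
  then have "((\<lambda>\<delta>. LINT y:{y. \<delta> < \<bar>x - y\<bar>}|lborel. (f x - f y) / \<bar>x - y\<bar> powr (1 + 2 * s)) \<longlongrightarrow> - frac_diff s f x) (at_right 0)"
    by (rule Lim_transform_eventually) (use eq in \<open>auto simp: eventually_at_right_less eventually_at_filter\<close>)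
  then have "Lim (at_right 0) (\<lambda>\<delta>. LINT y:{y. \<delta> < \<bar>x - y\<bar>}|lborel. (f x - f y) / \<bar>x - y\<bar> powr (1 + 2 * s)) = - frac_diff s f x"
    by (intro tendsto_Lim) auto
  then show ?thesis by (simp add: frac_lap_def)
qed

section \<open>Means over segments\<close>

definition seg_mean :: "real \<Rightarrow> (real \<Rightarrow> real) \<Rightarrow> real \<Rightarrow> real" where
  "seg_mean h f x = integral {0..1} (\<lambda>r. f (x + h * r))"

lemma integrable_01_continuous:
  fixes f :: "real \<Rightarrow> real"
  assumes "continuous_on {0..1} f"
  shows "integrable lborel (\<lambda>r. indicator {0..1} r * f r)"
    "(LINT r|lborel. indicator {0..1} r * f r) = integral {0..1} f"
  using borel_integrable_atLeastAtMost'[OF assms] set_borel_integral_eq_integral(2)[of "{0..1}" f]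
  by (auto simp: set_integrable_def set_lebesgue_integral_def)

lemma continuous_shift:
  fixes f :: "real \<Rightarrow> real"
  assumes "continuous_on UNIV f"
  shows "continuous_on A (\<lambda>r. f (x + h * r))"
  by (rule continuous_on_compose2[OF assms]) (auto intro!: continuous_intros)

text \<open>Matching the segments through the common parameter r lets one lemma compare a mean with
  a constant, with a mean of another length, and with a mean at another base point.\<close>

lemma seg_mean_mono:
  fixes f g :: "real \<Rightarrow> real"
  assumes "continuous_on UNIV f" "continuous_on UNIV g" "\<And>r. 0 \<le> r \<Longrightarrow> r \<le> 1 \<Longrightarrow> f (x + h * r) \<le> g (y + k * r)"
  shows "seg_mean h f x \<le> seg_mean k g y"
  unfolding seg_mean_def
  by (intro integral_le integrable_continuous_real continuous_shift) (use assms in auto)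

lemma seg_mean_const [simp]: "seg_mean h (\<lambda>_. c) x = c"
  by (simp add: seg_mean_def)

lemma seg_mean_bound:
  assumes "continuous_on UNIV f" "\<And>y. \<bar>f y\<bar> \<le> B"
  shows "\<bar>seg_mean h f x\<bar> \<le> B"
proof -
  have "seg_mean h f x \<le> seg_mean 0 (\<lambda>_. B) 0"
    using assms by (intro seg_mean_mono) (auto simp: abs_le_iff)
  moreover have "seg_mean 0 (\<lambda>_. - B) 0 \<le> seg_mean h f x"
  proof (intro seg_mean_mono)
    show "- B \<le> f (x + h * r)" for r using assms(2)[of "x + h * r"] by linarith
  qed (use assms in auto)
  ultimately show ?thesis by auto
qed

lemma DERIV_affine:
  assumes f: "\<And>y. (f has_real_derivative f' y) (at y)"
  shows "((\<lambda>r. f (x + h * r)) has_real_derivative f' (x + h * r) * h) (at r within S)"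
    "((\<lambda>y. f (y + k)) has_real_derivative f' (r + k)) (at r within S)"
proof -
  have "((\<lambda>r. x + h * r) has_real_derivative h) (at r within S)"
    by (auto intro!: derivative_eq_intros)
  from DERIV_chain2[OF f this] show "((\<lambda>r. f (x + h * r)) has_real_derivative f' (x + h * r) * h) (at r within S)" .
  have "((\<lambda>r. r + k) has_real_derivative 1) (at r within S)"
    by (auto intro!: derivative_eq_intros)
  from DERIV_chain2[OF f this] show "((\<lambda>y. f (y + k)) has_real_derivative f' (r + k)) (at r within S)" by simp
qed

lemma seg_mean_deriv:
  assumes f: "\<And>y. (f has_real_derivative f' y) (at y)" and f': "continuous_on UNIV f'" and h: "h \<noteq> 0"
  shows "(seg_mean h f has_real_derivative (f (x + h) - f x) / h) (at x)"
    "seg_mean h f' x = (f (x + h) - f x) / h"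
proof -
  have ftc: "((\<lambda>r. f' (x + h * r)) has_integral (f (x + h * 1) / h - f (x + h * 0) / h)) {0..1}"
  proof (intro fundamental_theorem_of_calculus)
    fix r :: real
    from DERIV_cdivide[OF DERIV_affine(1)[OF f, where x = x and h = h and r = r and S = "{0..1}"], of h]
    show "((\<lambda>r. f (x + h * r) / h) has_vector_derivative f' (x + h * r)) (at r within {0..1})"
      using h by (simp flip: has_real_derivative_iff_has_vector_derivative)
  qed simp
  then show 2: "seg_mean h f' x = (f (x + h) - f x) / h"
    by (simp add: seg_mean_def has_integral_iff diff_divide_distrib)
  have cf: "continuous_on UNIV f" by (rule DERIV_continuous_on[OF has_field_derivative_at_within[OF f]])
  have "((\<lambda>x. integral (cbox 0 1) (\<lambda>r. f (x + h * r))) has_field_derivative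
     integral (cbox 0 1) (\<lambda>r. f' (x + h * r))) (at x within UNIV)"
  proof (rule leibniz_rule_field_derivative)
    show "continuous_on (UNIV \<times> cbox 0 1) (\<lambda>(x, t). f' (x + h * t))"
      unfolding split_def
      by (rule continuous_on_compose2[OF f']) (auto intro!: continuous_intros)
    show "(\<lambda>r. f (x + h * r)) integrable_on cbox 0 1" for x
      unfolding cbox_interval by (intro integrable_continuous_real continuous_shift cf)
    show "((\<lambda>x. f (x + h * t)) has_real_derivative f' (x + h * t)) (at x within UNIV)" for x t
      by (rule DERIV_affine(2)[OF f])
  qed auto
  then show "(seg_mean h f has_real_derivative (f (x + h) - f x) / h) (at x)"
    using 2 by (simp add: seg_mean_def[abs_def] cbox_interval)
qed

text \<open>Averaging replaces one derivative by a difference quotient, so that the derivative of a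
  mean is controlled by h and the supremum of f alone.\<close>

lemma seg_mean_C2:
  assumes f: "bdd_C2 f f' f''" and h: "h \<noteq> 0"
  shows "bdd_C2 (seg_mean h f) (\<lambda>x. (f (x + h) - f x) / h) (\<lambda>x. (f' (x + h) - f' x) / h)"
proof -
  note c = bdd_C2_continuous[OF f]
  have d: "(f has_real_derivative f' x) (at x)" "(f' has_real_derivative f'' x) (at x)" for x
    using f unfolding bdd_C2_def by blast+
  obtain B where "\<And>x. \<bar>f x\<bar> \<le> B" using f by (auto simp: bdd_C2_def)
  then have "\<exists>B. \<forall>x. \<bar>seg_mean h f x\<bar> \<le> B" using seg_mean_bound[OF c(1)] by blast
  moreover have "((\<lambda>x. (f (x + h) - f x) / h) has_real_derivative (f' (x + h) - f' x) / h) (at x)" for x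
    by (intro DERIV_cdivide DERIV_diff DERIV_affine(2) d)
  moreover have "continuous_on UNIV (\<lambda>x. (f' (x + h) - f' x) / h)"
    by (auto intro!: continuous_intros continuous_on_compose2[OF c(2)] h)
  ultimately show ?thesis
    unfolding bdd_C2_def using seg_mean_deriv[OF d(1) c(2) h] by blast
qed

lemma sdiff_seg_mean:
  assumes "continuous_on UNIV f"
  shows "sdiff (seg_mean h f) x z = integral {0..1} (\<lambda>r. sdiff f (x + h * r) z)"
proof -
  have i: "(\<lambda>r. f (x + h * r)) integrable_on {0..1}" for x
    by (intro integrable_continuous_real continuous_shift assms)
  have eq: "(\<lambda>r. sdiff f (x + h * r) z) = (\<lambda>r. (f ((x + z) + h * r) + f ((x - z) + h * r)) - 2 * f (x + h * r))"
    by (auto simp: sdiff_def algebra_simps)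
  have "((\<lambda>r. sdiff f (x + h * r) z) has_integral (seg_mean h f (x + z) + seg_mean h f (x - z) - 2 * seg_mean h f x)) {0..1}"
    unfolding eq seg_mean_def
    by (intro has_integral_diff has_integral_add has_integral_mult_right integrable_integral i)
  then show ?thesis by (simp add: sdiff_def has_integral_iff)
qed

text \<open>Fubini. The integrand is dominated by one multiple of
  \<open>dom_fun z * frac_ker s z\<close> for all base points on the segment.\<close>

lemma frac_diff_seg_mean:
  assumes f: "bdd_C2 f f' f''" and s: "1/4 < s" "s < 1"
  shows "(\<lambda>r. frac_diff s f (x + h * r)) integrable_on {0..1}" "seg_mean h (frac_diff s f) x = frac_diff s (seg_mean h f) x"
proof -
  note c = bdd_C2_continuous[OF f]
  note [measurable] = c(4)
  obtain C where C: "0 \<le> C" "\<And>y z. y \<in> {x - \<bar>h\<bar>..x + \<bar>h\<bar>} \<Longrightarrow> 0 < z \<Longrightarrow> \<bar>sdiff f y z\<bar> \<le> C * dom_fun z"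
    by (rule sdiff_le_dom_fun[OF f, where a = "x - \<bar>h\<bar>" and b = "x + \<bar>h\<bar>"]) (rule that)
  have C': "\<bar>sdiff f (x + h * r) z\<bar> \<le> C * dom_fun z" if "r \<in> {0..1}" "0 < z" for r z
  proof -
    have "\<bar>h * r\<bar> \<le> \<bar>h\<bar>" using that mult_left_mono[of r 1 "\<bar>h\<bar>"] by (auto simp: abs_mult)
    then show ?thesis using that by (intro C) (auto simp: abs_le_iff)
  qed
  let ?P = "\<lambda>(r, z). indicator {0..1} r * (sdiff f (x + h * r) z * frac_ker s z)"
  let ?Q = "\<lambda>(r::real, z). indicator {0..1} r * (C * (dom_fun z * frac_ker s z))"
  have mP: "?P \<in> borel_measurable (lborel \<Otimes>\<^sub>M lborel)"
    unfolding sdiff_def by measurable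
  have Q: "integrable (lborel \<Otimes>\<^sub>M lborel) ?Q"
  proof (rule lborel_pair.Fubini_integrable)
    have "integrable lborel (\<lambda>r::real. indicator {0..1} r * (LINT z|lborel. C * (dom_fun z * frac_ker s z)))"
      using integrable_01_continuous(1)[of "\<lambda>_. (LINT z|lborel. C * (dom_fun z * frac_ker s z))"] by auto
    moreover have "(LINT z|lborel. norm (?Q (r, z))) = indicator {0..1} r * (LINT z|lborel. C * (dom_fun z * frac_ker s z))" for r
      using C(1) by (auto simp: indicator_def abs_mult)
    ultimately show "integrable lborel (\<lambda>r. LINT z|lborel. norm (?Q (r, z)))" by simp
    show "AE r in lborel. integrable lborel (\<lambda>z. ?Q (r, z))"
      using integrable_dom_fun_frac_ker[OF s] by auto
  qed measurable
  have P: "integrable (lborel \<Otimes>\<^sub>M lborel) ?P"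
  proof (rule Bochner_Integration.integrable_bound[OF Q mP])
    show "AE p in lborel \<Otimes>\<^sub>M lborel. norm (?P p) \<le> norm (?Q p)"
    proof (rule AE_I2, clarify)
      fix r z :: real
      have "\<bar>sdiff f (x + h * r) z * frac_ker s z\<bar> \<le> C * dom_fun z * frac_ker s z" if "r \<in> {0..1}"
        by (rule abs_mult_frac_ker_le) (use C' that in blast)
      then show "norm (indicator {0..1} r * (sdiff f (x + h * r) z * frac_ker s z)) \<le> norm (indicator {0..1} r * (C * (dom_fun z * frac_ker s z)))"
        using C(1) by (auto simp: indicator_def mult.assoc)
    qed
  qed
  have NLr: "(LINT z|lborel. ?P (r, z)) = indicator {0..1} r *\<^sub>R frac_diff s f (x + h * r)" for r
    by (simp add: frac_diff_def)
  have "integrable lborel (\<lambda>r. LINT z|lborel. ?P (r, z))"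
    using lborel_pair.integrable_fst[OF P] by simp
  then have si: "set_integrable lborel {0..1} (\<lambda>r. frac_diff s f (x + h * r))"
    by (simp add: frac_diff_def set_integrable_def)
  from set_borel_integral_eq_integral[OF si]
  show "(\<lambda>r. frac_diff s f (x + h * r)) integrable_on {0..1}" by simp
  have "seg_mean h (frac_diff s f) x = (LINT r|lborel. (LINT z|lborel. ?P (r, z)))"
    using set_borel_integral_eq_integral(2)[OF si] unfolding seg_mean_def NLr by (simp add: set_lebesgue_integral_def)
  also have "\<dots> = (LINT z|lborel. (LINT r|lborel. ?P (r, z)))"
    using lborel_pair.Fubini_integral[OF P] by simp
  also have "\<dots> = (LINT z|lborel. sdiff (seg_mean h f) x z * frac_ker s z)"
  proof (rule Bochner_Integration.integral_cong[OF refl])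
    fix z :: real
    have "continuous_on {0..1} (\<lambda>r. sdiff f (x + h * r) z)"
      unfolding sdiff_def by (auto intro!: continuous_intros continuous_on_compose2[OF c(1)])
    from integrable_01_continuous(2)[OF this] show "(LINT r|lborel. ?P (r, z)) = sdiff (seg_mean h f) x z * frac_ker s z"
      by (simp add: sdiff_seg_mean[OF c(1)] flip: mult.assoc)
  qed
  finally show "seg_mean h (frac_diff s f) x = frac_diff s (seg_mean h f) x" by (simp add: frac_diff_def)
qed

section \<open>Touching points and penalisation\<close>

lemma continuous_on_joint:
  assumes "continuous_on (S \<times> T) (\<lambda>p. v (fst p) (snd p))" "continuous_on A f" "continuous_on A g"
    "\<And>a. a \<in> A \<Longrightarrow> f a \<in> S" "\<And>a. a \<in> A \<Longrightarrow> g a \<in> T"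
  shows "continuous_on A (\<lambda>a. v (f a) (g a))"
proof -
  have "continuous_on A (\<lambda>a. (f a, g a))" by (intro continuous_on_Pair assms)
  from continuous_on_compose2[OF assms(1) this] show ?thesis using assms(4,5) by force
qed

lemma DERIV_affine_at:
  assumes "(f has_real_derivative D) (at (x + k * w))"
  shows "((\<lambda>z. f (x + k * z)) has_real_derivative D * k) (at w)"
proof -
  have "((\<lambda>z. x + k * z) has_real_derivative k) (at w)"
    by (auto intro!: derivative_eq_intros)
  from DERIV_chain2[OF assms this] show ?thesis .
qed

text \<open>The skeleton of every maximum principle below. The region where \<Phi> is nonnegative is
  compact by \<open>far\<close>, so it has a point of smallest time, and \<Phi> is negative
  everywhere before that time.\<close>

lemma first_touch:
  fixes \<Phi> :: "'a::euclidean_space \<Rightarrow> real \<Rightarrow> real"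
  assumes S: "closed S" and t01: "t0 \<le> t1"
    and cont: "continuous_on (S \<times> {t0..t1}) (\<lambda>p. \<Phi> (fst p) (snd p))"
    and far: "\<And>x t. x \<in> S \<Longrightarrow> t \<in> {t0..t1} \<Longrightarrow> R < norm x \<Longrightarrow> \<Phi> x t < 0"
    and init: "\<And>x. x \<in> S \<Longrightarrow> \<Phi> x t0 < 0"
    and x1: "x1 \<in> S" "0 \<le> \<Phi> x1 t1"
  obtains x t where "x \<in> S" "t0 < t" "t \<le> t1" "\<Phi> x t = 0" "\<And>y. y \<in> S \<Longrightarrow> \<Phi> y t \<le> 0"
    "\<And>\<tau>. \<tau> \<in> {t0..t} \<Longrightarrow> \<Phi> x \<tau> \<le> 0"
proof -
  let ?f = "\<lambda>p. \<Phi> (fst p) (snd p)"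
  let ?K = "(S \<times> {t0..t1}) \<inter> ?f -` {0..}"
  have cl: "closed ?K"
    by (intro continuous_closed_preimage cont closed_Times S closed_atLeastAtMost closed_atLeast)
  have sub: "?K \<subseteq> cball 0 R \<times> {t0..t1}"
  proof
    fix p assume p: "p \<in> ?K"
    then have "\<not> R < norm (fst p)" using far[of "fst p" "snd p"] by auto
    with p show "p \<in> cball 0 R \<times> {t0..t1}" by (cases p) auto
  qed
  have "compact (cball (0::'a) R \<times> {t0..t1})" by (intro compact_Times compact_cball compact_Icc)
  from closed_Int_compact[OF cl this] have "compact ?K" using sub by (simp only: Int_absorb2)
  moreover have "(x1, t1) \<in> ?K" using x1 t01 by auto
  then have "?K \<noteq> {}" by blast
  ultimately obtain p where p: "p \<in> ?K" "\<And>q. q \<in> ?K \<Longrightarrow> snd p \<le> snd q"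
    using continuous_attains_inf[of ?K snd, OF _ _ continuous_on_snd[OF continuous_on_id]] by blast
  obtain x t where pxt: "p = (x, t)" by (cases p)
  have x: "x \<in> S" "t0 \<le> t" "t \<le> t1" "0 \<le> \<Phi> x t" using p pxt by auto
  have "t \<noteq> t0" using init[OF x(1)] x(4) by auto
  then have t: "t0 < t" using x(2) by simp
  have before: "\<Phi> y \<tau> < 0" if "y \<in> S" "t0 \<le> \<tau>" "\<tau> < t" for y \<tau>
  proof (rule ccontr)
    assume "\<not> \<Phi> y \<tau> < 0"
    then have "(y, \<tau>) \<in> ?K" using that x by auto
    from p(2)[OF this] show False using that pxt by simp
  qed
  have le0: "\<Phi> y t \<le> 0" if y: "y \<in> S" for y
  proof (rule ccontr)
    assume "\<not> \<Phi> y t \<le> 0"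
    have "continuous_on {t0..t1} (\<lambda>\<tau>. \<Phi> y \<tau>)"
      by (rule continuous_on_joint[OF cont]) (use y in \<open>auto intro: continuous_intros\<close>)
    then have "continuous_on {t0..t} (\<lambda>\<tau>. \<Phi> y \<tau>)" using x by (auto elim: continuous_on_subset)
    moreover have "\<Phi> y t0 \<le> 0" using init[OF y] by simp
    \<comment> \<open>Half of the value \<Phi> y t is attained at a time different from t, hence
      earlier, where \<Phi> should be negative.\<close>
    ultimately obtain \<tau> where \<tau>: "t0 \<le> \<tau>" "\<tau> \<le> t" "\<Phi> y \<tau> = \<Phi> y t / 2"
      using IVT'[of "\<lambda>\<tau>. \<Phi> y \<tau>" t0 "\<Phi> y t / 2" t] \<open>\<not> \<Phi> y t \<le> 0\<close> x by auto
    then show False using before[OF y, of \<tau>] \<open>\<not> \<Phi> y t \<le> 0\<close> by (cases "\<tau> = t") auto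
  qed
  show thesis
  proof
    show "\<Phi> x t = 0" using le0[OF x(1)] x(4) by simp
    show "\<Phi> x \<tau> \<le> 0" if "\<tau> \<in> {t0..t}" for \<tau>
      using before[OF x(1), of \<tau>] le0[OF x(1)] that by (cases "\<tau> = t") auto
  qed (use x t le0 in auto)
qed

text \<open>Only times up to t are controlled, and t may be the end of the time interval; hence an
  inequality instead of a vanishing derivative.\<close>

lemma DERIV_left_max:
  fixes f :: "real \<Rightarrow> real"
  assumes "(f has_real_derivative D) (at t)" "t0 < t" "\<And>\<tau>. \<tau> \<in> {t0..t} \<Longrightarrow> f \<tau> \<le> f t"
  shows "0 \<le> D"
proof (rule ccontr)
  assume "\<not> 0 \<le> D"
  then obtain d where d: "0 < d" "\<And>h. 0 < h \<Longrightarrow> h < d \<Longrightarrow> f t < f (t - h)"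
    using DERIV_neg_dec_left[OF assms(1)] by auto
  let ?h = "min (d / 2) (t - t0)"
  have "f t < f (t - ?h)" using d assms(2) by (intro d(2)) auto
  moreover have "f (t - ?h) \<le> f t" using d assms(2) by (intro assms(3)) auto
  ultimately show False by simp
qed

lemma DERIV_max_eq:
  fixes f g :: "real \<Rightarrow> real"
  assumes "(f has_real_derivative D) (at x)" "(g has_real_derivative D') (at x)" "0 < d"
    "\<And>y. \<bar>x - y\<bar> < d \<Longrightarrow> f y - g y \<le> f x - g x"
  shows "D = D'"
  using DERIV_local_max[OF DERIV_diff[OF assms(1,2)] assms(3)] assms(4) by auto

text \<open>If D > c, then f' (x + z) - f' (x - z) - 2 * c * z, the derivative in z of f (x + z) + f
  (x - z) - c * z^2, is positive for small z > 0, and this function rises above 2 * f x.\<close>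

lemma second_deriv_le:
  assumes f: "\<And>y. (f has_real_derivative f' y) (at y)" "(f' has_real_derivative D) (at x)"
    and le: "\<And>z. 0 < z \<Longrightarrow> sdiff f x z \<le> c * z\<^sup>2"
  shows "D \<le> c"
proof (rule ccontr)
  assume D: "\<not> D \<le> c"
  let ?k = "\<lambda>z. f' (x + z) - f' (x - z) - 2 * c * z"
  have "(?k has_real_derivative 2 * D - 2 * c) (at 0)"
  proof -
    have 1: "((\<lambda>z. f' (x + z)) has_real_derivative D) (at 0)"
      using DERIV_affine_at[of f' D x 1 0] f(2) by simp
    have 2: "((\<lambda>z. f' (x - z)) has_real_derivative - D) (at 0)"
      using DERIV_affine_at[of f' D x "-1" 0] f(2) by simp
    have 3: "((\<lambda>z. 2 * c * z) has_real_derivative 2 * c) (at 0)" by (auto intro!: derivative_eq_intros)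
    show ?thesis using DERIV_diff[OF DERIV_diff[OF 1 2] 3] by simp
  qed
  then obtain d where d: "0 < d" "\<And>h. 0 < h \<Longrightarrow> h < d \<Longrightarrow> ?k 0 < ?k (0 + h)"
    using DERIV_pos_inc_right[of ?k "2 * D - 2 * c" 0] D by auto
  let ?z = "d / 2"
  have "((\<lambda>z. f (x + z) + f (x - z) - c * z\<^sup>2) has_real_derivative ?k w) (at w)" for w
  proof -
    have 1: "((\<lambda>z. f (x + z)) has_real_derivative f' (x + w)) (at w)"
      using DERIV_affine_at[OF f(1), where x = x and k = 1 and w = w] by simp
    have 2: "((\<lambda>z. f (x - z)) has_real_derivative - f' (x - w)) (at w)"
      using DERIV_affine_at[OF f(1), where x = x and k = "-1" and w = w] by simp
    have 3: "((\<lambda>z. c * z\<^sup>2) has_real_derivative 2 * c * w) (at w)" by (auto intro!: derivative_eq_intros)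
    show ?thesis using DERIV_diff[OF DERIV_add[OF 1 2] 3] by simp
  qed
  from MVT2[of 0 ?z, OF _ this] obtain w where w: "0 < w" "w < ?z"
    "f (x + ?z) + f (x - ?z) - c * ?z\<^sup>2 - (f x + f x) = ?z * ?k w" using d(1) by auto
  have "0 < ?k w" using d(2)[of w] w d(1) by simp
  then have "0 < ?z * ?k w" using d(1) by (intro mult_pos_pos) auto
  then show False using le[of ?z] d(1) w(3) unfolding sdiff_def by linarith
qed

text \<open>The penalty that forces maxima on the line to be attained. It tends to infinity, yet its
  slope is at most 1 and its second differences are bounded, uniformly in x, by a function
  integrable against the kernel. A quadratic weight would fail the last point, since z^2 is not
  integrable against the kernel at infinity.\<close>

definition log_weight :: "real \<Rightarrow> real" where
  "log_weight x = ln (1 + x\<^sup>2)"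

lemma one_plus_square_pos [simp]: "0 < 1 + (x::real)\<^sup>2"
  by (simp add: add_pos_nonneg)

lemma log_weight_nonneg [simp]: "0 \<le> log_weight x"
  by (simp add: log_weight_def)

lemma log_weight_deriv:
  "(log_weight has_real_derivative 2 * x / (1 + x\<^sup>2)) (at x)" "\<bar>2 * x / (1 + x\<^sup>2)\<bar> \<le> 1"
proof -
  show "(log_weight has_real_derivative 2 * x / (1 + x\<^sup>2)) (at x)"
    unfolding log_weight_def[abs_def] using one_plus_square_pos[of x]
    by (auto intro!: derivative_eq_intros simp: field_simps)
  have "2 * \<bar>x\<bar> \<le> 1 + x\<^sup>2"
    using sum_squares_ge_zero[of "\<bar>x\<bar> - 1" 0] by (simp add: power2_eq_square algebra_simps)
  then show "\<bar>2 * x / (1 + x\<^sup>2)\<bar> \<le> 1"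
    by (simp add: abs_mult abs_of_pos)
qed

lemma log_weight_deriv_scaled:
  assumes "0 \<le> (\<eta>::real)"
  shows "\<bar>\<eta> * (2 * x / (1 + x\<^sup>2))\<bar> \<le> \<eta>"
  using assms mult_left_mono[OF log_weight_deriv(2)[of x], of \<eta>] by (simp only: abs_mult[of \<eta>] abs_of_nonneg mult_1_right)

lemma continuous_on_log_weight [continuous_intros]:
  "continuous_on A f \<Longrightarrow> continuous_on A (\<lambda>x. log_weight (f x))"
proof -
  assume f: "continuous_on A f"
  have "1 + (f x)\<^sup>2 \<noteq> 0" for x using one_plus_square_pos[of "f x"] by linarith
  then show ?thesis unfolding log_weight_def by (intro continuous_on_ln continuous_intros f) blast
qed

lemma log_weight_coercive: "exp K < \<bar>x\<bar> \<Longrightarrow> K < log_weight x"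
proof -
  assume K: "exp K < \<bar>x\<bar>"
  have "\<bar>x\<bar> \<le> 1 + x\<^sup>2"
    using sum_squares_ge_zero[of "\<bar>x\<bar> - 1" 0] by (simp add: power2_eq_square algebra_simps)
  then have "exp K < 1 + x\<^sup>2" using K by linarith
  then show ?thesis unfolding log_weight_def using ln_less_cancel_iff[of "exp K" "1 + x\<^sup>2"] by simp
qed

text \<open>After exponentiation this compares two polynomials whose difference is a sum of even
  monomials with nonnegative coefficients. No x on the right: the cost of the penalty does not
  depend on where touching occurs.\<close>

lemma sdiff_log_weight_le: "sdiff log_weight x z \<le> 2 * ln (1 + z\<^sup>2)"
proof -
  have nz: "1 + w\<^sup>2 \<noteq> 0" for w :: real using one_plus_square_pos[of w] by linarith
  have "(1 + (x + z)\<^sup>2) * (1 + (x - z)\<^sup>2) \<le> ((1 + x\<^sup>2) * (1 + z\<^sup>2))\<^sup>2"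
  proof -
    have "((1 + x\<^sup>2) * (1 + z\<^sup>2))\<^sup>2 - (1 + (x + z)\<^sup>2) * (1 + (x - z)\<^sup>2)
      = 2 * x\<^sup>2 * z\<^sup>2 + 4 * x\<^sup>2 * z\<^sup>2 + 2 * x\<^sup>2 * z ^ 4 + 2 * x ^ 4 * z\<^sup>2 + x ^ 4 * z ^ 4"
      by (simp add: power2_eq_square power4_eq_xxxx algebra_simps)
    also have "\<dots> \<ge> 0" by (intro add_nonneg_nonneg mult_nonneg_nonneg) auto
    finally show ?thesis by linarith
  qed
  then have "ln ((1 + (x + z)\<^sup>2) * (1 + (x - z)\<^sup>2)) \<le> ln (((1 + x\<^sup>2) * (1 + z\<^sup>2))\<^sup>2)"
    by (subst ln_le_cancel_iff) (auto intro!: mult_pos_pos simp: nz)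
  also have "\<dots> = 2 * (ln (1 + x\<^sup>2) + ln (1 + z\<^sup>2))"
    using one_plus_square_pos[of x] one_plus_square_pos[of z]
    by (simp add: ln_realpow ln_mult_pos less_imp_neq[symmetric] del: one_plus_square_pos)
  finally show ?thesis by (simp add: sdiff_def log_weight_def ln_mult_pos)
qed

lemma log_weight_add_le: "log_weight (x + z) \<le> log_weight x + ln (1 + z\<^sup>2) + 1"
proof -
  have "0 \<le> (x - z)\<^sup>2" "0 \<le> x\<^sup>2 * z\<^sup>2" by auto
  then have "1 + (x + z)\<^sup>2 \<le> 2 * ((1 + x\<^sup>2) * (1 + z\<^sup>2))"
    by (simp add: power2_eq_square algebra_simps)
  then have "log_weight (x + z) \<le> ln (2 * ((1 + x\<^sup>2) * (1 + z\<^sup>2)))"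
    unfolding log_weight_def by (subst ln_le_cancel_iff) (auto intro!: mult_pos_pos)
  also have "\<dots> = ln 2 + (log_weight x + ln (1 + z\<^sup>2))"
    by (simp add: log_weight_def ln_mult_pos mult_pos_pos)
  also have "ln (2::real) \<le> 2 - 1" by (rule ln_le_minus_one) auto
  finally show ?thesis by simp
qed

text \<open>The price of the penalty in the nonlocal term, per unit of its coefficient.\<close>

definition log_mass :: "real \<Rightarrow> real" where
  "log_mass s = (LINT z|lborel. ln (1 + z\<^sup>2) * frac_ker s z)"

lemma log_mass_nonneg: "0 \<le> log_mass s"
  unfolding log_mass_def by (intro integral_nonneg_AE AE_I2 mult_nonneg_nonneg) auto

lemma frac_diff_le:
  assumes f: "bdd_C2 f f' f''" and s: "1/4 < s" "s < 1"
    and le: "\<And>z. 0 < z \<Longrightarrow> sdiff f x z \<le> a * ln (1 + z\<^sup>2)"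
  shows "frac_diff s f x \<le> a * log_mass s"
proof -
  have "frac_diff s f x \<le> (LINT z|lborel. a * (ln (1 + z\<^sup>2) * frac_ker s z))"
    unfolding frac_diff_def
  proof (rule integral_mono)
    show "integrable lborel (\<lambda>z. sdiff f x z * frac_ker s z)" by (rule integrable_sdiff_frac_ker[OF f s])
    show "integrable lborel (\<lambda>z. a * (ln (1 + z\<^sup>2) * frac_ker s z))" using integrable_ln_frac_ker[OF s] by simp
    fix z :: real
    show "sdiff f x z * frac_ker s z \<le> a * (ln (1 + z\<^sup>2) * frac_ker s z)"
    proof (cases "0 < z")
      case True
      from mult_right_mono[OF le[OF True] frac_ker_nonneg] show ?thesis by (simp add: mult.assoc)
    qed (simp add: frac_ker_def)
  qed
  then show ?thesis by (simp add: log_mass_def)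
qed

lemma second_deriv_le_ln:
  assumes f: "bdd_C2 f f' f''" and a: "0 \<le> a"
    and le: "\<And>z. 0 < z \<Longrightarrow> sdiff f x z \<le> a * ln (1 + z\<^sup>2)"
  shows "f'' x \<le> a"
proof (rule second_deriv_le)
  show "(f has_real_derivative f' y) (at y)" "(f' has_real_derivative f'' x) (at x)" for y
    using f unfolding bdd_C2_def by blast+
  fix z :: real assume z: "0 < z"
  have "sdiff f x z \<le> a * ln (1 + z\<^sup>2)" by (rule le[OF z])
  also have "\<dots> \<le> a * z\<^sup>2" by (intro mult_left_mono a ln_add_one_self_le_self) auto
  finally show "sdiff f x z \<le> a * z\<^sup>2" .
qed

lemma continuous_seg_mean:
  assumes "continuous_on (UNIV \<times> T) (\<lambda>p. v (fst p) (snd p))"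
  shows "continuous_on (UNIV \<times> T) (\<lambda>p. seg_mean h (\<lambda>y. v y (snd p)) (fst p))"
proof -
  have "continuous_on (UNIV \<times> T) (\<lambda>p. integral (cbox 0 1) (\<lambda>r. v (fst p + h * r) (snd p)))"
  proof (rule integral_continuous_on_param)
    show "continuous_on ((UNIV \<times> T) \<times> cbox 0 1) (\<lambda>(p, r). v (fst p + h * r) (snd p))"
      unfolding split_def by (rule continuous_on_joint[OF assms]) (auto intro!: continuous_intros)
  qed
  then show ?thesis by (simp add: seg_mean_def cbox_interval)
qed

lemma seg_mean_DERIV_time:
  assumes T: "open T" "convex T"
    and v: "\<And>y \<tau>. \<tau> \<in> T \<Longrightarrow> ((\<lambda>\<tau>. v y \<tau>) has_real_derivative vt y \<tau>) (at \<tau>)"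
    and cv: "\<And>\<tau>. \<tau> \<in> T \<Longrightarrow> continuous_on UNIV (\<lambda>y. v y \<tau>)"
    and ct: "continuous_on (UNIV \<times> T) (\<lambda>p. vt (fst p) (snd p))" and t: "t \<in> T"
  shows "((\<lambda>\<tau>. seg_mean h (\<lambda>y. v y \<tau>) x) has_real_derivative seg_mean h (\<lambda>y. vt y t) x) (at t)"
proof -
  have "((\<lambda>\<tau>. integral (cbox 0 1) (\<lambda>r. v (x + h * r) \<tau>)) has_field_derivative
      integral (cbox 0 1) (\<lambda>r. vt (x + h * r) t)) (at t within T)"
  proof (rule leibniz_rule_field_derivative)
    show "continuous_on (T \<times> cbox 0 1) (\<lambda>(\<tau>, r). vt (x + h * r) \<tau>)"
      unfolding split_def by (rule continuous_on_joint[OF ct]) (auto intro!: continuous_intros)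
    show "(\<lambda>r. v (x + h * r) \<tau>) integrable_on cbox 0 1" if "\<tau> \<in> T" for \<tau>
      unfolding cbox_interval by (intro integrable_continuous_real continuous_shift cv that)
    show "((\<lambda>\<tau>. v (x + h * r) \<tau>) has_real_derivative vt (x + h * r) \<tau>) (at \<tau> within T)" if "\<tau> \<in> T" for \<tau> r
      by (rule has_field_derivative_at_within[OF v[OF that]])
  qed (fact t, fact T(2))
  then show ?thesis unfolding at_within_open[OF t T(1)] by (simp only: seg_mean_def cbox_interval)
qed

section \<open>A priori estimates for the viscous equation\<close>

text \<open>Here c stands for the normalizing constant of the fractional Laplacian. The hypothesis
  \<open>bdd\<close> is qualitative: it keeps the comparison functions negative far out, and its
  bound does not appear in the decay, Oleinik and Hoelder estimates.\<close>

locale visc_burgers =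
  fixes s \<epsilon> c :: real and u ut ux uxx :: "real \<Rightarrow> real \<Rightarrow> real"
  assumes s: "9/20 < s" "s \<le> 1/2" and eps: "0 < \<epsilon>" and c: "1/10 \<le> c"
    and DERIV_t: "0 < t \<Longrightarrow> ((\<lambda>\<tau>. u x \<tau>) has_real_derivative ut x t) (at t)"
    and DERIV_x: "0 < t \<Longrightarrow> ((\<lambda>y. u y t) has_real_derivative ux x t) (at x)"
    and DERIV_xx: "0 < t \<Longrightarrow> ((\<lambda>y. ux y t) has_real_derivative uxx x t) (at x)"
    and cont_u: "continuous_on (UNIV \<times> {0<..}) (\<lambda>p. u (fst p) (snd p))"
    and cont_ut: "continuous_on (UNIV \<times> {0<..}) (\<lambda>p. ut (fst p) (snd p))"
    and cont_uxx: "continuous_on (UNIV \<times> {0<..}) (\<lambda>p. uxx (fst p) (snd p))"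
    and pde: "0 < t \<Longrightarrow> ut x t = - (u x t * ux x t) + c * frac_diff s (\<lambda>y. u y t) x + \<epsilon> * uxx x t"
    and bdd: "0 < t0 \<Longrightarrow> \<exists>B. \<forall>x. \<forall>t\<ge>t0. \<bar>u x t\<bar> \<le> B"
begin

lemma s': "1/4 < s" "s < 1" "0 < s"
  using s by auto

lemma c_pos: "0 < c"
  using c by auto

lemma slice_cont:
  assumes "0 < t"
  shows "continuous_on A (\<lambda>y. u y t)" "continuous_on A (\<lambda>y. ut y t)" "continuous_on A (\<lambda>y. uxx y t)"
    "continuous_on A (\<lambda>y. ux y t)"
  by (rule continuous_on_joint[OF cont_u] continuous_on_joint[OF cont_ut] continuous_on_joint[OF cont_uxx];
      use assms in \<open>auto intro: continuous_intros\<close>)+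
     (rule DERIV_continuous_on[OF has_field_derivative_at_within[OF DERIV_xx[OF assms]]])

lemma slice_C2: "0 < t \<Longrightarrow> bdd_C2 (\<lambda>y. u y t) (\<lambda>y. ux y t) (\<lambda>y. uxx y t)"
  unfolding bdd_C2_def using DERIV_x DERIV_xx slice_cont(3) bdd[of t] by blast

lemma frac_diff_reflect: "frac_diff s (\<lambda>y. - f (- y)) x = - frac_diff s f (- x)"
proof -
  have "sdiff (\<lambda>y. - f (- y)) x z * frac_ker s z = - (sdiff f (- x) z * frac_ker s z)" for z
    by (simp add: sdiff_def algebra_simps)
  then show ?thesis by (simp add: frac_diff_def)
qed

text \<open>The symmetry of the equation that turns upper bounds for solutions into lower
  bounds.\<close>

lemma reflect:
  "visc_burgers s \<epsilon> c (\<lambda>x t. - u (- x) t) (\<lambda>x t. - ut (- x) t) (\<lambda>x t. ux (- x) t) (\<lambda>x t. - uxx (- x) t)"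
proof
  fix t x :: real assume t: "0 < t"
  show "((\<lambda>\<tau>. - u (- x) \<tau>) has_real_derivative - ut (- x) t) (at t)"
    by (intro DERIV_minus DERIV_t t)
  show "((\<lambda>y. - u (- y) t) has_real_derivative ux (- x) t) (at x)"
    using DERIV_minus[OF DERIV_affine_at[of "\<lambda>y. u y t" "ux (- x) t" 0 "-1" x]] DERIV_x[OF t, of "- x"] by simp
  show "((\<lambda>y. ux (- y) t) has_real_derivative - uxx (- x) t) (at x)"
    using DERIV_affine_at[of "\<lambda>y. ux y t" "uxx (- x) t" 0 "-1" x] DERIV_xx[OF t, of "- x"] by simp
  show "- ut (- x) t = - (- u (- x) t * ux (- x) t) + c * frac_diff s (\<lambda>y. - u (- y) t) x + \<epsilon> * - uxx (- x) t"
    using pde[OF t, of "- x"] frac_diff_reflect[of "\<lambda>y. u y t" x] by simp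
next
  fix t0 :: real assume "0 < t0"
  from bdd[OF this] obtain B where "\<forall>x. \<forall>t\<ge>t0. \<bar>u x t\<bar> \<le> B" by blast
  then show "\<exists>B. \<forall>x. \<forall>t\<ge>t0. \<bar>- u (- x) t\<bar> \<le> B" by (intro exI[of _ B]) simp
qed (use s eps c in \<open>auto intro!: continuous_on_minus continuous_on_joint[OF cont_u] continuous_on_joint[OF cont_ut]
       continuous_on_joint[OF cont_uxx] continuous_intros\<close>)

text \<open>The flux is quadratic, so its difference over the segment factors: the average of the
  two end values times the spatial derivative of the mean. The mean thus satisfies a drift-diffusion
  equation with bounded drift.\<close>

lemma seg_mean_pde:
  assumes t: "0 < t" and h: "h \<noteq> 0"
  shows "seg_mean h (\<lambda>y. ut y t) x = - ((u (x + h) t + u x t) / 2 * ((u (x + h) t - u x t) / h))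
    + c * frac_diff s (seg_mean h (\<lambda>y. u y t)) x + \<epsilon> * ((ux (x + h) t - ux x t) / h)"
proof -
  note C2 = slice_C2[OF t]
  have d: "((\<lambda>y. (u y t)\<^sup>2 / 2) has_real_derivative u y t * ux y t) (at y)" for y
    using DERIV_cdivide[OF DERIV_power[OF DERIV_x[OF t, of y], of 2], of 2] by (simp add: mult.commute)
  have cd: "continuous_on UNIV (\<lambda>y. u y t * ux y t)"
    by (intro continuous_on_mult slice_cont t)
  have 1: "((\<lambda>r. u (x + h * r) t * ux (x + h * r) t) has_integral ((u (x + h) t)\<^sup>2 / 2 - (u x t)\<^sup>2 / 2) / h) {0..1}"
    using seg_mean_deriv(2)[OF d cd h, of x] integrable_integral[OF integrable_continuous_real[OF continuous_shift[OF cd, of "{0..1}" x h]]]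
    by (simp add: seg_mean_def)
  have 2: "((\<lambda>r. frac_diff s (\<lambda>y. u y t) (x + h * r)) has_integral frac_diff s (seg_mean h (\<lambda>y. u y t)) x) {0..1}"
    using frac_diff_seg_mean[OF C2 s'(1,2), where x = x and h = h] by (simp add: seg_mean_def has_integral_iff)
  have 3: "((\<lambda>r. uxx (x + h * r) t) has_integral (ux (x + h) t - ux x t) / h) {0..1}"
    using seg_mean_deriv(2)[OF DERIV_xx[OF t] slice_cont(3)[OF t] h, of x]
      integrable_integral[OF integrable_continuous_real[OF continuous_shift[OF slice_cont(3)[OF t], of "{0..1}" x h]]]
    by (simp add: seg_mean_def)
  have "((\<lambda>r. ut (x + h * r) t) has_integral (- (((u (x + h) t)\<^sup>2 / 2 - (u x t)\<^sup>2 / 2) / h)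
    + c * frac_diff s (seg_mean h (\<lambda>y. u y t)) x + \<epsilon> * ((ux (x + h) t - ux x t) / h))) {0..1}"
    unfolding pde[OF t]
    by (intro has_integral_add has_integral_neg has_integral_mult_right 1 2 3)
  then have "seg_mean h (\<lambda>y. ut y t) x = - (((u (x + h) t)\<^sup>2 / 2 - (u x t)\<^sup>2 / 2) / h)
    + c * frac_diff s (seg_mean h (\<lambda>y. u y t)) x + \<epsilon> * ((ux (x + h) t - ux x t) / h)"
    by (simp add: seg_mean_def has_integral_iff)
  also have "((u (x + h) t)\<^sup>2 / 2 - (u x t)\<^sup>2 / 2) / h = (u (x + h) t + u x t) / 2 * ((u (x + h) t - u x t) / h)"
    by (simp add: power2_eq_square field_simps)
  finally show ?thesis .
qed

lemma seg_mean_time: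
  assumes "0 < t"
  shows "((\<lambda>\<tau>. seg_mean h (\<lambda>y. u y \<tau>) x) has_real_derivative seg_mean h (\<lambda>y. ut y t) x) (at t)"
  by (rule seg_mean_DERIV_time[where T = "{0<..}"]) (use assms DERIV_t slice_cont(1) cont_ut in auto)

lemma cont_seg_mean: "continuous_on (UNIV \<times> {0<..}) (\<lambda>p. seg_mean h (\<lambda>y. u y (snd p)) (fst p))"
  by (rule continuous_seg_mean[OF cont_u])

text \<open>At a spatial maximum of the average, its derivative \<open>(u (x + h) - u x) / h\<close> vanishes, and so
  does the contribution of the nonlinear term.\<close>

lemma seg_mean_le:
  assumes h: "h \<noteq> 0" and t1: "0 < t1"
    and init: "\<And>\<sigma>. 0 < \<sigma> \<Longrightarrow> \<forall>\<^sub>F t in at_right 0. \<forall>x. seg_mean h (\<lambda>y. u y t) x \<le> m + \<sigma>"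
  shows "seg_mean h (\<lambda>y. u y t1) x1 \<le> m"
proof (rule field_le_epsilon)
  fix \<sigma>' :: real assume "0 < \<sigma>'"
  define \<sigma> where "\<sigma> = \<sigma>' / 2"
  have \<sigma>: "0 < \<sigma>" using \<open>0 < \<sigma>'\<close> by (simp add: \<sigma>_def)
  have "\<forall>\<^sub>F t in at_right 0. 0 < t \<and> t < t1 \<and> (\<forall>x. seg_mean h (\<lambda>y. u y t) x \<le> m + \<sigma>)"
    by (intro eventually_conj init[OF \<sigma>] eventually_at_right_less eventually_at_rightI[of 0 t1]) (use t1 in auto)
  then obtain t0 where t0: "0 < t0" "t0 < t1" "\<And>x. seg_mean h (\<lambda>y. u y t0) x \<le> m + \<sigma>"
    using eventually_happens[of _ "at_right (0::real)"] by (auto simp: trivial_limit_at_right_real)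
  from bdd[OF t0(1)] obtain B where B: "\<And>x t. t0 \<le> t \<Longrightarrow> \<bar>u x t\<bar> \<le> B" by blast
  have B0: "0 \<le> B" using B[of t0 0] by linarith
  \<comment> \<open>The penalty must grow in time faster than it costs at a touching point: the
    drift, at most B, meets a weight slope of at most 1, the nonlocal term costs 2 * c * log_mass s,
    the viscous one 2 * \<epsilon>, each per unit of \<eta>. The added 1 makes the contradiction
    strict.\<close>
  define \<Lambda> where "\<Lambda> = B + 2 * c * log_mass s + 2 * \<epsilon> + 1"
  have \<Lambda>: "0 < \<Lambda>" using B0 c_pos eps log_mass_nonneg[of s] by (simp add: \<Lambda>_def add_nonneg_pos)
  have main: "seg_mean h (\<lambda>y. u y t1) x1 \<le> m + \<sigma> + \<eta> * (1 + \<Lambda> * (t1 - t0) + log_weight x1)" if \<eta>: "0 < \<eta>" for \<eta>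
  proof (rule ccontr)
    assume con: "\<not> ?thesis"
    define \<Phi> where "\<Phi> = (\<lambda>x t. seg_mean h (\<lambda>y. u y t) x - (m + \<sigma>) - \<eta> * (1 + \<Lambda> * (t - t0) + log_weight x))"
    define R where "R = exp ((B + \<bar>m + \<sigma>\<bar>) / \<eta>)"
    obtain x t where xt: "x \<in> UNIV" "t0 < t" "t \<le> t1" "\<Phi> x t = 0" "\<And>y. y \<in> UNIV \<Longrightarrow> \<Phi> y t \<le> 0"
      "\<And>\<tau>. \<tau> \<in> {t0..t} \<Longrightarrow> \<Phi> x \<tau> \<le> 0"
    proof (rule first_touch[of "UNIV :: real set" t0 t1 \<Phi> R x1])
      have sub: "UNIV \<times> {t0..t1} \<subseteq> UNIV \<times> {0<..}" using t0 by auto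
      show "continuous_on (UNIV \<times> {t0..t1}) (\<lambda>p. \<Phi> (fst p) (snd p))"
        unfolding \<Phi>_def by (intro continuous_intros continuous_on_subset[OF cont_seg_mean sub])
      fix x t :: real
      assume t: "t \<in> {t0..t1}" and R: "R < norm x"
      have "(B + \<bar>m + \<sigma>\<bar>) / \<eta> < log_weight x" using R by (intro log_weight_coercive) (simp add: R_def)
      then have "B + \<bar>m + \<sigma>\<bar> < \<eta> * log_weight x" using \<eta> by (simp add: field_simps)
      moreover have "\<bar>seg_mean h (\<lambda>y. u y t) x\<bar> \<le> B"
        using t t0 by (intro seg_mean_bound slice_cont B) auto
      moreover have "0 \<le> \<eta> * (1 + \<Lambda> * (t - t0))" using \<eta> \<Lambda> t by simp
      ultimately show "\<Phi> x t < 0" unfolding \<Phi>_def distrib_left[of \<eta> "1 + \<Lambda> * (t - t0)"] by linarith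
    next
      fix x show "\<Phi> x t0 < 0"
        using t0(3)[of x] mult_pos_pos[OF \<eta> add_pos_nonneg[OF zero_less_one log_weight_nonneg[of x]]] by (simp add: \<Phi>_def)
    next
      show "0 \<le> \<Phi> x1 t1" using con by (simp add: \<Phi>_def)
    qed (use t0 in auto)
    have tpos: "0 < t" using xt(2) t0 by simp
    note C2 = seg_mean_C2[OF slice_C2[OF tpos] h]
    let ?A = "seg_mean h (\<lambda>y. u y t)"
    have dt: "0 \<le> seg_mean h (\<lambda>y. ut y t) x - \<eta> * \<Lambda>"
    proof (rule DERIV_left_max[OF _ xt(2)])
      show "((\<lambda>t. \<Phi> x t) has_real_derivative seg_mean h (\<lambda>y. ut y t) x - \<eta> * \<Lambda>) (at t)"
        unfolding \<Phi>_def by (auto intro!: derivative_eq_intros seg_mean_time tpos)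
    qed (use xt in auto)
    have max: "?A y - \<eta> * log_weight y \<le> ?A x - \<eta> * log_weight x" for y
      using xt(5)[of y] xt(4) by (simp add: \<Phi>_def distrib_left)
    have dx: "(u (x + h) t - u x t) / h = \<eta> * (2 * x / (1 + x\<^sup>2))"
    proof (rule DERIV_max_eq[OF _ DERIV_cmult[OF log_weight_deriv(1)], of ?A _ x 1 \<eta>])
      show "(?A has_real_derivative (u (x + h) t - u x t) / h) (at x)"
        using C2 unfolding bdd_C2_def by blast
    qed (use max in auto)
    have sd: "sdiff ?A x z \<le> 2 * \<eta> * ln (1 + z\<^sup>2)" for z
    proof -
      have "sdiff ?A x z \<le> \<eta> * sdiff log_weight x z"
        using max[of "x + z"] max[of "x - z"] by (simp add: sdiff_def algebra_simps)
      also have "\<dots> \<le> \<eta> * (2 * ln (1 + z\<^sup>2))" using \<eta> sdiff_log_weight_le by (intro mult_left_mono) auto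
      finally show ?thesis by simp
    qed
    have "frac_diff s ?A x \<le> 2 * \<eta> * log_mass s" by (rule frac_diff_le[OF C2 s'(1,2) sd])
    then have 1: "c * frac_diff s ?A x \<le> c * (2 * \<eta> * log_mass s)" using c_pos by (intro mult_left_mono) auto
    have "(ux (x + h) t - ux x t) / h \<le> 2 * \<eta>"
      using second_deriv_le_ln[OF C2 _ sd] \<eta> by simp
    then have 2: "\<epsilon> * ((ux (x + h) t - ux x t) / h) \<le> \<epsilon> * (2 * \<eta>)" using eps by (intro mult_left_mono) auto
    have 3: "- ((u (x + h) t + u x t) / 2 * ((u (x + h) t - u x t) / h)) \<le> B * \<eta>"
    proof -
      have "\<bar>(u (x + h) t + u x t) / 2\<bar> \<le> B"
        using B[of t "x + h"] B[of t x] xt(2) by auto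
      moreover have "\<bar>\<eta> * (2 * x / (1 + x\<^sup>2))\<bar> \<le> \<eta>"
        using \<eta> by (intro log_weight_deriv_scaled) auto
      ultimately have "\<bar>(u (x + h) t + u x t) / 2\<bar> * \<bar>\<eta> * (2 * x / (1 + x\<^sup>2))\<bar> \<le> B * \<eta>"
        using B0 by (intro mult_mono) auto
      then show ?thesis unfolding dx by (simp only: abs_mult[symmetric])
    qed
    have "\<eta> * \<Lambda> \<le> B * \<eta> + c * (2 * \<eta> * log_mass s) + \<epsilon> * (2 * \<eta>)"
      using dt 1 2 3 unfolding seg_mean_pde[OF tpos h] by linarith
    also have "\<dots> = \<eta> * \<Lambda> - \<eta>" by (simp add: \<Lambda>_def algebra_simps)
    finally show False using \<eta> by simp
  qed
  define D where "D = 1 + \<Lambda> * (t1 - t0) + log_weight x1"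
  have D: "0 < D" using \<Lambda> t0 unfolding D_def by (intro add_pos_nonneg) auto
  from main[of "\<sigma> / D"] show "seg_mean h (\<lambda>y. u y t1) x1 \<le> m + \<sigma>'"
    using \<sigma> D by (simp add: D_def[symmetric] \<sigma>_def)
qed

end

text \<open>The function a * ln (1 + z^2) - sdiff f x z is nonnegative for z > 0, so only z between
  R and 2 * R need be kept. There the kernel is at least \<open>frac_ker s (2 * R)\<close>, and the
  second differences average to the means over [x + R, x + 2 * R] and [x - 2 * R, x - R]. Small
  means beside a large value therefore force dissipation.\<close>

lemma frac_diff_le_drop:
  assumes f: "bdd_C2 f f' f''" and s: "1/4 < s" "s < 1" and a: "0 \<le> a" and R: "0 < R"
    and le: "\<And>z. 0 < z \<Longrightarrow> sdiff f x z \<le> a * ln (1 + z\<^sup>2)"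
    and m: "seg_mean R f (x + R) \<le> m" "seg_mean (- R) f (x - R) \<le> m"
  shows "frac_diff s f x \<le> a * log_mass s - R * frac_ker s (2 * R) * (2 * f x - 2 * m)"
proof -
  note cf = bdd_C2_continuous(1)[OF f]
  let ?G = "\<lambda>z. (a * ln (1 + z\<^sup>2) - sdiff f x z) * frac_ker s z"
  have I: "integrable lborel (\<lambda>z. a * (ln (1 + z\<^sup>2) * frac_ker s z))" using integrable_ln_frac_ker[OF s] by simp
  have eq: "?G z = a * (ln (1 + z\<^sup>2) * frac_ker s z) - sdiff f x z * frac_ker s z" for z
    by (simp add: algebra_simps)
  have G: "integrable lborel ?G"
    unfolding eq by (rule Bochner_Integration.integrable_diff[OF I integrable_sdiff_frac_ker[OF f s]])
  have frac_diff: "frac_diff s f x = a * log_mass s - (LINT z|lborel. ?G z)"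
    unfolding eq Bochner_Integration.integral_diff[OF I integrable_sdiff_frac_ker[OF f s]] by (simp add: frac_diff_def log_mass_def)
  have cs: "continuous_on {0..1} (\<lambda>r. - sdiff f x (R + R * r))"
    unfolding sdiff_def by (intro continuous_intros continuous_on_compose2[OF cf[of UNIV]]) auto
  have seg_mean_eq: "(LINT r|lborel. indicator {0..1} r * - sdiff f x (R + R * r)) = 2 * f x - seg_mean R f (x + R) - seg_mean (- R) f (x - R)"
  proof -
    have "((\<lambda>r. 2 * f x - f ((x + R) + R * r) - f ((x - R) + (- R) * r)) has_integral
        2 * f x - seg_mean R f (x + R) - seg_mean (- R) f (x - R)) {0..1}"
      unfolding seg_mean_def using has_integral_const_real[of "2 * f x" 0 1]
      by (intro has_integral_diff integrable_integral integrable_continuous_real continuous_shift cf) simp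
    moreover have "2 * f x - f ((x + R) + R * r) - f ((x - R) + (- R) * r) = - sdiff f x (R + R * r)" for r
      by (simp add: sdiff_def algebra_simps)
    ultimately have "((\<lambda>r. - sdiff f x (R + R * r)) has_integral
        2 * f x - seg_mean R f (x + R) - seg_mean (- R) f (x - R)) {0..1}" by simp
    then show ?thesis unfolding integrable_01_continuous(2)[OF cs] by (rule integral_unique)
  qed
  have GR: "integrable lborel (\<lambda>r. ?G (R + R * r))"
    using lborel_integrable_real_affine[OF G, where c = R and t = R] R by simp
  have "R * (frac_ker s (2 * R) * (2 * f x - seg_mean R f (x + R) - seg_mean (- R) f (x - R)))
     = R * (LINT r|lborel. frac_ker s (2 * R) * (indicator {0..1} r * - sdiff f x (R + R * r)))"
    unfolding seg_mean_eq[symmetric] by simp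
  also have "\<dots> \<le> R * (LINT r|lborel. ?G (R + R * r))"
  proof (intro mult_left_mono integral_mono GR)
    show "integrable lborel (\<lambda>r. frac_ker s (2 * R) * (indicator {0..1} r * - sdiff f x (R + R * r)))"
      using integrable_01_continuous(1)[OF cs] by (rule integrable_mult_right)
    fix r :: real
    let ?z = "R + R * r"
    show "frac_ker s (2 * R) * (indicator {0..1} r * - sdiff f x ?z) \<le> ?G ?z"
    proof (cases "r \<in> {0..1}")
      case True
      then have z: "0 < ?z" "?z \<le> 2 * R" using R by (auto intro: add_pos_nonneg mult_left_le)
      have "frac_ker s (2 * R) * - sdiff f x ?z \<le> frac_ker s (2 * R) * (a * ln (1 + ?z\<^sup>2) - sdiff f x ?z)"
        using a by (intro mult_left_mono) auto
      also have "\<dots> \<le> frac_ker s ?z * (a * ln (1 + ?z\<^sup>2) - sdiff f x ?z)"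
        using le[OF z(1)] s z by (intro mult_right_mono frac_ker_antimono) auto
      finally show ?thesis using True by (simp add: mult.commute)
    next
      case False
      have "0 \<le> ?G ?z"
      proof (cases "0 < ?z")
        case True then show ?thesis using le[of ?z] by (intro mult_nonneg_nonneg) auto
      qed (simp add: frac_ker_def)
      then show ?thesis using False by simp
    qed
  qed (use R in auto)
  also have "\<dots> = (LINT z|lborel. ?G z)"
    using lborel_integral_real_affine[of R ?G R] R by simp
  finally have "R * (frac_ker s (2 * R) * (2 * f x - seg_mean R f (x + R) - seg_mean (- R) f (x - R))) \<le> (LINT z|lborel. ?G z)" .
  moreover have "R * (frac_ker s (2 * R) * (2 * f x - 2 * m)) \<le> R * (frac_ker s (2 * R) * (2 * f x - seg_mean R f (x + R) - seg_mean (- R) f (x - R)))"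
    using R m by (intro mult_left_mono) auto
  ultimately show ?thesis unfolding frac_diff by (simp add: mult.assoc)
qed

context visc_burgers
begin

text \<open>The barrier \<open>b (\<tau>) = 100 M \<tau>\<^bsup>-1/(4s)\<^esup>\<close> solves \<open>b' = - C b\<^bsup>1+4s\<^esup> / M\<^bsup>4s\<^esup>\<close>. Since the mean of \<open>u\<close> over
  intervals of length \<open>4 (M / b)\<^sup>2\<close> is at most half of its maximum \<open>b\<close>, the dissipation at the maximum
  is stronger than that.\<close>

lemma u_le_decay_from:
  assumes M: "0 < M" and seg_mean: "\<And>t h x. 0 < t \<Longrightarrow> h \<noteq> 0 \<Longrightarrow> seg_mean h (\<lambda>y. u y t) x \<le> M / sqrt \<bar>h\<bar>"
    and t0: "0 < t0" "t0 < t1"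
  shows "u x1 t1 \<le> 100 * M * (t1 - t0) powr (-1 / (4 * s))"
proof (rule field_le_epsilon)
  fix e :: real assume e: "0 < e"
  define p where "p = 1 / (4 * s)"
  define A where "A = 100 * M"
  have p: "0 < p" "p < 5/9" using s by (auto simp: p_def field_simps)
  have A: "0 < A" using M by (simp add: A_def)
  define b where "b = (\<lambda>t. A * (t - t0) powr (- p))"
  from bdd[OF t0(1)] obtain B where B: "\<And>x t. t0 \<le> t \<Longrightarrow> \<bar>u x t\<bar> \<le> B" by blast
  have B0: "0 \<le> B" using B[of t0 0] by linarith
  \<comment> \<open>The barrier is infinite at t0 and falls to B + 1 at t0 + q. Starting the
    comparison no later than that puts u below it.\<close>
  define q where "q = ((B + 1) / A) powr (-1 / p)"
  have q: "0 < q" using A B0 by (simp add: q_def)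
  define \<delta> where "\<delta> = min ((t1 - t0) / 2) q"
  have \<delta>: "0 < \<delta>" "\<delta> < t1 - t0" "\<delta> \<le> q" using q t0 by (auto simp: \<delta>_def min_def)
  have b\<delta>: "B + 1 \<le> b (t0 + \<delta>)"
  proof -
    have "q powr (- p) = (B + 1) / A"
      using A B0 p by (simp add: q_def powr_powr)
    moreover have "q powr (- p) \<le> \<delta> powr (- p)" using \<delta> p by (intro powr_mono2') auto
    ultimately have "(B + 1) / A \<le> \<delta> powr (- p)" by simp
    then show ?thesis using A by (simp add: b_def field_simps)
  qed
  define \<Lambda> where "\<Lambda> = B + 2 * c * log_mass s + 2 * \<epsilon> + 1"
  have \<Lambda>: "0 < \<Lambda>" using B0 c_pos eps log_mass_nonneg[of s] by (simp add: \<Lambda>_def add_nonneg_pos)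
  define D where "D = 1 + \<Lambda> * (t1 - t0) + log_weight x1"
  have D: "0 < D" using \<Lambda> t0 unfolding D_def by (intro add_pos_nonneg) auto
  define \<eta> where "\<eta> = e / D"
  have \<eta>: "0 < \<eta>" using e D by (simp add: \<eta>_def)
  have "u x1 t1 \<le> b t1 + \<eta> * D"
  proof (rule ccontr)
    assume con: "\<not> ?thesis"
    define \<Phi> where "\<Phi> = (\<lambda>x t. u x t - b t - \<eta> * (1 + \<Lambda> * (t - t0) + log_weight x))"
    have bpos: "0 < b t" if "t0 < t" for t using that A by (simp add: b_def)
    define R where "R = exp (B / \<eta>)"
    obtain x t where xt: "x \<in> UNIV" "t0 + \<delta> < t" "t \<le> t1" "\<Phi> x t = 0" "\<And>y. y \<in> UNIV \<Longrightarrow> \<Phi> y t \<le> 0"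
      "\<And>\<tau>. \<tau> \<in> {t0 + \<delta>..t} \<Longrightarrow> \<Phi> x \<tau> \<le> 0"
    proof (rule first_touch[of "UNIV :: real set" "t0 + \<delta>" t1 \<Phi> R x1])
      have sub: "UNIV \<times> {t0 + \<delta>..t1} \<subseteq> UNIV \<times> {0<..}" using t0 \<delta> by auto
      show "continuous_on (UNIV \<times> {t0 + \<delta>..t1}) (\<lambda>p. \<Phi> (fst p) (snd p))"
        unfolding \<Phi>_def b_def
        by (intro continuous_intros continuous_on_subset[OF cont_u sub]) (use \<delta> in auto)
      fix x t :: real
      assume t: "t \<in> {t0 + \<delta>..t1}" and R: "R < norm x"
      have "B / \<eta> < log_weight x" using R by (intro log_weight_coercive) (simp add: R_def)
      then have "B < \<eta> * log_weight x" using \<eta> by (simp add: field_simps)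
      moreover have "\<bar>u x t\<bar> \<le> B" using t \<delta> by (intro B) auto
      moreover have "0 \<le> \<eta> * (1 + \<Lambda> * (t - t0))" using \<eta> \<Lambda> t \<delta> by simp
      moreover have "0 < b t" using t \<delta> by (intro bpos) auto
      ultimately show "\<Phi> x t < 0" unfolding \<Phi>_def distrib_left[of \<eta> "1 + \<Lambda> * (t - t0)"] by linarith
    next
      fix x
      have "\<bar>u x (t0 + \<delta>)\<bar> \<le> B" using \<delta> by (intro B) auto
      moreover have "0 \<le> \<eta> * (1 + \<Lambda> * (t0 + \<delta> - t0) + log_weight x)"
        using \<eta> \<Lambda> \<delta> log_weight_nonneg[of x] by (intro mult_nonneg_nonneg add_nonneg_nonneg) auto
      ultimately show "\<Phi> x (t0 + \<delta>) < 0" unfolding \<Phi>_def using b\<delta> by linarith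
    next
      show "0 \<le> \<Phi> x1 t1" using con by (simp add: \<Phi>_def D_def)
    qed (use \<delta> in auto)
    have tt0: "t0 < t" using xt(2) \<delta> by simp
    have tpos: "0 < t" using tt0 t0 by simp
    define \<tau> where "\<tau> = t - t0"
    have \<tau>: "0 < \<tau>" using tt0 by (simp add: \<tau>_def)
    note C2 = slice_C2[OF tpos]
    let ?f = "\<lambda>y. u y t"
    have db: "(b has_real_derivative - p * (b t / \<tau>)) (at t)"
    proof -
      have "((\<lambda>t. (t - t0) powr (- p)) has_real_derivative - p * (t - t0) powr (- p - 1)) (at t)"
        using tt0 by (auto intro!: derivative_eq_intros simp: powr_diff)
      from DERIV_cmult[OF this, of A] show ?thesis
        using \<tau> by (simp add: b_def[abs_def] powr_diff \<tau>_def mult_ac)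
    qed
    have dt: "0 \<le> ut x t - (- p * (b t / \<tau>)) - \<eta> * \<Lambda>"
    proof (rule DERIV_left_max[OF _ xt(2)])
      show "((\<lambda>t. \<Phi> x t) has_real_derivative ut x t - (- p * (b t / \<tau>)) - \<eta> * \<Lambda>) (at t)"
        unfolding \<Phi>_def
      proof (intro DERIV_diff DERIV_t tpos db)
        show "((\<lambda>t. \<eta> * (1 + \<Lambda> * (t - t0) + log_weight x)) has_real_derivative \<eta> * \<Lambda>) (at t)"
          by (auto intro!: derivative_eq_intros)
      qed
    qed (use xt in auto)
    have max: "u y t - \<eta> * log_weight y \<le> u x t - \<eta> * log_weight x" for y
      using xt(5)[of y] xt(4) by (simp add: \<Phi>_def distrib_left)
    have ub: "b t \<le> u x t"
    proof -
      have "0 \<le> \<eta> * (1 + \<Lambda> * (t - t0) + log_weight x)"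
        using \<eta> \<Lambda> tt0 log_weight_nonneg[of x] by (intro mult_nonneg_nonneg add_nonneg_nonneg) auto
      then show ?thesis using xt(4) unfolding \<Phi>_def by linarith
    qed
    have dx: "ux x t = \<eta> * (2 * x / (1 + x\<^sup>2))"
      by (rule DERIV_max_eq[OF DERIV_x[OF tpos] DERIV_cmult[OF log_weight_deriv(1)], of 1 x \<eta>]) (use max in auto)
    have sd: "sdiff ?f x z \<le> 2 * \<eta> * ln (1 + z\<^sup>2)" for z
    proof -
      have "sdiff ?f x z \<le> \<eta> * sdiff log_weight x z"
        using max[of "x + z"] max[of "x - z"] by (simp add: sdiff_def algebra_simps)
      also have "\<dots> \<le> \<eta> * (2 * ln (1 + z\<^sup>2))" using \<eta> sdiff_log_weight_le by (intro mult_left_mono) auto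
      finally show ?thesis by simp
    qed
    define r where "r = 4 * (M / b t)\<^sup>2"
    have b0: "0 < b t" by (rule bpos[OF tt0])
    have r: "0 < r" using M b0 by (simp add: r_def)
    have sr: "M / sqrt r = b t / 2"
      using M b0 by (simp add: r_def real_sqrt_mult)
    have "frac_diff s ?f x \<le> 2 * \<eta> * log_mass s - r * frac_ker s (2 * r) * (2 * u x t - 2 * (b t / 2))"
      using seg_mean[OF tpos, of r "x + r"] seg_mean[OF tpos, of "- r" "x - r"] r \<eta> sd sr
      by (intro frac_diff_le_drop[OF C2 s'(1,2)]) auto
    also have "\<dots> \<le> 2 * \<eta> * log_mass s - r * frac_ker s (2 * r) * b t"
      using r ub by (intro diff_left_mono mult_left_mono) auto
    also have "\<dots> \<le> 2 * \<eta> * log_mass s - 10 * p * (b t / \<tau>)"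
    proof -
      \<comment> \<open>Here the factor 100 of the barrier is fixed. As 2 * r = 8 * (M / b)^2 and M
        / b = \<tau> powr p / 100 with 4 * s * p = 1, the product is 8 powr (-2 * s) * 100 powr (4 *
        s) / (2 * \<tau>), which is at least 6 / \<tau> because 2 * s \<le> 1 \<le> 4 * s. Since p <
        5/9, this exceeds 10 * p / \<tau>, and c \<ge> 1/10 leaves p / \<tau>, the relative rate at
        which the barrier falls.\<close>
      have rk: "r * frac_ker s (2 * r) = (2 * r) powr (- 2 * s) / 2"
      proof -
        have e: "-1 - 2 * s = - 2 * s - 1" by simp
        have "frac_ker s (2 * r) = (2 * r) powr (- 2 * s - 1)" using r unfolding frac_ker_def e by simp
        also have "\<dots> = (2 * r) powr (- 2 * s) / (2 * r)" using r by (subst powr_diff) auto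
        finally show ?thesis using r by simp
      qed
      have "(2 * r) powr (- 2 * s) = (8 * (M / b t) powr 2) powr (- 2 * s)" using M b0 by (simp add: r_def)
      also have "(8 * (M / b t) powr 2) powr (- 2 * s) = 8 powr (- 2 * s) * (M / b t) powr (- 4 * s)"
      proof -
        have "((M / b t) powr 2) powr (- 2 * s) = (M / b t) powr (2 * (- 2 * s))" by (rule powr_powr)
        then show ?thesis using M b0 powr_mult[of 8 "(M / b t) powr 2" "- 2 * s"] by simp
      qed
      also have "M / b t = \<tau> powr p / 100"
        using M \<tau> by (simp add: b_def A_def \<tau>_def powr_minus field_simps)
      also have "(\<tau> powr p / 100) powr (- 4 * s) = 100 powr (4 * s) / \<tau>"
      proof -
        have "(\<tau> powr p / 100) powr (- 4 * s) = \<tau> powr (p * (- 4 * s)) / 100 powr (- 4 * s)"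
          using \<tau> by (simp add: powr_divide powr_powr)
        also have "p * (- 4 * s) = - 1" using s by (simp add: p_def)
        finally show ?thesis using \<tau> by (simp add: powr_minus field_simps)
      qed
      finally have "r * frac_ker s (2 * r) = 8 powr (- 2 * s) * (100 powr (4 * s) / \<tau>) / 2"
        unfolding rk by simp
      moreover have "1 / 8 \<le> 8 powr (- 2 * s)"
      proof -
        have "8 powr (-1) \<le> 8 powr (- 2 * s)" using s by (intro powr_mono) auto
        then show ?thesis by (simp add: powr_minus)
      qed
      moreover have "100 \<le> (100::real) powr (4 * s)"
        using powr_mono[of 1 "4 * s" "100::real"] s by simp
      ultimately have "1 / 8 * 100 / (\<tau> * 2) \<le> r * frac_ker s (2 * r)"
        using \<tau> mult_mono[of "1 / 8" "8 powr (- 2 * s)" 100 "100 powr (4 * s)"]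
          divide_right_mono[of "1 / 8 * 100" "8 powr (- 2 * s) * 100 powr (4 * s)" "\<tau> * 2"]
        by simp
      then have "6 / \<tau> \<le> r * frac_ker s (2 * r)" using \<tau> by (simp add: field_simps)
      moreover have "10 * p / \<tau> \<le> 6 / \<tau>" using p \<tau> by (intro divide_right_mono) auto
      ultimately have "10 * p / \<tau> * b t \<le> r * frac_ker s (2 * r) * b t" using b0 by (intro mult_right_mono) auto
      then show ?thesis by simp
    qed
    finally have "c * frac_diff s ?f x \<le> c * (2 * \<eta> * log_mass s - 10 * p * (b t / \<tau>))"
      using c_pos by (intro mult_left_mono) auto
    also have "\<dots> = c * (2 * \<eta> * log_mass s) - (10 * c) * (p * (b t / \<tau>))" by (simp add: algebra_simps)
    also have "\<dots> \<le> c * (2 * \<eta> * log_mass s) - p * (b t / \<tau>)"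
      using mult_right_mono[of 1 "10 * c" "p * (b t / \<tau>)"] c p b0 \<tau> by simp
    finally have 1: "c * frac_diff s ?f x \<le> c * (2 * \<eta> * log_mass s) - p * (b t / \<tau>)" .
    have "uxx x t \<le> 2 * \<eta>"
      using second_deriv_le_ln[OF C2 _ sd] \<eta> by simp
    then have 2: "\<epsilon> * uxx x t \<le> \<epsilon> * (2 * \<eta>)" using eps by (intro mult_left_mono) auto
    have 3: "- (u x t * ux x t) \<le> B * \<eta>"
    proof -
      have "\<bar>u x t\<bar> * \<bar>\<eta> * (2 * x / (1 + x\<^sup>2))\<bar> \<le> B * \<eta>"
        using B0 B[of t x] tt0 \<eta> by (intro mult_mono log_weight_deriv_scaled) auto
      then show ?thesis unfolding dx by (simp only: abs_mult[symmetric])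
    qed
    have "\<eta> * \<Lambda> \<le> B * \<eta> + c * (2 * \<eta> * log_mass s) + \<epsilon> * (2 * \<eta>)"
      using dt 1 2 3 unfolding pde[OF tpos] by linarith
    also have "\<dots> = \<eta> * \<Lambda> - \<eta>" by (simp add: \<Lambda>_def algebra_simps)
    finally show False using \<eta> by simp
  qed
  then show "u x1 t1 \<le> 100 * M * (t1 - t0) powr (-1 / (4 * s)) + e"
    using D by (simp add: b_def A_def p_def \<eta>_def)
qed

lemma u_le_decay:
  assumes M: "0 < M" and seg_mean: "\<And>t h x. 0 < t \<Longrightarrow> h \<noteq> 0 \<Longrightarrow> seg_mean h (\<lambda>y. u y t) x \<le> M / sqrt \<bar>h\<bar>"
    and t1: "0 < t1"
  shows "u x1 t1 \<le> 100 * M * t1 powr (-1 / (4 * s))"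
proof (rule tendsto_lowerbound)
  have "((\<lambda>t0. 100 * M * (t1 - t0) powr (-1 / (4 * s))) \<longlongrightarrow> 100 * M * (t1 - 0) powr (-1 / (4 * s))) (at_right 0)"
    by (intro tendsto_intros) (use t1 in auto)
  then show "((\<lambda>t0. 100 * M * (t1 - t0) powr (-1 / (4 * s))) \<longlongrightarrow> 100 * M * t1 powr (-1 / (4 * s))) (at_right 0)"
    by simp
  have "\<forall>\<^sub>F t0 in at_right 0. t0 \<in> {0<..<t1}"
    using t1 by (rule eventually_at_rightI[of 0 t1, rotated]) auto
  then show "\<forall>\<^sub>F t0 in at_right 0. u x1 t1 \<le> 100 * M * (t1 - t0) powr (-1 / (4 * s))"
    by eventually_elim (use u_le_decay_from[OF M seg_mean] in auto)
qed simp

end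

section \<open>Comparison at two points\<close>

lemma diff_shift_C2:
  assumes "bdd_C2 f f' f''"
  shows "bdd_C2 (\<lambda>w. f (w + x) - f (w + y)) (\<lambda>w. f' (w + x) - f' (w + y)) (\<lambda>w. f'' (w + x) - f'' (w + y))"
proof -
  have d: "(f has_real_derivative f' x) (at x)" "(f' has_real_derivative f'' x) (at x)" for x
    using assms unfolding bdd_C2_def by blast+
  obtain B where B: "\<And>x. \<bar>f x\<bar> \<le> B" using assms unfolding bdd_C2_def by blast
  have "\<bar>f (w + x) - f (w + y)\<bar> \<le> 2 * B" for w
    using B[of "w + x"] B[of "w + y"] by linarith
  then have "\<exists>B. \<forall>w. \<bar>f (w + x) - f (w + y)\<bar> \<le> B" by blast
  moreover have "continuous_on UNIV (\<lambda>w. f'' (w + x) - f'' (w + y))"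
    by (intro continuous_intros continuous_on_compose2[OF bdd_C2_continuous(3)[OF assms, of UNIV]]) auto
  ultimately show ?thesis unfolding bdd_C2_def
    by (intro conjI allI DERIV_diff DERIV_affine(2) d)
qed

text \<open>Moving both points by the same amount reduces the two-point comparison to the one-point
  one for w \<mapsto> f (w + x) - f (w + y) at w = 0.\<close>

lemma diff_le_of_sdiff_le:
  assumes f: "bdd_C2 f f' f''" and s: "1/4 < s" "s < 1" and a: "0 \<le> a"
    and le: "\<And>z. 0 < z \<Longrightarrow> sdiff f x z - sdiff f y z \<le> a * ln (1 + z\<^sup>2)"
  shows "frac_diff s f x - frac_diff s f y \<le> a * log_mass s" "f'' x - f'' y \<le> a"
proof -
  let ?F = "\<lambda>w. f (w + x) - f (w + y)"
  have sd: "sdiff ?F 0 z = sdiff f x z - sdiff f y z" for z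
    by (simp add: sdiff_def algebra_simps)
  have "frac_diff s ?F 0 = frac_diff s f x - frac_diff s f y"
    unfolding frac_diff_def sd left_diff_distrib
    by (rule Bochner_Integration.integral_diff[OF integrable_sdiff_frac_ker[OF f s] integrable_sdiff_frac_ker[OF f s]])
  moreover have "frac_diff s ?F 0 \<le> a * log_mass s"
    by (rule frac_diff_le[OF diff_shift_C2[OF f] s]) (simp add: sd le)
  ultimately show "frac_diff s f x - frac_diff s f y \<le> a * log_mass s" by simp
  have "f'' (0 + x) - f'' (0 + y) \<le> a"
    by (rule second_deriv_le_ln[OF diff_shift_C2[OF f] a]) (simp add: sd le)
  then show "f'' x - f'' y \<le> a" by simp
qed

lemma log_weight_pair_coercive:
  assumes "2 * exp K < norm (p :: real \<times> real)"
  shows "K < log_weight (fst p) + log_weight (snd p)"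
proof -
  have "norm p \<le> \<bar>fst p\<bar> + \<bar>snd p\<bar>" using norm_Pair_le[of "fst p" "snd p"] by simp
  then have "exp K < \<bar>fst p\<bar> \<or> exp K < \<bar>snd p\<bar>" using assms by linarith
  then show ?thesis using log_weight_coercive[of K "fst p"] log_weight_coercive[of K "snd p"] log_weight_nonneg[of "fst p"] log_weight_nonneg[of "snd p"] by linarith
qed

lemma closed_halfplane: "closed {p :: real \<times> real. snd p \<le> fst p}"
  by (intro closed_Collect_le continuous_intros)

text \<open>Mirror coupling of the two points at distances up to \<open>\<xi>\<close>, synchronous coupling beyond. The
  mirrored difference changes sign at distance \<open>\<xi> / 2\<close>, and its values on both sides of it are
  matched by \<open>z \<mapsto> \<xi> - z\<close>.\<close>

lemma frac_diff_mirror_coupling: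
  fixes f f' f'' \<omega> :: "real \<Rightarrow> real" and x y \<xi> P \<eta> s :: real
  assumes f: "bdd_C2 f f' f''" and s: "1/4 < s" "s < 1"
    and xi: "\<xi> = x - y" "0 < \<xi>" "\<xi> \<le> 1" and \<eta>: "0 < \<eta>" and P: "16 \<le> P"
  defines "N \<equiv> f y - f x" and "r \<equiv> \<lambda>x' y'. \<omega> (x' - y') + \<eta> * (P + log_weight x' + log_weight y')"
  assumes N: "N = r x y" and le: "\<And>x' y'. y' \<le> x' \<Longrightarrow> f y' - f x' \<le> r x' y'"
    and w0: "\<And>z. 0 \<le> z \<Longrightarrow> 0 \<le> \<omega> z"
    and conc: "\<And>z. 0 \<le> z \<Longrightarrow> z \<le> \<xi> \<Longrightarrow> \<omega> (\<xi> + z) + \<omega> (\<xi> - z) \<le> 2 * \<omega> \<xi>"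
    and grow: "\<And>z. 0 \<le> z \<Longrightarrow> z \<le> 2 * \<xi> \<Longrightarrow> \<omega> (\<xi> + z) \<le> 9/8 * \<omega> \<xi>"
  shows "frac_diff s f y - frac_diff s f x \<le> 4 * \<eta> * log_mass s - 3/8 * N * \<xi> powr (- 2 * s)"
proof -
  define D where "D = (\<lambda>z. sdiff f y z - sdiff f x z)"
  let ?K = "\<lambda>z. D z * frac_ker s z"
  have K: "integrable lborel ?K"
    unfolding D_def left_diff_distrib
    by (rule Bochner_Integration.integrable_diff[OF integrable_sdiff_frac_ker[OF f s] integrable_sdiff_frac_ker[OF f s]])
  have NLd: "frac_diff s f y - frac_diff s f x = (LINT z|lborel. ?K z)"
    unfolding frac_diff_def D_def left_diff_distrib
    by (rule Bochner_Integration.integral_diff[OF integrable_sdiff_frac_ker[OF f s] integrable_sdiff_frac_ker[OF f s], symmetric])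
  have xy: "y < x" using xi by simp
  have N0: "0 \<le> N"
    unfolding N r_def using w0[of "x - y"] xy \<eta> P log_weight_nonneg[of x] log_weight_nonneg[of y] by simp
  \<comment> \<open>Equal shifts leave x' - y' unchanged, so \<omega> cancels and the weights alone
    remain.\<close>
  have far: "D z \<le> 4 * \<eta> * ln (1 + z\<^sup>2)" for z
  proof -
    have "D z \<le> \<eta> * (sdiff log_weight x z + sdiff log_weight y z)"
      using le[of "y + z" "x + z"] le[of "y - z" "x - z"] xy N
      by (simp add: N_def r_def D_def sdiff_def algebra_simps)
    also have "\<dots> \<le> \<eta> * (2 * ln (1 + z\<^sup>2) + 2 * ln (1 + z\<^sup>2))"
      using \<eta> by (intro mult_left_mono add_mono sdiff_log_weight_le) auto
    finally show ?thesis by simp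
  qed
  have near: "?K z + ?K (\<xi> - z) \<le> 4 * \<eta> * (ln (1 + z\<^sup>2) * frac_ker s z) - 3/4 * N * \<xi> powr (-1 - 2 * s)"
    if z: "0 < z" "z < \<xi> / 2" for z
  proof -
    define \<zeta> where "\<zeta> = \<xi> - z"
    define k k' where "k = frac_ker s z" and "k' = frac_ker s \<zeta>"
    have kk: "k' \<le> k" "0 \<le> k'" "0 \<le> k" using z s by (auto simp: k_def k'_def \<zeta>_def intro!: frac_ker_antimono)
    have k'xi: "\<xi> powr (-1 - 2 * s) \<le> k'"
      using frac_ker_antimono[of s \<zeta> \<xi>] z s xi by (simp add: k'_def \<zeta>_def frac_ker_def)
    define a a' w where "a = f (y - z) - f (x + z)" and "a' = f (y - \<zeta>) - f (x + \<zeta>)" and "w = f (y + z) - f (x - z)"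
    define r0 where "r0 = r (x - z) (y + z)"
    have Dz: "D z = a + w - 2 * N" by (simp add: D_def sdiff_def a_def w_def N_def algebra_simps)
    have y\<zeta>: "y + \<zeta> = x - z" "x - \<zeta> = y + z" using xi by (auto simp: \<zeta>_def)
    \<comment> \<open>The mirrored pair for \<zeta> is the one for z with its points exchanged, so w
      returns with the opposite sign. In the sum it carries the weight k - k' \<ge> 0, and the upper
      bound r0 for w suffices.\<close>
    have D\<zeta>: "D \<zeta> = a' - w - 2 * N" by (simp add: D_def sdiff_def a'_def w_def N_def y\<zeta>)
    have w: "w \<le> r0" unfolding w_def r0_def by (rule le) (use z xi in auto)
    have r0: "0 \<le> r0"
      unfolding r0_def r_def using w0[of "x - z - (y + z)"] z xi \<eta> P log_weight_nonneg[of "x - z"] log_weight_nonneg[of "y + z"] by simp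
    \<comment> \<open>The outward and inward pairs lie at distances \<xi> + 2 * z and \<xi> - 2 * z,
      so by concavity \<omega> contributes nothing positive.\<close>
    have A: "a + r0 - 2 * N \<le> 4 * \<eta> * ln (1 + z\<^sup>2)"
    proof -
      have "a \<le> r (x + z) (y - z)" unfolding a_def by (rule le) (use z xi in auto)
      moreover have "\<omega> (\<xi> + 2 * z) + \<omega> (\<xi> - 2 * z) \<le> 2 * \<omega> \<xi>" by (rule conc) (use z in auto)
      moreover have "x + z - (y - z) = \<xi> + 2 * z" "x - z - (y + z) = \<xi> - 2 * z" using xi by auto
      ultimately have "a + r0 - 2 * N \<le> \<eta> * (sdiff log_weight x z + sdiff log_weight y z)"
        unfolding N r0_def r_def xi(1)[symmetric] by (simp add: sdiff_def algebra_simps)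
      also have "\<dots> \<le> \<eta> * (2 * ln (1 + z\<^sup>2) + 2 * ln (1 + z\<^sup>2))"
        using \<eta> by (intro mult_left_mono add_mono sdiff_log_weight_le) auto
      finally show ?thesis by simp
    qed
    \<comment> \<open>The outward pair is at most 3 * \<xi> apart, which costs a factor 9/8 on
      \<omega>. The two weights grow by at most 2 each, and \<open>P\<close> \<ge> 16 makes the
      resulting 4 * \<eta> at most a quarter of the penalty at (x, y). Hence a' - r0 \<le> 5/4 * N,
      leaving 3/4 * N of the 2 * N.\<close>
    have A': "a' - r0 - 2 * N \<le> - (3/4 * N)"
    proof -
      have \<zeta>: "0 < \<zeta>" "\<zeta> \<le> \<xi>" using z by (auto simp: \<zeta>_def)
      have "\<zeta>\<^sup>2 \<le> 1" using \<zeta> xi by (intro power_le_one) auto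
      then have "1 + \<zeta>\<^sup>2 \<le> 2" by simp
      then have ln1: "ln (1 + \<zeta>\<^sup>2) \<le> 1" using ln_le_minus_one[of "1 + \<zeta>\<^sup>2"] one_plus_square_pos[of \<zeta>] by linarith
      have "x + \<zeta> - (y - \<zeta>) = \<xi> + 2 * \<zeta>" using xi by simp
      have "a' \<le> r (x + \<zeta>) (y - \<zeta>)" unfolding a'_def by (rule le) (use \<zeta> xi in auto)
      also have "\<dots> \<le> 9/8 * \<omega> \<xi> + \<eta> * (P + (log_weight x + 2) + (log_weight y + 2))"
        unfolding r_def \<open>x + \<zeta> - (y - \<zeta>) = \<xi> + 2 * \<zeta>\<close>
        using \<eta> grow[of "2 * \<zeta>"] \<zeta> ln1 log_weight_add_le[of x \<zeta>] log_weight_add_le[of y "- \<zeta>"]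
        by (intro add_mono mult_left_mono) auto
      finally have "a' - r0 - 2 * N \<le> 9/8 * \<omega> \<xi> + \<eta> * (P + log_weight x + log_weight y) + 4 * \<eta> - 2 * N"
        using r0 by (simp add: algebra_simps)
      moreover have "N = \<omega> \<xi> + \<eta> * (P + log_weight x + log_weight y)" by (simp add: N r_def xi)
      moreover have "\<eta> * 16 \<le> \<eta> * (P + log_weight x + log_weight y)"
        using \<eta> P log_weight_nonneg[of x] log_weight_nonneg[of y] by (intro mult_left_mono) linarith+
      moreover have "0 \<le> \<omega> \<xi>" using w0 xi by simp
      ultimately show ?thesis by linarith
    qed
    have "?K z + ?K (\<xi> - z) = k * (a - 2 * N) + (k - k') * w + k' * (a' - 2 * N)"
      unfolding \<zeta>_def[symmetric] k_def[symmetric] k'_def[symmetric] Dz D\<zeta> by (simp add: algebra_simps)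
    also have "\<dots> \<le> k * (a - 2 * N) + (k - k') * r0 + k' * (a' - 2 * N)"
      using w kk by (intro add_mono mult_left_mono) auto
    also have "\<dots> = k * (a + r0 - 2 * N) + k' * (a' - r0 - 2 * N)" by (simp add: algebra_simps)
    also have "\<dots> \<le> k * (4 * \<eta> * ln (1 + z\<^sup>2)) + k' * (- (3/4 * N))"
      using A A' kk by (intro add_mono mult_left_mono) auto
    also have "k' * (- (3/4 * N)) \<le> \<xi> powr (-1 - 2 * s) * (- (3/4 * N))"
      using k'xi N0 by (intro mult_right_mono_neg) auto
    finally show ?thesis by (simp add: k_def algebra_simps)
  qed
  let ?I = "\<lambda>z. indicator {0<..<\<xi> / 2} z :: real"
  let ?J = "\<lambda>z. indicator {\<xi> / 2<..<\<xi>} z :: real"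
  let ?L = "\<lambda>z. indicator (UNIV - {0<..<\<xi> / 2} - {\<xi> / 2<..<\<xi>}) z :: real"
  have int: "integrable lborel (\<lambda>z. indicator S z * ?K z)" if "S \<in> sets borel" for S
    using integrable_mult_indicator[OF _ K, of S] that by simp
  have refl: "(LINT z|lborel. ?J z * ?K z) = (LINT z|lborel. ?I z * ?K (\<xi> - z))"
    "integrable lborel (\<lambda>z. ?I z * ?K (\<xi> - z))"
  proof -
    have J: "?J (\<xi> + (-1) * z) = ?I z" for z by (auto simp: indicator_def)
    show "(LINT z|lborel. ?J z * ?K z) = (LINT z|lborel. ?I z * ?K (\<xi> - z))"
      using lborel_integral_real_affine[of "-1" "\<lambda>z. ?J z * ?K z" \<xi>] J by simp
    show "integrable lborel (\<lambda>z. ?I z * ?K (\<xi> - z))"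
      using lborel_integrable_real_affine[OF int[of "{\<xi> / 2<..<\<xi>}"], where c = "-1" and t = \<xi>] J by simp
  qed
  \<comment> \<open>The part over (\<xi> / 2, \<xi>) is reflected onto (0, \<xi> / 2) and added
    pointwise. The length \<xi> / 2 times 3/4 produces the final 3/8.\<close>
  have "(LINT z|lborel. ?K z) = (LINT z|lborel. ?I z * ?K z + ?J z * ?K z + ?L z * ?K z)"
    by (rule Bochner_Integration.integral_cong) (auto simp: indicator_def)
  also have "\<dots> = (LINT z|lborel. ?I z * ?K z) + (LINT z|lborel. ?I z * ?K (\<xi> - z)) + (LINT z|lborel. ?L z * ?K z)"
    unfolding refl(1)[symmetric]
    by (subst Bochner_Integration.integral_add, (intro Bochner_Integration.integrable_add int; simp)+)+ simp
  also have "\<dots> = (LINT z|lborel. ?I z * ?K z + ?I z * ?K (\<xi> - z) + ?L z * ?K z)"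
    by (subst Bochner_Integration.integral_add, (intro Bochner_Integration.integrable_add int refl(2); simp)+)+ simp
  also have "\<dots> \<le> (LINT z|lborel. 4 * \<eta> * (ln (1 + z\<^sup>2) * frac_ker s z) - ?I z * (3/4 * N * \<xi> powr (-1 - 2 * s)))"
  proof (rule integral_mono)
    show "integrable lborel (\<lambda>z. ?I z * ?K z + ?I z * ?K (\<xi> - z) + ?L z * ?K z)"
      by (intro Bochner_Integration.integrable_add int refl(2)) auto
    show "integrable lborel (\<lambda>z. 4 * \<eta> * (ln (1 + z\<^sup>2) * frac_ker s z) - ?I z * (3/4 * N * \<xi> powr (-1 - 2 * s)))"
      using integrable_ln_frac_ker[OF s] xi(2) by (intro Bochner_Integration.integrable_diff integrable_mult_right integrable_mult_left
        integrable_real_indicator) auto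
    fix z :: real
    show "?I z * ?K z + ?I z * ?K (\<xi> - z) + ?L z * ?K z \<le> 4 * \<eta> * (ln (1 + z\<^sup>2) * frac_ker s z) - ?I z * (3/4 * N * \<xi> powr (-1 - 2 * s))"
    proof (cases "0 < z \<and> z < \<xi> / 2")
      case True then show ?thesis using near[of z] by simp
    next
      case False
      have "?K z \<le> 4 * \<eta> * (ln (1 + z\<^sup>2) * frac_ker s z)"
        using mult_right_mono[OF far[of z] frac_ker_nonneg[of s z]] by (simp add: mult.assoc)
      moreover have "0 \<le> 4 * \<eta> * (ln (1 + z\<^sup>2) * frac_ker s z)" using \<eta> by (intro mult_nonneg_nonneg) auto
      ultimately show ?thesis using False by (auto simp: indicator_def)
    qed
  qed
  also have "\<dots> = 4 * \<eta> * log_mass s - \<xi> / 2 * (3/4 * N * \<xi> powr (-1 - 2 * s))"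
    using integrable_ln_frac_ker[OF s] xi(2)
    by (subst Bochner_Integration.integral_diff) (auto simp: log_mass_def)
  also have "\<xi> / 2 * (3/4 * N * \<xi> powr (-1 - 2 * s)) = 3/8 * N * \<xi> powr (- 2 * s)"
  proof -
    have "\<xi> powr (- 2 * s) = \<xi> powr (1 + (-1 - 2 * s))" by simp
    also have "\<dots> = \<xi> * \<xi> powr (-1 - 2 * s)" using xi by (subst powr_add) simp
    finally show ?thesis by simp
  qed
  finally show ?thesis unfolding NLd .
qed

context visc_burgers
begin

text \<open>At a touching pair the slope of (t - t0) * u is 1 at both points, up to the penalty. The
  nonlinear terms then contribute - (u x - u y), exactly what differentiating the factor t - t0
  contributes with the opposite sign. Dissipation and viscosity have a favourable sign at a
  maximum.\<close>

lemma oleinik_from: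
  assumes t0: "0 < t0" "t0 < t1" and le1: "y1 \<le> x1"
  shows "(t1 - t0) * (u x1 t1 - u y1 t1) \<le> x1 - y1"
proof (rule field_le_epsilon)
  fix e :: real assume e: "0 < e"
  from bdd[OF t0(1)] obtain B where B: "\<And>x t. t0 \<le> t \<Longrightarrow> \<bar>u x t\<bar> \<le> B" by blast
  have B0: "0 \<le> B" using B[of t0 0] by linarith
  define \<Lambda> where "\<Lambda> = 2 * B + 4 * c * log_mass s + 4 * \<epsilon> + 1"
  have \<Lambda>: "0 < \<Lambda>" using B0 c_pos eps log_mass_nonneg[of s] by (simp add: \<Lambda>_def add_nonneg_pos)
  define D where "D = 1 + \<Lambda> * (t1 - t0) + (log_weight x1 + log_weight y1)"
  have D: "0 < D" using \<Lambda> t0 log_weight_nonneg[of x1] log_weight_nonneg[of y1] unfolding D_def by (intro add_pos_nonneg) auto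
  define \<eta> where "\<eta> = e / D"
  have \<eta>: "0 < \<eta>" using e D by (simp add: \<eta>_def)
  have "(t1 - t0) * (u x1 t1 - u y1 t1) \<le> x1 - y1 + \<eta> * D"
  proof (rule ccontr)
    assume con: "\<not> ?thesis"
    define \<Phi> where "\<Phi> = (\<lambda>p t. (t - t0) * (u (fst p) t - u (snd p) t) - (fst p - snd p)
      - \<eta> * (1 + \<Lambda> * (t - t0) + (log_weight (fst p) + log_weight (snd p))))"
    define S where "S = {p :: real \<times> real. snd p \<le> fst p}"
    define R where "R = 2 * exp ((t1 - t0) * (2 * B) / \<eta>)"
    have pos: "0 < \<eta> * (1 + \<Lambda> * (t - t0) + (log_weight x + log_weight y))" if "t0 \<le> t" for t x y
      using \<eta> \<Lambda> that log_weight_nonneg[of x] log_weight_nonneg[of y] by (intro mult_pos_pos add_pos_nonneg) auto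
    obtain p t where pt: "p \<in> S" "t0 < t" "t \<le> t1" "\<Phi> p t = 0" "\<And>q. q \<in> S \<Longrightarrow> \<Phi> q t \<le> 0"
      "\<And>\<tau>. \<tau> \<in> {t0..t} \<Longrightarrow> \<Phi> p \<tau> \<le> 0"
    proof (rule first_touch[of S t0 t1 \<Phi> R "(x1, y1)"])
      show "closed S" unfolding S_def by (rule closed_halfplane)
      show "continuous_on (S \<times> {t0..t1}) (\<lambda>p. \<Phi> (fst p) (snd p))"
        unfolding \<Phi>_def
        by (intro continuous_intros continuous_on_joint[OF cont_u]) (use t0 in auto)
    next
      fix p t
      assume "p \<in> S" and t: "t \<in> {t0..t1}" and R: "R < norm p"
      then have p: "snd p \<le> fst p" by (simp add: S_def)
      have "(t1 - t0) * (2 * B) / \<eta> < log_weight (fst p) + log_weight (snd p)"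
        using R unfolding R_def by (rule log_weight_pair_coercive)
      then have 1: "(t1 - t0) * (2 * B) < \<eta> * (log_weight (fst p) + log_weight (snd p))" using \<eta> by (simp add: field_simps)
      have 2: "(t - t0) * (u (fst p) t - u (snd p) t) \<le> (t1 - t0) * (2 * B)"
      proof -
        have "u (fst p) t - u (snd p) t \<le> 2 * B"
          using B[of t "fst p"] B[of t "snd p"] t by auto
        then have "(t - t0) * (u (fst p) t - u (snd p) t) \<le> (t - t0) * (2 * B)"
          using t by (intro mult_left_mono) auto
        also have "\<dots> \<le> (t1 - t0) * (2 * B)" using t B0 by (intro mult_right_mono) auto
        finally show ?thesis .
      qed
      have 3: "0 \<le> \<eta> * (1 + \<Lambda> * (t - t0))" using \<eta> \<Lambda> t by simp
      show "\<Phi> p t < 0"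
        unfolding \<Phi>_def distrib_left[of \<eta> "1 + \<Lambda> * (t - t0)"] using 1 2 3 p by linarith
    next
      fix p assume "p \<in> S"
      then show "\<Phi> p t0 < 0" using pos[of t0 "fst p" "snd p"] by (simp add: \<Phi>_def S_def)
    next
      show "0 \<le> \<Phi> (x1, y1) t1" using con by (simp add: \<Phi>_def D_def)
    qed (use t0 le1 in \<open>auto simp: S_def\<close>)
    obtain x y where p: "p = (x, y)" by (cases p)
    have tpos: "0 < t" using pt(2) t0 by simp
    define \<tau> where "\<tau> = t - t0"
    have \<tau>: "0 < \<tau>" using pt(2) by (simp add: \<tau>_def)
    \<comment> \<open>Strictly off the diagonal, either point can be varied alone without leaving
      the half plane, so both spatial derivatives are determined.\<close>
    have yx: "y < x"
    proof (rule ccontr)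
      assume "\<not> y < x"
      then have "x = y" using pt(1) by (simp add: S_def p)
      then have "\<Phi> p t < 0" using pos[of t y y] pt(2) by (simp add: \<Phi>_def p)
      then show False using pt(4) by simp
    qed
    note C2 = slice_C2[OF tpos]
    let ?f = "\<lambda>y. u y t"
    have dt: "0 \<le> (u x t - u y t) + \<tau> * (ut x t - ut y t) - \<eta> * \<Lambda>"
    proof (rule DERIV_left_max[OF _ pt(2)])
      have "((\<lambda>t. (t - t0) * (u x t - u y t)) has_real_derivative 1 * (u x t - u y t) + (ut x t - ut y t) * (t - t0)) (at t)"
        by (intro DERIV_mult DERIV_diff DERIV_t tpos) (auto intro!: derivative_eq_intros)
      moreover have "((\<lambda>t. \<eta> * (1 + \<Lambda> * (t - t0) + (log_weight x + log_weight y))) has_real_derivative \<eta> * \<Lambda>) (at t)"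
        by (auto intro!: derivative_eq_intros)
      ultimately have "((\<lambda>t. (t - t0) * (u x t - u y t) - (x - y) - \<eta> * (1 + \<Lambda> * (t - t0) + (log_weight x + log_weight y)))
          has_real_derivative 1 * (u x t - u y t) + (ut x t - ut y t) * (t - t0) - 0 - \<eta> * \<Lambda>) (at t)"
        by (intro DERIV_diff DERIV_const)
      then show "((\<lambda>t. \<Phi> p t) has_real_derivative (u x t - u y t) + \<tau> * (ut x t - ut y t) - \<eta> * \<Lambda>) (at t)"
        unfolding \<Phi>_def p \<tau>_def by (simp add: mult.commute)
    qed (use pt in auto)
    have max: "\<tau> * (u x' t - u y' t) - (x' - y') - \<eta> * (log_weight x' + log_weight y') \<le> \<tau> * (u x t - u y t) - (x - y) - \<eta> * (log_weight x + log_weight y)"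
      if "y' \<le> x'" for x' y'
      using pt(5)[of "(x', y')"] pt(4) that by (simp add: \<Phi>_def p S_def \<tau>_def distrib_left)
    have dx: "\<tau> * ux x t = 1 + \<eta> * (2 * x / (1 + x\<^sup>2))"
    proof (rule DERIV_max_eq)
      show "((\<lambda>x. \<tau> * u x t) has_real_derivative \<tau> * ux x t) (at x)" by (intro DERIV_cmult DERIV_x tpos)
      show "((\<lambda>x. x + \<eta> * log_weight x) has_real_derivative 1 + \<eta> * (2 * x / (1 + x\<^sup>2))) (at x)"
        by (intro DERIV_add DERIV_ident DERIV_cmult log_weight_deriv)
      show "0 < x - y" using yx by simp
      fix z assume "\<bar>x - z\<bar> < x - y"
      then have "y \<le> z" by linarith
      from max[OF this] show "\<tau> * u z t - (z + \<eta> * log_weight z) \<le> \<tau> * u x t - (x + \<eta> * log_weight x)"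
        by (simp add: algebra_simps)
    qed
    have dy: "- \<tau> * ux y t = - 1 + \<eta> * (2 * y / (1 + y\<^sup>2))"
    proof (rule DERIV_max_eq)
      show "((\<lambda>x. - \<tau> * u x t) has_real_derivative - \<tau> * ux y t) (at y)" by (intro DERIV_cmult DERIV_x tpos)
      show "((\<lambda>x. - x + \<eta> * log_weight x) has_real_derivative - 1 + \<eta> * (2 * y / (1 + y\<^sup>2))) (at y)"
        by (intro DERIV_add DERIV_minus DERIV_ident DERIV_cmult log_weight_deriv)
      show "0 < x - y" using yx by simp
      fix z assume "\<bar>y - z\<bar> < x - y"
      then have "z \<le> x" by linarith
      from max[OF this] show "- \<tau> * u z t - (- z + \<eta> * log_weight z) \<le> - \<tau> * u y t - (- y + \<eta> * log_weight y)"
        by (simp add: algebra_simps)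
    qed
    have sd: "sdiff ?f x z - sdiff ?f y z \<le> 4 * \<eta> / \<tau> * ln (1 + z\<^sup>2)" for z
    proof -
      have "\<tau> * (sdiff ?f x z - sdiff ?f y z) \<le> \<eta> * (sdiff log_weight x z + sdiff log_weight y z)"
        using max[of "y + z" "x + z"] max[of "y - z" "x - z"] yx by (simp add: sdiff_def algebra_simps)
      also have "\<dots> \<le> \<eta> * (2 * ln (1 + z\<^sup>2) + 2 * ln (1 + z\<^sup>2))"
        using \<eta> by (intro mult_left_mono add_mono sdiff_log_weight_le) auto
      finally show ?thesis using \<tau> by (simp add: field_simps)
    qed
    have a: "0 \<le> 4 * \<eta> / \<tau>" using \<eta> \<tau> by simp
    note d = diff_le_of_sdiff_le[OF C2 s'(1,2) a sd]
    have 1: "\<tau> * (c * (frac_diff s ?f x - frac_diff s ?f y)) \<le> 4 * c * log_mass s * \<eta>"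
      using mult_left_mono[OF d(1), of "\<tau> * c"] \<tau> c_pos by (simp add: field_simps)
    have 2: "\<tau> * (\<epsilon> * (uxx x t - uxx y t)) \<le> 4 * \<epsilon> * \<eta>"
      using mult_left_mono[OF d(2), of "\<tau> * \<epsilon>"] \<tau> eps by (simp add: field_simps)
    have 3: "- (u z t * (\<eta> * (2 * z / (1 + z\<^sup>2)))) \<le> B * \<eta>" for z
    proof -
      have "\<bar>u z t\<bar> * \<bar>\<eta> * (2 * z / (1 + z\<^sup>2))\<bar> \<le> B * \<eta>"
        using B0 B[of t z] pt(2) \<eta> by (intro mult_mono log_weight_deriv_scaled) auto
      then show ?thesis by (simp only: abs_mult[symmetric])
    qed
    have "\<tau> * (ut x t - ut y t) = - (u x t * (\<tau> * ux x t)) - u y t * (- \<tau> * ux y t)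
      + \<tau> * (c * (frac_diff s ?f x - frac_diff s ?f y)) + \<tau> * (\<epsilon> * (uxx x t - uxx y t))"
      unfolding pde[OF tpos] by (simp add: algebra_simps)
    \<comment> \<open>The leading term cancels u x t - u y t in \<open>dt\<close>; only multiples of
      \<eta> are left.\<close>
    also have "\<dots> = - (u x t - u y t) + (- (u x t * (\<eta> * (2 * x / (1 + x\<^sup>2)))) - u y t * (\<eta> * (2 * y / (1 + y\<^sup>2))))
      + \<tau> * (c * (frac_diff s ?f x - frac_diff s ?f y)) + \<tau> * (\<epsilon> * (uxx x t - uxx y t))"
    proof -
      have "- (a * (1 + g)) - b * (- 1 + h) + k + l = - (a - b) + (- (a * g) - b * h) + k + l" for a b g h k l :: real
        by (simp add: algebra_simps)
      then show ?thesis unfolding dx dy .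
    qed
    finally have "\<eta> * \<Lambda> \<le> 2 * (B * \<eta>) + 4 * c * log_mass s * \<eta> + 4 * \<epsilon> * \<eta>"
      using dt 1 2 3[of x] 3[of y] by linarith
    also have "\<dots> = \<eta> * \<Lambda> - \<eta>" by (simp add: \<Lambda>_def algebra_simps)
    finally show False using \<eta> by simp
  qed
  then show "(t1 - t0) * (u x1 t1 - u y1 t1) \<le> x1 - y1 + e"
    using D by (simp add: \<eta>_def)
qed

lemma oleinik:
  assumes t1: "0 < t1" and le1: "y1 \<le> x1"
  shows "u x1 t1 - u y1 t1 \<le> (x1 - y1) / t1"
proof -
  have "t1 * (u x1 t1 - u y1 t1) \<le> x1 - y1"
  proof (rule tendsto_upperbound)
    have "((\<lambda>t0. (t1 - t0) * (u x1 t1 - u y1 t1)) \<longlongrightarrow> (t1 - 0) * (u x1 t1 - u y1 t1)) (at_right 0)"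
      by (intro tendsto_intros)
    then show "((\<lambda>t0. (t1 - t0) * (u x1 t1 - u y1 t1)) \<longlongrightarrow> t1 * (u x1 t1 - u y1 t1)) (at_right 0)" by simp
    have "\<forall>\<^sub>F t0 in at_right 0. t0 \<in> {0<..<t1}"
      using t1 by (rule eventually_at_rightI[of 0 t1, rotated]) auto
    then show "\<forall>\<^sub>F t0 in at_right 0. (t1 - t0) * (u x1 t1 - u y1 t1) \<le> x1 - y1"
      by eventually_elim (use oleinik_from le1 in auto)
  qed simp
  then show ?thesis using t1 by (simp add: field_simps)
qed

end

section \<open>Inequalities for the power 1/10\<close>

lemma powr_tangent:
  assumes "0 \<le> b" "0 < (p::real)"
  shows "b powr (1/10) \<le> p powr (1/10) * (1 + (b / p - 1) / 10)"
proof -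
  define w where "w = (b / p) powr (1/10)"
  have w0: "0 \<le> w" by (simp add: w_def)
  have "w ^ 10 = b / p"
    using assms by (cases "b = 0") (simp_all add: w_def powr_power)
  \<comment> \<open>Concavity of the tenth root is Bernoulli's inequality for the tenth power of
    w.\<close>
  moreover have "1 + real 10 * (w - 1) \<le> (1 + (w - 1)) ^ 10"
    using w0 by (intro Bernoulli_inequality) simp
  ultimately have "w \<le> 1 + (b / p - 1) / 10" by (simp add: diff_divide_distrib)
  then have "p powr (1/10) * w \<le> p powr (1/10) * (1 + (b / p - 1) / 10)"
    by (intro mult_left_mono) auto
  moreover have "p powr (1/10) * w = b powr (1/10)"
    using assms by (simp add: w_def powr_divide)
  ultimately show ?thesis by simp
qed

lemma powr_concave:
  assumes "0 \<le> z" "z \<le> (p::real)" "0 < p"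
  shows "(p + z) powr (1/10) + (p - z) powr (1/10) \<le> 2 * p powr (1/10)"
proof -
  have "(p + z) powr (1/10) + (p - z) powr (1/10)
      \<le> p powr (1/10) * (1 + ((p + z) / p - 1) / 10) + p powr (1/10) * (1 + ((p - z) / p - 1) / 10)"
    using assms by (intro add_mono powr_tangent) auto
  also have "\<dots> = 2 * p powr (1/10)" using assms by (simp add: field_simps)
  finally show ?thesis .
qed

text \<open>Numerically this is 3 \<le> (9/8)^10. It serves outward pairs, whose distance may triple
  in the mirror coupling.\<close>

lemma powr_triple:
  assumes "0 < (p::real)" "0 \<le> q" "q \<le> 3 * p"
  shows "q powr (1/10) \<le> 9/8 * p powr (1/10)"
proof -
  have "(3::real) \<le> (9/8) ^ 10" by (simp add: power_divide)
  also have "\<dots> = (9/8) powr 10" by (rule powr_numeral[symmetric]) simp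
  finally have "(3::real) powr (1/10) \<le> ((9/8) powr 10) powr (1/10)" by (intro powr_mono2) auto
  also have "\<dots> = 9/8" unfolding powr_powr by simp
  finally have 3: "(3::real) powr (1/10) \<le> 9/8" .
  have "q powr (1/10) \<le> (3 * p) powr (1/10)" using assms by (intro powr_mono2) auto
  also have "\<dots> = 3 powr (1/10) * p powr (1/10)" using assms by (simp add: powr_mult)
  also have "\<dots> \<le> 9/8 * p powr (1/10)" using 3 by (intro mult_right_mono) auto
  finally show ?thesis .
qed

context visc_burgers
begin

text \<open>The modulus of continuity \<open>(\<xi> + \<rho> (t))\<^bsup>1/10\<^esup> / 10\<close> starts from \<open>\<rho> = 1\<close>, where smallness of \<open>u\<close> makes
  it trivial, and becomes a Hoelder modulus when \<open>\<rho>\<close> vanishes.\<close>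

lemma holder_shock_side:
  assumes T: "0 < T" and small: "\<And>x t. T \<le> t \<Longrightarrow> \<bar>u x t\<bar> \<le> 1/30"
    and t1: "T + 10 \<le> t1" and le1: "y1 \<le> x1"
  shows "u y1 t1 - u x1 t1 \<le> 1/10 * (x1 - y1) powr (1/10)"
proof (rule field_le_epsilon)
  fix e :: real assume e: "0 < e"
  define t0 where "t0 = t1 - 10"
  have t0: "0 < t0" "t0 < t1" "T \<le> t0" using T t1 by (auto simp: t0_def)
  define B where "B = (1/30 :: real)"
  have B: "\<bar>u x t\<bar> \<le> B" if "t0 \<le> t" for x t using small[of t x] that t0 by (simp add: B_def)
  have B0: "0 \<le> B" by (simp add: B_def)
  define \<Lambda> where "\<Lambda> = 2 * B + 4 * c * log_mass s + 4 * \<epsilon> + 1"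
  have \<Lambda>: "0 < \<Lambda>" using B0 c_pos eps log_mass_nonneg[of s] by (simp add: \<Lambda>_def add_nonneg_pos)
  \<comment> \<open>The summand 16 is the lower bound on \<open>P\<close> that the mirror coupling
    asks for.\<close>
  define D where "D = 16 + \<Lambda> * (t1 - t0) + (log_weight x1 + log_weight y1)"
  have D: "0 < D" using \<Lambda> t0 log_weight_nonneg[of x1] log_weight_nonneg[of y1] unfolding D_def by (intro add_pos_nonneg) auto
  define \<eta> where "\<eta> = e / D"
  have \<eta>: "0 < \<eta>" using e D by (simp add: \<eta>_def)
  \<comment> \<open>The squared linear m makes \<rho> reach 0 in finite time with speed of order
    sqrt \<rho>. The cost of moving \<rho> is then of order \<omega> * sqrt \<rho> / (\<xi> +
    \<rho>), at most \<omega> / sqrt \<xi>. A linear \<rho> would cost up to \<omega> / \<xi>,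
    beyond the dissipation for s < 1/2.\<close>
  define m where "m = (\<lambda>t. 1 - (t - t0) / 10)"
  define \<omega> where "\<omega> = (\<lambda>\<xi> t. 1/10 * (\<xi> + (m t)\<^sup>2) powr (1/10))"
  have "u y1 t1 - u x1 t1 \<le> \<omega> (x1 - y1) t1 + \<eta> * D"
  proof (rule ccontr)
    assume con: "\<not> ?thesis"
    define \<Phi> where "\<Phi> = (\<lambda>p t. (u (snd p) t - u (fst p) t) - \<omega> (fst p - snd p) t
      - \<eta> * (16 + \<Lambda> * (t - t0) + (log_weight (fst p) + log_weight (snd p))))"
    define S where "S = {p :: real \<times> real. snd p \<le> fst p}"
    define R where "R = 2 * exp (2 * B / \<eta>)"
    have pos: "0 < \<eta> * (16 + \<Lambda> * (t - t0) + (log_weight x + log_weight y))" if "t0 \<le> t" for t x y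
      using \<eta> \<Lambda> that log_weight_nonneg[of x] log_weight_nonneg[of y] by (intro mult_pos_pos add_pos_nonneg) auto
    have \<omega>0: "0 \<le> \<omega> \<xi> t" for \<xi> t by (simp add: \<omega>_def)
    have u2B: "u y t - u x t \<le> 2 * B" if "t0 \<le> t" for x y t
      using B[OF that, of x] B[OF that, of y] by linarith
    \<comment> \<open>Where \<omega> \<ge> 1/10 it exceeds the whole oscillation 2 * B = 1/15. This
      settles the initial time, when m = 1, and all distances from 1 on, so that touching requires
      \<xi> < 1.\<close>
    have big: "\<Phi> p t < 0" if "t0 \<le> t" "1/10 \<le> \<omega> (fst p - snd p) t" for p t
      using u2B[OF that(1), of "snd p" "fst p"] that(2) pos[OF that(1), of "fst p" "snd p"] by (simp add: \<Phi>_def B_def)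
    have big': "1/10 \<le> \<omega> \<xi> t" if "1 \<le> \<xi> + (m t)\<^sup>2" for \<xi> t
      using ge_one_powr_ge_zero[OF that, of "1/10"] by (simp add: \<omega>_def)
    obtain p t where pt: "p \<in> S" "t0 < t" "t \<le> t1" "\<Phi> p t = 0" "\<And>q. q \<in> S \<Longrightarrow> \<Phi> q t \<le> 0"
      "\<And>\<tau>. \<tau> \<in> {t0..t} \<Longrightarrow> \<Phi> p \<tau> \<le> 0"
    proof (rule first_touch[of S t0 t1 \<Phi> R "(x1, y1)"])
      show "closed S" unfolding S_def by (rule closed_halfplane)
      have "continuous_on (S \<times> {t0..t1}) (\<lambda>p. \<omega> (fst (fst p) - snd (fst p)) (snd p))"
        unfolding \<omega>_def m_def
        by (intro continuous_intros continuous_on_powr') (auto simp: S_def)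
      then show "continuous_on (S \<times> {t0..t1}) (\<lambda>p. \<Phi> (fst p) (snd p))"
        unfolding \<Phi>_def
        by (intro continuous_intros continuous_on_joint[OF cont_u]) (use t0 in auto)
    next
      fix p t
      assume "p \<in> S" and t: "t \<in> {t0..t1}" and R: "R < norm p"
      have "2 * B / \<eta> < log_weight (fst p) + log_weight (snd p)"
        using R unfolding R_def by (rule log_weight_pair_coercive)
      then have 1: "2 * B < \<eta> * (log_weight (fst p) + log_weight (snd p))" using \<eta> by (simp add: field_simps)
      have 2: "u (snd p) t - u (fst p) t \<le> 2 * B" using t by (intro u2B) auto
      have 3: "0 \<le> \<eta> * (16 + \<Lambda> * (t - t0))" using \<eta> \<Lambda> t by simp
      show "\<Phi> p t < 0"
        unfolding \<Phi>_def distrib_left[of \<eta> "16 + \<Lambda> * (t - t0)"]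
        using 1 2 3 \<omega>0[of "fst p - snd p" t] by linarith
    next
      fix p assume "p \<in> S"
      then show "\<Phi> p t0 < 0" by (intro big big') (auto simp: m_def S_def)
    next
      show "0 \<le> \<Phi> (x1, y1) t1" using con by (simp add: \<Phi>_def D_def)
    qed (use t0 le1 in \<open>auto simp: S_def\<close>)
    obtain x y where p: "p = (x, y)" by (cases p)
    have tpos: "0 < t" using pt(2) t0 by simp
    have yx: "y < x"
    proof (rule ccontr)
      assume "\<not> y < x"
      then have "x = y" using pt(1) by (simp add: S_def p)
      then have "\<Phi> p t < 0" using pos[of t y y] pt(2) \<omega>0[of 0 t] by (simp add: \<Phi>_def p)
      then show False using pt(4) by simp
    qed
    define \<xi> where "\<xi> = x - y"
    have \<xi>0: "0 < \<xi>" using yx by (simp add: \<xi>_def)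
    have \<xi>1: "\<xi> < 1"
    proof (rule ccontr)
      assume "\<not> \<xi> < 1"
      then have "\<Phi> p t < 0" using pt(2) by (intro big big') (auto simp: p \<xi>_def intro: add_increasing2)
      then show False using pt(4) by simp
    qed
    have mt: "0 \<le> m t" "m t \<le> 1" using pt(2,3) by (auto simp: m_def t0_def)
    define \<rho> where "\<rho> = (m t)\<^sup>2"
    have \<rho>0: "0 \<le> \<rho>" by (simp add: \<rho>_def)
    define N where "N = u y t - u x t"
    define \<omega>x where "\<omega>x = 1/100 * (\<xi> + \<rho>) powr (-9/10)"
    define \<omega>t where "\<omega>t = \<omega>x * (- 1/5 * m t)"
    have Neq: "N = \<omega> \<xi> t + \<eta> * (16 + \<Lambda> * (t - t0) + log_weight x + log_weight y)"
      using pt(4) by (simp add: \<Phi>_def p N_def \<xi>_def algebra_simps)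
    have N\<omega>: "\<omega> \<xi> t \<le> N" using pos[of t x y] pt(2) unfolding Neq by (simp add: add.assoc)
    have d\<omega>: "((\<lambda>z. 1/10 * z powr (1/10)) has_real_derivative \<omega>x) (at (\<xi> + \<rho>))"
    proof -
      have "((\<lambda>z. z powr (1/10)) has_real_derivative (1/10) * (\<xi> + \<rho>) powr (1/10 - 1)) (at (\<xi> + \<rho>))"
        using \<xi>0 \<rho>0 by (intro has_real_derivative_powr) simp
      from DERIV_cmult[OF this, of "1/10"] show ?thesis by (simp add: \<omega>x_def)
    qed
    have d\<omega>t: "((\<lambda>t. \<omega> \<xi> t) has_real_derivative \<omega>t) (at t)"
    proof -
      have "((\<lambda>t. \<xi> + (m t)\<^sup>2) has_real_derivative (- 1/5 * m t)) (at t)"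
        unfolding m_def by (auto intro!: derivative_eq_intros simp: field_simps)
      from DERIV_chain2[OF d\<omega>[unfolded \<rho>_def] this] show ?thesis
        by (simp add: \<omega>_def[abs_def] \<omega>t_def)
    qed
    note C2 = slice_C2[OF tpos]
    let ?f = "\<lambda>y. u y t"
    have dt: "0 \<le> (ut y t - ut x t) - \<omega>t - \<eta> * \<Lambda>"
    proof (rule DERIV_left_max[OF _ pt(2)])
      have "((\<lambda>t. \<eta> * (16 + \<Lambda> * (t - t0) + (log_weight x + log_weight y))) has_real_derivative \<eta> * \<Lambda>) (at t)"
        by (auto intro!: derivative_eq_intros)
      then show "((\<lambda>t. \<Phi> p t) has_real_derivative (ut y t - ut x t) - \<omega>t - \<eta> * \<Lambda>) (at t)"
        unfolding \<Phi>_def p fst_conv snd_conv \<xi>_def[symmetric]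
        by (intro DERIV_diff DERIV_t tpos d\<omega>t)
    qed (use pt in auto)
    define P where "P = 16 + \<Lambda> * (t - t0)"
    have P: "16 \<le> P" using \<Lambda> pt(2) by (simp add: P_def)
    have max: "u y' t - u x' t \<le> \<omega> (x' - y') t + \<eta> * (P + log_weight x' + log_weight y')"
      if "y' \<le> x'" for x' y'
      using pt(5)[of "(x', y')"] that by (simp add: \<Phi>_def P_def S_def algebra_simps)
    have eq: "u y t - u x t = \<omega> (x - y) t + \<eta> * (P + log_weight x + log_weight y)"
      using Neq by (simp add: N_def \<xi>_def P_def)
    have dx: "- ux x t = \<omega>x + \<eta> * (2 * x / (1 + x\<^sup>2))"
    proof (rule DERIV_max_eq)
      show "((\<lambda>x. - u x t) has_real_derivative - ux x t) (at x)" by (intro DERIV_minus DERIV_x tpos)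
      have "((\<lambda>x. x - y + \<rho>) has_real_derivative 1) (at x)" by (auto intro!: derivative_eq_intros)
      from DERIV_chain2[OF d\<omega>[unfolded \<xi>_def] this]
      show "((\<lambda>x. \<omega> (x - y) t + \<eta> * log_weight x) has_real_derivative \<omega>x + \<eta> * (2 * x / (1 + x\<^sup>2))) (at x)"
        unfolding \<omega>_def \<rho>_def by (intro DERIV_add DERIV_cmult log_weight_deriv) simp
      show "0 < x - y" using yx by simp
      fix z assume "\<bar>x - z\<bar> < x - y"
      then have "y \<le> z" by linarith
      from max[OF this] eq show "- u z t - (\<omega> (z - y) t + \<eta> * log_weight z) \<le> - u x t - (\<omega> (x - y) t + \<eta> * log_weight x)"
        by (simp add: algebra_simps)
    qed
    have dy: "ux y t = - \<omega>x + \<eta> * (2 * y / (1 + y\<^sup>2))"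
    proof (rule DERIV_max_eq)
      show "((\<lambda>x. u x t) has_real_derivative ux y t) (at y)" by (intro DERIV_x tpos)
      have "((\<lambda>y. x - y + \<rho>) has_real_derivative - 1) (at y)" by (auto intro!: derivative_eq_intros)
      from DERIV_chain2[OF d\<omega>[unfolded \<xi>_def] this]
      show "((\<lambda>y. \<omega> (x - y) t + \<eta> * log_weight y) has_real_derivative - \<omega>x + \<eta> * (2 * y / (1 + y\<^sup>2))) (at y)"
        unfolding \<omega>_def \<rho>_def by (intro DERIV_add DERIV_cmult log_weight_deriv) simp
      show "0 < x - y" using yx by simp
      fix z assume "\<bar>y - z\<bar> < x - y"
      then have "z \<le> x" by linarith
      from max[OF this] eq show "u z t - (\<omega> (x - z) t + \<eta> * log_weight z) \<le> u y t - (\<omega> (x - y) t + \<eta> * log_weight y)"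
        by (simp add: algebra_simps)
    qed
    have frac_diff: "frac_diff s ?f y - frac_diff s ?f x \<le> 4 * \<eta> * log_mass s - 3/8 * N * \<xi> powr (- 2 * s)"
      unfolding N_def
    proof (rule frac_diff_mirror_coupling[OF C2 s'(1,2) \<xi>_def \<xi>0 _ \<eta> P, where \<omega> = "\<lambda>z. \<omega> z t"])
      fix z assume z: "0 \<le> z" "z \<le> \<xi>"
      then show "\<omega> (\<xi> + z) t + \<omega> (\<xi> - z) t \<le> 2 * \<omega> \<xi> t"
        using powr_concave[of z "\<xi> + \<rho>"] \<rho>0 \<xi>0 by (simp add: \<omega>_def \<rho>_def[symmetric] algebra_simps)
    next
      fix z assume z: "0 \<le> z" "z \<le> 2 * \<xi>"
      then show "\<omega> (\<xi> + z) t \<le> 9/8 * \<omega> \<xi> t"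
        using powr_triple[of "\<xi> + \<rho>" "\<xi> + z + \<rho>"] \<rho>0 \<xi>0 by (simp add: \<omega>_def \<rho>_def[symmetric])
    qed (use \<xi>1 max eq \<omega>0 in auto)
    define Q where "Q = N * \<xi> powr (- 2 * s)"
    have N0: "0 \<le> N" using N\<omega> \<omega>0[of \<xi> t] by linarith
    have Q0: "0 \<le> Q" using N0 by (simp add: Q_def)
    have pow: "\<xi> powr a \<le> \<xi> powr (- 2 * s)" if "- 2 * s \<le> a" for a
      using that \<xi>0 \<xi>1 by (intro powr_mono') auto
    \<comment> \<open>The nonlinear term. Here the lower bound on s is decisive: \<xi> powr (-9/10)
      \<le> \<xi> powr (-2 * s) for \<xi> < 1. The factor 1/100, amplitude times exponent, is below
      c / 8.\<close>
    have i1: "N * \<omega>x \<le> c / 8 * Q"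
    proof -
      have "(\<xi> + \<rho>) powr (-9/10) \<le> \<xi> powr (-9/10)" using \<xi>0 \<rho>0 by (intro powr_mono2') auto
      also have "\<dots> \<le> \<xi> powr (- 2 * s)" using s by (intro pow) auto
      finally have "\<omega>x \<le> 1/100 * \<xi> powr (- 2 * s)" by (simp add: \<omega>x_def)
      then have "N * \<omega>x \<le> N * (1/100 * \<xi> powr (- 2 * s))" using N0 by (intro mult_left_mono) auto
      also have "\<dots> = 1/100 * Q" by (simp add: Q_def)
      also have "\<dots> \<le> c / 8 * Q" using c Q0 by (intro mult_right_mono) auto
      finally show ?thesis .
    qed
    \<comment> \<open>The cost of shrinking \<rho>. From 2 * sqrt \<xi> * m \<le> \<xi> + m^2 one
      gets 2 * m / (\<xi> + \<rho>) \<le> \<xi> powr (-1/2), which is weaker than the dissipation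
      since 2 * s \<ge> 1/2.\<close>
    have i2: "- \<omega>t \<le> c / 8 * Q"
    proof -
      have xr: "0 < \<xi> + \<rho>" using \<xi>0 \<rho>0 by simp
      have "(\<xi> + \<rho>) powr (-9/10) = (\<xi> + \<rho>) powr (1/10 - 1)" by simp
      also have "\<dots> = (\<xi> + \<rho>) powr (1/10) / (\<xi> + \<rho>)" using xr by (subst powr_diff) simp
      finally have wx: "\<omega>x = 1/10 * (\<omega> \<xi> t / (\<xi> + \<rho>))" by (simp add: \<omega>x_def \<omega>_def \<rho>_def)
      have "2 * (m t / (\<xi> + \<rho>)) \<le> \<xi> powr (-1/2)"
      proof -
        have "2 * (sqrt \<xi> * m t) \<le> \<xi> + \<rho>"
          using sum_squares_ge_zero[of "sqrt \<xi> - m t" 0] \<xi>0 by (simp add: \<rho>_def power2_eq_square algebra_simps)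
        moreover have "0 \<le> sqrt \<xi> * m t" using mt \<xi>0 by simp
        ultimately have "2 * (sqrt \<xi> * m t) \<le> \<xi> + \<rho>" by linarith
        then have "2 * (m t / (\<xi> + \<rho>)) \<le> 1 / sqrt \<xi>" using xr \<xi>0 by (simp add: field_simps)
        also have "\<dots> = \<xi> powr (-1/2)" using \<xi>0 by (simp add: powr_minus_divide powr_half_sqrt flip: minus_divide_left)
        finally show ?thesis .
      qed
      also have "\<dots> \<le> \<xi> powr (- 2 * s)" using s by (intro pow) auto
      finally have mm: "2 * (m t / (\<xi> + \<rho>)) \<le> \<xi> powr (- 2 * s)" .
      have "- \<omega>t = 1/100 * (\<omega> \<xi> t * (2 * (m t / (\<xi> + \<rho>))))" unfolding \<omega>t_def wx by simp
      also have "\<dots> \<le> 1/100 * (N * \<xi> powr (- 2 * s))"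
        using N0 N\<omega> mm mt xr by (intro mult_left_mono mult_mono) auto
      also have "\<dots> = 1/100 * Q" by (simp add: Q_def)
      also have "\<dots> \<le> c / 8 * Q" using c Q0 by (intro mult_right_mono) auto
      finally show ?thesis .
    qed
    have 1: "c * (frac_diff s ?f y - frac_diff s ?f x) \<le> 4 * c * log_mass s * \<eta> - 3/8 * c * Q"
      using mult_left_mono[OF frac_diff, of c] c_pos by (simp add: Q_def algebra_simps)
    have sd: "sdiff ?f y z - sdiff ?f x z \<le> 4 * \<eta> * ln (1 + z\<^sup>2)" for z
    proof -
      have "sdiff ?f y z - sdiff ?f x z \<le> \<eta> * (sdiff log_weight x z + sdiff log_weight y z)"
        using max[of "y + z" "x + z"] max[of "y - z" "x - z"] yx eq by (simp add: sdiff_def algebra_simps)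
      also have "\<dots> \<le> \<eta> * (2 * ln (1 + z\<^sup>2) + 2 * ln (1 + z\<^sup>2))"
        using \<eta> by (intro mult_left_mono add_mono sdiff_log_weight_le) auto
      finally show ?thesis by simp
    qed
    have "uxx y t - uxx x t \<le> 4 * \<eta>"
      using diff_le_of_sdiff_le(2)[OF C2 s'(1,2) _ sd] \<eta> by simp
    then have 2: "\<epsilon> * (uxx y t - uxx x t) \<le> 4 * \<epsilon> * \<eta>"
      using mult_left_mono[of "uxx y t - uxx x t" "4 * \<eta>" \<epsilon>] eps by (simp add: algebra_simps)
    have 3: "- (u z t * (\<eta> * (2 * z / (1 + z\<^sup>2)))) \<le> B * \<eta>" for z
    proof -
      have "\<bar>u z t\<bar> * \<bar>\<eta> * (2 * z / (1 + z\<^sup>2))\<bar> \<le> B * \<eta>"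
        using B0 B[of t z] pt(2) \<eta> by (intro mult_mono log_weight_deriv_scaled) auto
      then show ?thesis by (simp only: abs_mult[symmetric])
    qed
    have "ut y t - ut x t = - (u y t * ux y t) - u x t * (- ux x t)
      + c * (frac_diff s ?f y - frac_diff s ?f x) + \<epsilon> * (uxx y t - uxx x t)"
      unfolding pde[OF tpos] by (simp add: algebra_simps)
    also have "\<dots> = N * \<omega>x + (- (u y t * (\<eta> * (2 * y / (1 + y\<^sup>2)))) - u x t * (\<eta> * (2 * x / (1 + x\<^sup>2))))
      + c * (frac_diff s ?f y - frac_diff s ?f x) + \<epsilon> * (uxx y t - uxx x t)"
    proof -
      have "- (a * (- w + g)) - b * (w + h) + k + l = (a - b) * w + (- (a * g) - b * h) + k + l" for a b g h k l w :: real
        by (simp add: algebra_simps)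
      then show ?thesis unfolding dx dy N_def .
    qed
    \<comment> \<open>Of the dissipation 3/8 * c * Q, one eighth pays for the nonlinearity and one
      for the motion of \<rho>; the last eighth is left over.\<close>
    finally have "\<eta> * \<Lambda> \<le> 2 * (B * \<eta>) + 4 * c * log_mass s * \<eta> + 4 * \<epsilon> * \<eta> - c / 8 * Q"
      using dt 1 2 3[of x] 3[of y] i1 i2 by linarith
    also have "\<dots> = \<eta> * \<Lambda> - \<eta> - c / 8 * Q" by (simp add: \<Lambda>_def algebra_simps)
    finally have "\<eta> + c / 8 * Q \<le> 0" by simp
    moreover have "0 \<le> c / 8 * Q" using c_pos Q0 by (intro mult_nonneg_nonneg) auto
    ultimately show False using \<eta> by linarith
  qed
  moreover have "\<omega> (x1 - y1) t1 = 1/10 * (x1 - y1) powr (1/10)" by (simp add: \<omega>_def m_def t0_def)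
  ultimately show "u y1 t1 - u x1 t1 \<le> 1/10 * (x1 - y1) powr (1/10) + e"
    using D by (simp add: \<eta>_def)
qed

text \<open>The two signs of the difference have different causes. Increase from left to right is
  limited by Oleinik's inequality for distances up to 1, where t1 \<ge> 10 supplies the constant
  1/10, and by the size of u beyond. Only decrease, the direction of shocks, needs the
  modulus.\<close>

lemma holder:
  assumes T: "0 < T" and small: "\<And>x t. T \<le> t \<Longrightarrow> \<bar>u x t\<bar> \<le> 1/30" and t1: "T + 10 \<le> t1"
  shows "\<bar>u x t1 - u y t1\<bar> \<le> 1/10 * \<bar>x - y\<bar> powr (1/10)"
proof -
  have main: "\<bar>u x t1 - u y t1\<bar> \<le> 1/10 * (x - y) powr (1/10)" if xy: "y \<le> x" for x y
  proof -
    have "u x t1 - u y t1 \<le> 1/10 * (x - y) powr (1/10)"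
    proof (cases "x - y \<le> 1")
      case True
      have "u x t1 - u y t1 \<le> (x - y) / t1" using T t1 by (intro oleinik xy) auto
      also have "\<dots> \<le> (x - y) / 10" using T t1 xy by (intro divide_left_mono) auto
      also have "x - y \<le> (x - y) powr (1/10)"
        using powr_mono'[of "1/10" 1 "x - y"] True xy by simp
      finally show ?thesis by simp
    next
      case False
      then have "1 \<le> (x - y) powr (1/10)" by (intro ge_one_powr_ge_zero) auto
      moreover have "u x t1 - u y t1 \<le> 1/10" using small[of t1 x] small[of t1 y] t1 by auto
      ultimately show ?thesis by linarith
    qed
    moreover have "u y t1 - u x t1 \<le> 1/10 * (x - y) powr (1/10)"
      by (rule holder_shock_side[OF T small t1 xy])
    ultimately show ?thesis by linarith
  qed
  show ?thesis
    using main[of x y] main[of y x] by (cases "y \<le> x") (auto simp: abs_minus_commute)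
qed

end

section \<open>Viscous solutions\<close>

lemma open_spacetime: "open (spacetime :: (real \<times> real) set)"
  by (intro open_Times) auto

lemma Ck_on_partial:
  fixes f :: "real \<times> real \<Rightarrow> real"
  assumes "Ck_on (Suc k) S f" "p \<in> S"
  shows "((\<lambda>y. f (y, snd p)) has_real_derivative frechet_derivative f (at p) (1, 0)) (at (fst p))"
    "((\<lambda>\<tau>. f (fst p, \<tau>)) has_real_derivative frechet_derivative f (at p) (0, 1)) (at (snd p))"
proof -
  have D: "(f has_derivative frechet_derivative f (at p)) (at p)"
    using assms by (simp add: frechet_derivative_works)
  then interpret L: bounded_linear "frechet_derivative f (at p)" by (rule has_derivative_bounded_linear)
  have scale: "frechet_derivative f (at p) (h, 0) = h * frechet_derivative f (at p) (1, 0)"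
    "frechet_derivative f (at p) (0, h) = h * frechet_derivative f (at p) (0, 1)" for h
    using L.scaleR[of h "(1, 0)"] L.scaleR[of h "(0, 1)"] by auto
  have eq1: "(\<lambda>h. frechet_derivative f (at p) (h, 0)) = (*) (frechet_derivative f (at p) (1, 0))"
    by (rule ext, subst scale(1)) simp
  have eq2: "(\<lambda>h. frechet_derivative f (at p) (0, h)) = (*) (frechet_derivative f (at p) (0, 1))"
    by (rule ext, subst scale(2)) simp
  have "((\<lambda>y. (y, snd p)) has_derivative (\<lambda>h. (h, 0))) (at (fst p))"
    by (auto intro!: derivative_eq_intros)
  moreover have "(f has_derivative frechet_derivative f (at p)) (at ((\<lambda>y. (y, snd p)) (fst p)))" using D by simp
  ultimately have "((\<lambda>y. f (y, snd p)) has_derivative (\<lambda>h. frechet_derivative f (at p) (h, 0))) (at (fst p))"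
    by (rule has_derivative_compose)
  then show "((\<lambda>y. f (y, snd p)) has_real_derivative frechet_derivative f (at p) (1, 0)) (at (fst p))"
    unfolding has_field_derivative_def eq1 .
  have "((\<lambda>\<tau>. (fst p, \<tau>)) has_derivative (\<lambda>h. (0, h))) (at (snd p))"
    by (auto intro!: derivative_eq_intros)
  moreover have "(f has_derivative frechet_derivative f (at p)) (at ((\<lambda>\<tau>. (fst p, \<tau>)) (snd p)))" using D by simp
  ultimately have "((\<lambda>\<tau>. f (fst p, \<tau>)) has_derivative (\<lambda>h. frechet_derivative f (at p) (0, h))) (at (snd p))"
    by (rule has_derivative_compose)
  then show "((\<lambda>\<tau>. f (fst p, \<tau>)) has_real_derivative frechet_derivative f (at p) (0, 1)) (at (snd p))"
    unfolding has_field_derivative_def eq2 .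
qed

lemma Ck_on_continuous:
  assumes "Ck_on k S f"
  shows "continuous_on S f"
proof (cases k)
  case (Suc n)
  then have "f differentiable_on S"
    using assms by (intro differentiable_at_imp_differentiable_on) simp
  then show ?thesis by (rule differentiable_imp_continuous_on)
qed (use assms in simp)

lemma smooth_on_partials:
  fixes f :: "real \<times> real \<Rightarrow> real"
  assumes f: "smooth_on spacetime f"
  shows "0 < t \<Longrightarrow> ((\<lambda>y. f (y, t)) has_real_derivative dx f (x, t)) (at x)"
    "0 < t \<Longrightarrow> ((\<lambda>\<tau>. f (x, \<tau>)) has_real_derivative dt f (x, t)) (at t)"
    "0 < t \<Longrightarrow> ((\<lambda>y. dx f (y, t)) has_real_derivative dx (dx f) (x, t)) (at x)"
    "continuous_on spacetime f" "continuous_on spacetime (dt f)" "continuous_on spacetime (dx (dx f))"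
proof -
  have C1: "Ck_on (Suc 0) spacetime f" and C2: "Ck_on (Suc (Suc 0)) spacetime f"
    using f unfolding smooth_on_def by blast+
  let ?X = "\<lambda>p. frechet_derivative f (at p) (1, 0)" and ?T = "\<lambda>p. frechet_derivative f (at p) (0, 1)"
  let ?XX = "\<lambda>p. frechet_derivative ?X (at p) (1, 0)"
  have X: "dx f p = ?X p" and T: "dt f p = ?T p" if "p \<in> spacetime" for p
    unfolding dx_def dt_def by (rule DERIV_imp_deriv[OF Ck_on_partial(1)[OF C1 that]] DERIV_imp_deriv[OF Ck_on_partial(2)[OF C1 that]])+
  have CX: "Ck_on (Suc 0) spacetime ?X" and CT: "Ck_on (Suc 0) spacetime ?T"
    using C2 by (simp_all only: Ck_on.simps) blast+
  have XX: "((\<lambda>y. dx f (y, snd p)) has_real_derivative ?XX p) (at (fst p))" if "p \<in> spacetime" for p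
  proof -
    have "(\<lambda>y. dx f (y, snd p)) = (\<lambda>y. ?X (y, snd p))" using X that by (cases p) (auto intro!: ext)
    then show ?thesis using Ck_on_partial(1)[OF CX that] by simp
  qed
  have XX': "dx (dx f) p = ?XX p" if "p \<in> spacetime" for p
    using DERIV_imp_deriv[OF XX[OF that]] by (simp add: dx_def)
  show "((\<lambda>y. f (y, t)) has_real_derivative dx f (x, t)) (at x)" if "0 < t"
    using Ck_on_partial(1)[OF C1, of "(x, t)"] X[of "(x, t)"] that by simp
  show "((\<lambda>\<tau>. f (x, \<tau>)) has_real_derivative dt f (x, t)) (at t)" if "0 < t"
    using Ck_on_partial(2)[OF C1, of "(x, t)"] T[of "(x, t)"] that by simp
  show "((\<lambda>y. dx f (y, t)) has_real_derivative dx (dx f) (x, t)) (at x)" if "0 < t"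
    using XX[of "(x, t)"] XX'[of "(x, t)"] that by simp
  show "continuous_on spacetime f" by (rule Ck_on_continuous[OF C1])
  show "continuous_on spacetime (dt f)"
    using Ck_on_continuous[OF CT] T by (simp cong: continuous_on_cong)
  have "Ck_on 0 spacetime ?XX" using CX by (simp only: Ck_on.simps)
  then show "continuous_on spacetime (dx (dx f))"
    using Ck_on_continuous[of 0 spacetime ?XX] XX' by (simp cong: continuous_on_cong)
qed

text \<open>For continuous u the set where the essential bound fails is open and null, hence
  empty.\<close>

lemma bounded_of_in_Linf_after:
  assumes cont: "continuous_on spacetime u" and t0: "0 < t0" and u: "in_Linf_after t0 u"
  shows "\<exists>B. \<forall>x. \<forall>t>t0. \<bar>u (x, t)\<bar> \<le> B"
proof -
  obtain C where C: "AE p in lborel. t0 < snd p \<longrightarrow> \<bar>u p\<bar> \<le> C"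
    using u by (auto simp: in_Linf_after_def)
  let ?S = "{p \<in> UNIV \<times> {t0<..}. C < \<bar>u p\<bar>}"
  have "continuous_on (UNIV \<times> {t0<..}) (\<lambda>p. \<bar>u p\<bar>)"
    using cont t0 by (intro continuous_intros continuous_on_subset[OF cont]) auto
  then have "open ((UNIV \<times> {t0<..}) \<inter> (\<lambda>p. \<bar>u p\<bar>) -` {C<..})"
    by (intro continuous_open_preimage open_Times) auto
  moreover have "(UNIV \<times> {t0<..}) \<inter> (\<lambda>p. \<bar>u p\<bar>) -` {C<..} = ?S" by auto
  ultimately have op: "open ?S" by simp
  have "AE p in lborel. p \<notin> ?S" using C by eventually_elim auto
  then have "?S \<in> null_sets lborel"
    using op by (subst AE_iff_null_sets) auto
  then have "negligible ?S"
    unfolding negligible_iff_null_sets by (rule null_sets_completionI)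
  then have "?S = {}" using op open_not_negligible by blast
  have "\<bar>u (x, t)\<bar> \<le> C" if "t0 < t" for x t
  proof (rule ccontr)
    assume "\<not> \<bar>u (x, t)\<bar> \<le> C"
    then have "(x, t) \<in> ?S" using that by simp
    then show False unfolding \<open>?S = {}\<close> by simp
  qed
  then show ?thesis by blast
qed

lemma viscous_solution_visc_burgers:
  assumes s: "9/20 < s" "s \<le> 1/2" and eps: "0 < \<epsilon>" and u: "viscous_solution s \<epsilon> \<theta>\<^sub>0 u"
    and Linf: "\<And>t. 0 < t \<Longrightarrow> in_Linf_after t u"
  shows "visc_burgers s \<epsilon> (frac_lap_const s) (\<lambda>x t. u (x, t)) (\<lambda>x t. dt u (x, t)) (\<lambda>x t. dx u (x, t))
    (\<lambda>x t. dx (dx u) (x, t))"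
proof -
  have sm: "smooth_on spacetime u" using u by (simp add: viscous_solution_def)
  note p = smooth_on_partials[OF sm]
  have bdd: "\<exists>B. \<forall>x. \<forall>t\<ge>t0. \<bar>u (x, t)\<bar> \<le> B" if t0: "0 < t0" for t0
  proof -
    \<comment> \<open>The essential bound holds strictly after its starting time; starting at t0 / 2
      covers all t \<ge> t0.\<close>
    obtain B where "\<forall>x. \<forall>t>t0 / 2. \<bar>u (x, t)\<bar> \<le> B"
      using bounded_of_in_Linf_after[OF p(4) _ Linf, of "t0 / 2"] t0 by auto
    then show ?thesis using t0 by (intro exI[of _ B]) auto
  qed
  have C2: "bdd_C2 (\<lambda>y. u (y, t)) (\<lambda>y. dx u (y, t)) (\<lambda>y. dx (dx u) (y, t))" if t: "0 < t" for t
  proof -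
    have "continuous_on UNIV (\<lambda>y. dx (dx u) (y, t))"
      using continuous_on_joint[of UNIV "{0<..}" "\<lambda>x t. dx (dx u) (x, t)" UNIV "\<lambda>y. y" "\<lambda>_. t"] p(6) t by simp
    then show ?thesis unfolding bdd_C2_def using p(1,3)[OF t] bdd[OF t] by blast
  qed
  show ?thesis
  proof
    show "9/20 < s" "s \<le> 1/2" "0 < \<epsilon>" "1/10 \<le> frac_lap_const s" using s eps frac_lap_const_ge by auto
    show "continuous_on spacetime (\<lambda>p. u (fst p, snd p))" "continuous_on spacetime (\<lambda>p. dt u (fst p, snd p))"
      "continuous_on spacetime (\<lambda>p. dx (dx u) (fst p, snd p))" using p(4-6) by simp_all
  next
    fix x t :: real assume t: "0 < t"
    have "dt u (x, t) + u (x, t) * dx u (x, t) + frac_lap s (\<lambda>y. u (y, t)) x - \<epsilon> * dx (dx u) (x, t) = 0"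
      using u t unfolding viscous_solution_def by blast
    moreover have "frac_lap s (\<lambda>y. u (y, t)) x = - frac_lap_const s * frac_diff s (\<lambda>y. u (y, t)) x"
      using s by (intro frac_lap_eq_frac_diff[OF C2[OF t]]) auto
    ultimately show "dt u (x, t) = - (u (x, t) * dx u (x, t)) + frac_lap_const s * frac_diff s (\<lambda>y. u (y, t)) x + \<epsilon> * dx (dx u) (x, t)"
      by simp
  qed (use p(1-3) bdd in blast)+
qed

section \<open>Bounds near the initial time and for large times\<close>

lemma abs_seg_mean_L2_le:
  fixes g :: "real \<Rightarrow> real" and h k :: real
  assumes g: "g \<in> borel_measurable borel" "integrable lborel (\<lambda>x. (g x)\<^sup>2)" and h: "h \<noteq> 0" and k: "0 < k"
  shows "integrable lborel (\<lambda>r. indicator {0..1} r * g (x + h * r))"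
    "\<bar>LINT r|lborel. indicator {0..1} r * g (x + h * r)\<bar> \<le> k / 2 + (LINT y|lborel. (g y)\<^sup>2) / (2 * k * \<bar>h\<bar>)"
proof -
  note [measurable] = g(1)
  let ?I = "indicator {0..1} :: real \<Rightarrow> real"
  have I: "integrable lborel ?I" by (intro integrable_real_indicator) auto
  have G: "integrable lborel (\<lambda>r. (g (x + h * r))\<^sup>2)"
    using lborel_integrable_real_affine[OF g(2) h, of x] .
  have R: "integrable lborel (\<lambda>r. k / 2 * ?I r + (g (x + h * r))\<^sup>2 / (2 * k))"
    by (intro Bochner_Integration.integrable_add integrable_mult_right integrable_divide I G)
  have le: "norm (?I r * g (x + h * r)) \<le> k / 2 * ?I r + (g (x + h * r))\<^sup>2 / (2 * k)" for r
  proof -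
    \<comment> \<open>Young's inequality with a free k in place of Cauchy-Schwarz. The optimal k,
      the norm of g divided by sqrt \<bar>h\<bar>, returns the Cauchy-Schwarz bound.\<close>
    have "0 \<le> (\<bar>g (x + h * r)\<bar> - k)\<^sup>2" by simp
    then have "2 * k * \<bar>g (x + h * r)\<bar> \<le> k\<^sup>2 + (g (x + h * r))\<^sup>2"
      by (simp add: power2_diff mult_ac)
    then have "\<bar>g (x + h * r)\<bar> \<le> k / 2 + (g (x + h * r))\<^sup>2 / (2 * k)"
      using k by (simp add: field_simps power2_eq_square)
    then show ?thesis using k by (simp add: indicator_def)
  qed
  show i: "integrable lborel (\<lambda>r. ?I r * g (x + h * r))"
  proof (rule Bochner_Integration.integrable_bound[OF R])
    show "AE r in lborel. norm (?I r * g (x + h * r)) \<le> norm (k / 2 * ?I r + (g (x + h * r))\<^sup>2 / (2 * k))"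
      using le by (intro AE_I2) (metis abs_ge_self order_trans real_norm_def)
  qed measurable
  have "\<bar>LINT r|lborel. ?I r * g (x + h * r)\<bar> \<le> (LINT r|lborel. k / 2 * ?I r + (g (x + h * r))\<^sup>2 / (2 * k))"
    using le by (intro order_trans[OF integral_abs_bound integral_mono[OF integrable_abs[OF i] R]]) simp
  also have "\<dots> = k / 2 + (LINT r|lborel. (g (x + h * r))\<^sup>2) / (2 * k)"
    using I G by (subst Bochner_Integration.integral_add) auto
  also have "(LINT r|lborel. (g (x + h * r))\<^sup>2) = (LINT y|lborel. (g y)\<^sup>2) / \<bar>h\<bar>"
    using lborel_integral_real_affine[OF h, of "\<lambda>y. (g y)\<^sup>2" x] h by simp
  finally show "\<bar>LINT r|lborel. ?I r * g (x + h * r)\<bar> \<le> k / 2 + (LINT y|lborel. (g y)\<^sup>2) / (2 * k * \<bar>h\<bar>)"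
    by (simp add: mult_ac)
qed

lemma eventually_abs_seg_mean_le:
  fixes u :: "real \<times> real \<Rightarrow> real"
  assumes \<theta>: "in_L2 \<theta>\<^sub>0" and u: "continuous_on spacetime u"
    and lim: "((\<lambda>t. \<integral>\<^sup>+x. ennreal ((u (x, t) - \<theta>\<^sub>0 x)\<^sup>2) \<partial>lborel) \<longlongrightarrow> 0) (at_right 0)"
    and h: "h \<noteq> 0" and \<sigma>: "0 < \<sigma>"
  shows "\<forall>\<^sub>F t in at_right 0. \<forall>x. \<bar>seg_mean h (\<lambda>y. u (y, t)) x\<bar> \<le> L2_norm \<theta>\<^sub>0 / sqrt \<bar>h\<bar> + \<sigma>"
proof -
  have \<theta>m[measurable]: "\<theta>\<^sub>0 \<in> borel_measurable borel" and \<theta>i: "integrable lborel (\<lambda>x. (\<theta>\<^sub>0 x)\<^sup>2)"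
    using \<theta> by (auto simp: in_L2_def)
  define M where "M = L2_norm \<theta>\<^sub>0"
  have M2: "M\<^sup>2 = (LINT x|lborel. (\<theta>\<^sub>0 x)\<^sup>2)" and M0: "0 \<le> M"
    by (auto simp: M_def L2_norm_def)
  \<comment> \<open>The threshold is chosen so that, with k = \<sigma> / 2, both terms of the bound
    for the mean of u - \<open>\<theta>\<^sub>0\<close> are at most \<sigma> / 4.\<close>
  have e: "\<forall>\<^sub>F t in at_right 0. (\<integral>\<^sup>+x. ennreal ((u (x, t) - \<theta>\<^sub>0 x)\<^sup>2) \<partial>lborel) < ennreal (\<sigma>\<^sup>2 * \<bar>h\<bar> / 4)"
    using h \<sigma> by (intro order_tendstoD(2)[OF lim]) simp
  have p: "\<forall>\<^sub>F t in at_right 0. (0::real) < t" by (rule eventually_at_right_less)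
  from e p show ?thesis
  proof eventually_elim
    case (elim t)
    have cf: "continuous_on UNIV (\<lambda>y. u (y, t))"
      using continuous_on_joint[of UNIV "{0<..}" "\<lambda>x t. u (x, t)" UNIV "\<lambda>y. y" "\<lambda>_. t"] u elim(2) by simp
    then have [measurable]: "(\<lambda>y. u (y, t)) \<in> borel_measurable borel" by (rule borel_measurable_continuous_onI)
    define d where "d = (\<lambda>y. u (y, t) - \<theta>\<^sub>0 y)"
    have dm[measurable]: "d \<in> borel_measurable borel" unfolding d_def by measurable
    have nn: "(\<integral>\<^sup>+x. ennreal ((d x)\<^sup>2) \<partial>lborel) < ennreal (\<sigma>\<^sup>2 * \<bar>h\<bar> / 4)" using elim(1) by (simp add: d_def)
    have di: "integrable lborel (\<lambda>x. (d x)\<^sup>2)"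
    proof (rule integrableI_bounded)
      have "(\<integral>\<^sup>+x. ennreal (norm ((d x)\<^sup>2)) \<partial>lborel) = (\<integral>\<^sup>+x. ennreal ((d x)\<^sup>2) \<partial>lborel)" by simp
      also have "\<dots> < \<infinity>" using nn by (rule order_less_trans) simp
      finally show "(\<integral>\<^sup>+x. ennreal (norm ((d x)\<^sup>2)) \<partial>lborel) < \<infinity>" .
    qed measurable
    have "ennreal (LINT x|lborel. (d x)\<^sup>2) < ennreal (\<sigma>\<^sup>2 * \<bar>h\<bar> / 4)"
      using nn nn_integral_eq_integral[OF di] by simp
    then have dle: "(LINT x|lborel. (d x)\<^sup>2) \<le> \<sigma>\<^sup>2 * \<bar>h\<bar> / 4"
      using \<sigma> by (simp add: ennreal_less_iff integral_nonneg_AE)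
    show ?case
    proof
      fix x
      define q where "q = M / sqrt \<bar>h\<bar>"
      have q: "0 \<le> q" using M0 by (simp add: q_def)
      \<comment> \<open>The optimal k for \<open>\<theta>\<^sub>0\<close> is q; the shift keeps it
        positive when the norm vanishes.\<close>
      define k1 where "k1 = q + \<sigma> / 2"
      have k1: "0 < k1" using q \<sigma> by (simp add: k1_def)
      have k2: "0 < \<sigma> / 2" using \<sigma> by simp
      note a1 = abs_seg_mean_L2_le[OF \<theta>m \<theta>i h k1, of x] and a2 = abs_seg_mean_L2_le[OF dm di h k2, of x]
      have arith: "v \<le> q + \<sigma>" if "v \<le> (k1 / 2 + a) + (\<sigma> / 2 / 2 + b)" "a \<le> q / 2" "b \<le> b'" "b' = \<sigma> / 4"
        "k1 = q + \<sigma> / 2" for v a b b' using that \<sigma> by linarith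
      have "seg_mean h (\<lambda>y. u (y, t)) x = (LINT r|lborel. indicator {0..1} r * u (x + h * r, t))"
        unfolding seg_mean_def by (rule integrable_01_continuous(2)[OF continuous_shift[OF cf], symmetric])
      also have "\<dots> = (LINT r|lborel. indicator {0..1} r * \<theta>\<^sub>0 (x + h * r) + indicator {0..1} r * d (x + h * r))"
        by (rule Bochner_Integration.integral_cong) (auto simp: d_def algebra_simps)
      also have "\<dots> = (LINT r|lborel. indicator {0..1} r * \<theta>\<^sub>0 (x + h * r)) + (LINT r|lborel. indicator {0..1} r * d (x + h * r))"
        by (rule Bochner_Integration.integral_add[OF a1(1) a2(1)])
      finally have "\<bar>seg_mean h (\<lambda>y. u (y, t)) x\<bar> \<le> (k1 / 2 + M\<^sup>2 / (2 * k1 * \<bar>h\<bar>))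
          + (\<sigma> / 2 / 2 + (LINT y|lborel. (d y)\<^sup>2) / (2 * (\<sigma> / 2) * \<bar>h\<bar>))"
        using a1(2) a2(2) unfolding M2 by linarith
      moreover have "M\<^sup>2 / (2 * k1 * \<bar>h\<bar>) \<le> q / 2"
      proof -
        have "M\<^sup>2 / \<bar>h\<bar> = q\<^sup>2" by (simp add: power_divide q_def)
        also have "\<dots> \<le> q * k1"
          unfolding power2_eq_square k1_def using q \<sigma> by (intro mult_left_mono) auto
        finally have "M\<^sup>2 / \<bar>h\<bar> / (2 * k1) \<le> q * k1 / (2 * k1)"
          using k1 by (intro divide_right_mono) auto
        then show ?thesis using k1 by (simp add: mult_ac)
      qed
      moreover have "(LINT y|lborel. (d y)\<^sup>2) / (2 * (\<sigma> / 2) * \<bar>h\<bar>) \<le> (\<sigma>\<^sup>2 * \<bar>h\<bar> / 4) / (2 * (\<sigma> / 2) * \<bar>h\<bar>)"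
        using dle \<sigma> h by (intro divide_right_mono) auto
      moreover have "(\<sigma>\<^sup>2 * \<bar>h\<bar> / 4) / (2 * (\<sigma> / 2) * \<bar>h\<bar>) = \<sigma> / 4" using \<sigma> h by (simp add: power2_eq_square)
      ultimately show "\<bar>seg_mean h (\<lambda>y. u (y, t)) x\<bar> \<le> L2_norm \<theta>\<^sub>0 / sqrt \<bar>h\<bar> + \<sigma>"
        unfolding M_def[symmetric] q_def[symmetric] by (rule arith) (simp add: k1_def)
    qed
  qed
qed

lemma viscous_solution_decay:
  assumes s: "9/20 < s" "s \<le> 1/2" and eps: "0 < \<epsilon>" and u: "viscous_solution s \<epsilon> \<theta>\<^sub>0 u"
    and Linf: "\<And>t. 0 < t \<Longrightarrow> in_Linf_after t u" and \<theta>: "in_L2 \<theta>\<^sub>0" and t: "0 < t"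
  shows "\<bar>u (x, t)\<bar> \<le> 100 * (L2_norm \<theta>\<^sub>0 + 1) * t powr (-1 / (4 * s))"
proof -
  interpret V: visc_burgers s \<epsilon> "frac_lap_const s" "\<lambda>x t. u (x, t)" "\<lambda>x t. dt u (x, t)" "\<lambda>x t. dx u (x, t)"
    "\<lambda>x t. dx (dx u) (x, t)"
    by (rule viscous_solution_visc_burgers[OF s eps u Linf])
  interpret W: visc_burgers s \<epsilon> "frac_lap_const s" "\<lambda>x t. - u (- x, t)" "\<lambda>x t. - dt u (- x, t)" "\<lambda>x t. dx u (- x, t)"
    "\<lambda>x t. - dx (dx u) (- x, t)"
    by (rule V.reflect)
  let ?M = "L2_norm \<theta>\<^sub>0"
  have M: "0 \<le> ?M" by (simp add: L2_norm_def)
  have cu: "continuous_on spacetime u" using V.cont_u by simp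
  have ev: "\<forall>\<^sub>F t in at_right 0. \<forall>x. \<bar>seg_mean h (\<lambda>y. u (y, t)) x\<bar> \<le> ?M / sqrt \<bar>h\<bar> + \<sigma>" if "h \<noteq> 0" "0 < \<sigma>" for h \<sigma>
    using u that by (intro eventually_abs_seg_mean_le[OF \<theta> cu]) (auto simp: viscous_solution_def)
  have refl: "seg_mean h (\<lambda>y. - u (- y, t)) x = - seg_mean (- h) (\<lambda>y. u (y, t)) (- x)" for h t x
    by (simp add: seg_mean_def)
  \<comment> \<open>The barrier needs a positive amplitude even for zero data, hence ?M + 1.\<close>
  have le: "?M / sqrt \<bar>h\<bar> \<le> (?M + 1) / sqrt \<bar>h\<bar>" for h by (simp add: divide_right_mono)
  have A1: "seg_mean h (\<lambda>y. u (y, t)) x \<le> (?M + 1) / sqrt \<bar>h\<bar>" if "0 < t" "h \<noteq> 0" for h t x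
  proof -
    have "seg_mean h (\<lambda>y. u (y, t)) x \<le> ?M / sqrt \<bar>h\<bar>"
    proof (rule V.seg_mean_le[OF that(2,1)])
      fix \<sigma> :: real assume "0 < \<sigma>"
      from ev[OF that(2) this] show "\<forall>\<^sub>F t in at_right 0. \<forall>x. seg_mean h (\<lambda>y. u (y, t)) x \<le> ?M / sqrt \<bar>h\<bar> + \<sigma>"
        by eventually_elim (auto simp: abs_le_iff)
    qed
    then show ?thesis using le[of h] by linarith
  qed
  have A2: "seg_mean h (\<lambda>y. - u (- y, t)) x \<le> (?M + 1) / sqrt \<bar>h\<bar>" if "0 < t" "h \<noteq> 0" for h t x
  proof -
    have "seg_mean h (\<lambda>y. - u (- y, t)) x \<le> ?M / sqrt \<bar>h\<bar>"
    proof (rule W.seg_mean_le[OF that(2,1)])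
      fix \<sigma> :: real assume "0 < \<sigma>"
      have "- h \<noteq> 0" using that by simp
      from ev[OF this \<open>0 < \<sigma>\<close>] show "\<forall>\<^sub>F t in at_right 0. \<forall>x. seg_mean h (\<lambda>y. - u (- y, t)) x \<le> ?M / sqrt \<bar>h\<bar> + \<sigma>"
        unfolding refl by eventually_elim (simp add: abs_le_iff)
    qed
    then show ?thesis using le[of h] by linarith
  qed
  have "0 < ?M + 1" using M by simp
  from V.u_le_decay[OF this A1 t, of x] W.u_le_decay[OF this A2 t, of "- x"]
  show ?thesis by (simp add: abs_le_iff)
qed

text \<open>As s \<le> 1/2, the decay for t \<ge> 1 is at least as fast as 100 * (L2_norm
  \<open>\<theta>\<^sub>0\<close> + 1) / sqrt t. This is at most 1/30 once sqrt t is 3000 * (L2_norm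
  \<open>\<theta>\<^sub>0\<close> + 1); the further 10 units of time let the jump of the modulus
  close.\<close>

lemma viscous_solution_holder:
  assumes s: "9/20 < s" "s \<le> 1/2" and eps: "0 < \<epsilon>" and u: "viscous_solution s \<epsilon> \<theta>\<^sub>0 u"
    and Linf: "\<And>t. 0 < t \<Longrightarrow> in_Linf_after t u" and \<theta>: "in_L2 \<theta>\<^sub>0" and t: "(3000 * (L2_norm \<theta>\<^sub>0 + 1))\<^sup>2 + 10 \<le> t"
  shows "\<bar>u (x, t) - u (y, t)\<bar> \<le> 1/10 * \<bar>x - y\<bar> powr (1/10)"
proof -
  interpret V: visc_burgers s \<epsilon> "frac_lap_const s" "\<lambda>x t. u (x, t)" "\<lambda>x t. dt u (x, t)" "\<lambda>x t. dx u (x, t)"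
    "\<lambda>x t. dx (dx u) (x, t)"
    by (rule viscous_solution_visc_burgers[OF s eps u Linf])
  let ?M = "L2_norm \<theta>\<^sub>0"
  have M: "0 \<le> ?M" by (simp add: L2_norm_def)
  have small: "\<bar>u (x, t)\<bar> \<le> 1/30" if t: "(3000 * (?M + 1))\<^sup>2 \<le> t" for x t
  proof -
    have st: "3000 * (?M + 1) \<le> sqrt t" using t M by (simp add: real_le_rsqrt)
    have "1 \<le> (3000 * (?M + 1))\<^sup>2" using M by (intro one_le_power) simp
    then have t1: "1 \<le> t" using t by simp
    have "\<bar>u (x, t)\<bar> \<le> 100 * (?M + 1) * t powr (-1 / (4 * s))"
      using t1 by (intro viscous_solution_decay[OF s eps u Linf \<theta>]) auto
    also have "\<dots> \<le> 100 * (?M + 1) * t powr (-1/2)"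
      using t1 s M by (intro mult_left_mono powr_mono) (auto simp: field_simps)
    also have "t powr (-1/2) = 1 / sqrt t" using t1 by (simp add: powr_minus_divide powr_half_sqrt flip: minus_divide_left)
    also have "100 * (?M + 1) * (1 / sqrt t) \<le> 1/30" using st t1 M by (simp add: field_simps)
    finally show ?thesis .
  qed
  have T: "0 < (3000 * (?M + 1))\<^sup>2" using M by simp
  from V.holder[OF T small t] show ?thesis .
qed

section \<open>Time regularity of means\<close>

lemma seg_mean_add_const:
  assumes "continuous_on UNIV f"
  shows "seg_mean h (\<lambda>y. f y + C) x = seg_mean h f x + C"
  unfolding seg_mean_def
  using integrable_continuous_real[OF continuous_shift[OF assms, of "{0..1}" x h]]
  by (subst Henstock_Kurzweil_Integration.integral_add) auto

lemma seg_mean_diff_le: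
  assumes "continuous_on UNIV f" "continuous_on UNIV g" "\<And>r. 0 \<le> r \<Longrightarrow> r \<le> 1 \<Longrightarrow> \<bar>f (x + h * r) - g (y + k * r)\<bar> \<le> C"
  shows "\<bar>seg_mean h f x - seg_mean k g y\<bar> \<le> C"
proof -
  have c: "continuous_on UNIV (\<lambda>y. f y + C)" "continuous_on UNIV (\<lambda>y. g y + C)"
    using assms by (auto intro!: continuous_intros)
  have "seg_mean h f x \<le> seg_mean k (\<lambda>y. g y + C) y"
  proof (rule seg_mean_mono[OF assms(1) c(2)])
    fix r :: real assume "0 \<le> r" "r \<le> 1"
    from assms(3)[OF this] show "f (x + h * r) \<le> g (y + k * r) + C" by linarith
  qed
  moreover have "seg_mean k g y \<le> seg_mean h (\<lambda>y. f y + C) x"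
  proof (rule seg_mean_mono[OF assms(2) c(1)])
    fix r :: real assume "0 \<le> r" "r \<le> 1"
    from assms(3)[OF this] show "g (y + k * r) \<le> f (x + h * r) + C" by linarith
  qed
  ultimately show ?thesis unfolding seg_mean_add_const[OF assms(1)] seg_mean_add_const[OF assms(2)] by linarith
qed

text \<open>A mean over length h is Lipschitz with constant 2 * B / h, so a second averaging at a
  scale \<eta> much smaller than h hardly changes it.\<close>

lemma seg_mean_near:
  assumes f: "bdd_C2 f f' f''" and B: "\<And>x. \<bar>f x\<bar> \<le> B" and h: "0 < h" and \<eta>: "0 < \<eta>"
  shows "\<bar>seg_mean \<eta> (seg_mean h f) x - seg_mean h f x\<bar> \<le> 2 * B * \<eta> / h"
proof -
  have h0: "h \<noteq> 0" using h by simp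
  have B0: "0 \<le> B" using B[of 0] by linarith
  note C2 = seg_mean_C2[OF f h0]
  have d: "(seg_mean h f has_real_derivative (f (x + h) - f x) / h) (at x within UNIV)" for x
    using C2 unfolding bdd_C2_def by simp
  have bd: "norm ((f (x + h) - f x) / h) \<le> 2 * B / h" for x
    using B[of "x + h"] B[of x] h by (simp add: divide_right_mono)
  have "\<bar>seg_mean \<eta> (seg_mean h f) x - seg_mean 0 (seg_mean h f) x\<bar> \<le> 2 * B * \<eta> / h"
  proof (rule seg_mean_diff_le[OF bdd_C2_continuous(1)[OF C2] bdd_C2_continuous(1)[OF C2]])
    fix r :: real assume r: "0 \<le> r" "r \<le> 1"
    have "norm (seg_mean h f (x + \<eta> * r) - seg_mean h f x) \<le> 2 * B / h * norm (x + \<eta> * r - x)"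
      by (rule field_differentiable_bound[OF convex_UNIV d bd]) auto
    also have "\<dots> = 2 * B / h * (\<eta> * r)" using r \<eta> by simp
    also have "\<dots> \<le> 2 * B / h * (\<eta> * 1)" using r \<eta> h B0 by (intro mult_left_mono) auto
    finally show "\<bar>seg_mean h f (x + \<eta> * r) - seg_mean h f (x + 0 * r)\<bar> \<le> 2 * B * \<eta> / h" by simp
  qed
  moreover have "seg_mean 0 (seg_mean h f) x = seg_mean h f x" by (simp add: seg_mean_def[of 0])
  ultimately show ?thesis by simp
qed

lemma frac_diff_abs_le:
  assumes f: "bdd_C2 f f' f''" and s: "1/4 < s" "s < 1"
    and B: "\<And>x. \<bar>f x\<bar> \<le> B" and C: "\<And>x. \<bar>f'' x\<bar> \<le> C"
  shows "\<bar>frac_diff s f x\<bar> \<le> (2 * C + 4 * B) * (LINT z|lborel. dom_fun z * frac_ker s z)"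
proof -
  have d: "(f has_real_derivative f' x) (at x)" "(f' has_real_derivative f'' x) (at x)" for x
    using f unfolding bdd_C2_def by blast+
  have B0: "0 \<le> B" and C0: "0 \<le> C" using B[of 0] C[of 0] by linarith+
  have sd: "\<bar>sdiff f x z\<bar> \<le> (2 * C + 4 * B) * dom_fun z" if z: "0 < z" for z
  proof (cases "z \<le> 1")
    case True
    have "\<bar>sdiff f x z\<bar> \<le> 2 * C * z\<^sup>2" by (rule sdiff_le_square[OF d C z])
    also have "\<dots> \<le> (2 * C + 4 * B) * z\<^sup>2" using B0 by (intro mult_right_mono) auto
    finally show ?thesis using True by (simp add: dom_fun_def)
  next
    case False
    have "\<bar>sdiff f x z\<bar> \<le> 4 * B"
      using B[of "x + z"] B[of "x - z"] B[of x] unfolding sdiff_def by linarith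
    also have "\<dots> \<le> (2 * C + 4 * B) * 1" using C0 by simp
    also have "\<dots> \<le> (2 * C + 4 * B) * sqrt z" using False C0 B0 by (intro mult_left_mono) auto
    finally show ?thesis using False by (simp add: dom_fun_def)
  qed
  have "\<bar>frac_diff s f x\<bar> \<le> (LINT z|lborel. (2 * C + 4 * B) * (dom_fun z * frac_ker s z))"
    unfolding frac_diff_def
  proof (rule integral_abs_bound_integral[OF integrable_sdiff_frac_ker[OF f s]])
    show "integrable lborel (\<lambda>z. (2 * C + 4 * B) * (dom_fun z * frac_ker s z))"
      using integrable_dom_fun_frac_ker[OF s] by simp
    show "\<bar>sdiff f x z * frac_ker s z\<bar> \<le> (2 * C + 4 * B) * (dom_fun z * frac_ker s z)" for z
      using abs_mult_frac_ker_le[OF sd, where s = s and z = z] by (simp add: mult.assoc)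
  qed
  then show ?thesis by simp
qed

context visc_burgers
begin

text \<open>A single mean is not smooth enough: its second derivative involves ux, for which no
  bound uniform in \<epsilon> is at hand. Averaging twice bounds the second derivative by 4 * B / (h
  * \<eta>), and with it the nonlocal and the viscous term, through B alone.\<close>

lemma double_mean_time_deriv_bound:
  assumes t: "0 < t" and h: "0 < h" and \<eta>: "0 < \<eta>" and B: "\<And>x. \<bar>u x t\<bar> \<le> B"
  shows "\<bar>seg_mean \<eta> (\<lambda>y. seg_mean h (\<lambda>y. ut y t) y) x\<bar> \<le> 2 * B * B / h
    + c * ((2 * (4 * B / (h * \<eta>)) + 4 * B) * (LINT z|lborel. dom_fun z * frac_ker s z)) + \<epsilon> * (4 * B / (h * \<eta>))"
proof -
  have h0: "h \<noteq> 0" and \<eta>0: "\<eta> \<noteq> 0" using h \<eta> by auto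
  have B0: "0 \<le> B" using B[of 0] by linarith
  note C2 = slice_C2[OF t]
  note C2h = seg_mean_C2[OF C2 h0]
  note C2\<eta> = seg_mean_C2[OF C2h \<eta>0]
  note cu = slice_cont(1)[OF t, of UNIV]
  define g where "g = (\<lambda>y. (u (y + h) t - u y t) / h)"
  define g' where "g' = (\<lambda>y. (ux (y + h) t - ux y t) / h)"
  have dg: "(g has_real_derivative g' y) (at y)" for y
    using C2h unfolding bdd_C2_def g_def g'_def by blast
  have cg': "continuous_on UNIV g'" using bdd_C2_continuous(3)[OF C2h] unfolding g'_def .
  have cus: "continuous_on A (\<lambda>y. u (y + h) t)" for A
    by (rule continuous_on_compose2[OF cu]) (auto intro!: continuous_intros)
  have gb: "\<bar>g y\<bar> \<le> 2 * B / h" for y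
    using B[of "y + h"] B[of y] h by (simp add: g_def divide_right_mono)
  define P where "P = (\<lambda>y. (u (y + h) t + u y t) / 2 * g y)"
  have cP: "continuous_on UNIV P"
    unfolding P_def g_def by (intro continuous_intros cus cu) (use h0 in auto)
  have Pb: "\<bar>P y\<bar> \<le> 2 * B * B / h" for y
  proof -
    have "\<bar>(u (y + h) t + u y t) / 2\<bar> * \<bar>g y\<bar> \<le> B * (2 * B / h)"
      using B[of "y + h"] B[of y] gb[of y] B0 by (intro mult_mono) auto
    then show ?thesis by (simp add: P_def abs_mult mult_ac)
  qed
  have cg: "continuous_on UNIV g" unfolding g_def by (intro continuous_intros cus cu) (use h0 in auto)
  let ?A = "seg_mean h (\<lambda>y. u y t)"
  have 1: "((\<lambda>r. P (x + \<eta> * r)) has_integral seg_mean \<eta> P x) {0..1}"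
    unfolding seg_mean_def by (intro integrable_integral integrable_continuous_real continuous_shift cP)
  have 2: "((\<lambda>r. frac_diff s ?A (x + \<eta> * r)) has_integral frac_diff s (seg_mean \<eta> ?A) x) {0..1}"
    using frac_diff_seg_mean[OF C2h s'(1,2), where x = x and h = \<eta>] by (simp add: seg_mean_def[of \<eta>] has_integral_iff)
  have 3: "((\<lambda>r. g' (x + \<eta> * r)) has_integral (g (x + \<eta>) - g x) / \<eta>) {0..1}"
    using seg_mean_deriv(2)[OF dg cg' \<eta>0, of x]
      integrable_integral[OF integrable_continuous_real[OF continuous_shift[OF cg', of "{0..1}" x \<eta>]]]
    by (simp add: seg_mean_def)
  have "((\<lambda>r. seg_mean h (\<lambda>y. ut y t) (x + \<eta> * r)) has_integral
      - seg_mean \<eta> P x + c * frac_diff s (seg_mean \<eta> ?A) x + \<epsilon> * ((g (x + \<eta>) - g x) / \<eta>)) {0..1}"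
    unfolding seg_mean_pde[OF t h0] g_def[symmetric] g'_def[symmetric]
    using has_integral_add[OF has_integral_add[OF has_integral_neg[OF 1] has_integral_mult_right[OF 2, of c]] has_integral_mult_right[OF 3, of \<epsilon>]]
    by (simp add: P_def g_def g'_def)
  then have eq: "seg_mean \<eta> (\<lambda>y. seg_mean h (\<lambda>y. ut y t) y) x = - seg_mean \<eta> P x + c * frac_diff s (seg_mean \<eta> ?A) x + \<epsilon> * ((g (x + \<eta>) - g x) / \<eta>)"
    by (simp add: seg_mean_def[of \<eta>] has_integral_iff)
  have i1: "\<bar>seg_mean \<eta> P x\<bar> \<le> 2 * B * B / h" by (rule seg_mean_bound[OF cP Pb])
  have gd: "\<bar>(g (y + \<eta>) - g y) / \<eta>\<bar> \<le> 4 * B / (h * \<eta>)" for y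
  proof -
    have "\<bar>g (y + \<eta>) - g y\<bar> \<le> 4 * B / h" using gb[of "y + \<eta>"] gb[of y] by simp
    from divide_right_mono[OF this, of \<eta>] show ?thesis using \<eta> by simp
  qed
  have i2: "\<bar>frac_diff s (seg_mean \<eta> ?A) x\<bar> \<le> (2 * (4 * B / (h * \<eta>)) + 4 * B) * (LINT z|lborel. dom_fun z * frac_ker s z)"
  proof (rule frac_diff_abs_le[OF C2\<eta> s'(1,2)])
    show "\<bar>seg_mean \<eta> ?A x\<bar> \<le> B" for x
      by (intro seg_mean_bound bdd_C2_continuous(1)[OF C2h] bdd_C2_continuous(1)[OF C2] B)
    show "\<bar>((u (x + \<eta> + h) t - u (x + \<eta>) t) / h - (u (x + h) t - u x t) / h) / \<eta>\<bar> \<le> 4 * B / (h * \<eta>)" for x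
      using gd[of x] by (simp add: g_def)
  qed
  have "\<bar>c * frac_diff s (seg_mean \<eta> ?A) x\<bar> \<le> c * ((2 * (4 * B / (h * \<eta>)) + 4 * B) * (LINT z|lborel. dom_fun z * frac_ker s z))"
    using mult_left_mono[OF i2, of c] c_pos by (simp add: abs_mult)
  moreover have "\<bar>\<epsilon> * ((g (x + \<eta>) - g x) / \<eta>)\<bar> \<le> \<epsilon> * (4 * B / (h * \<eta>))"
    using mult_left_mono[OF gd[of x], of \<epsilon>] eps by (simp only: abs_mult[of \<epsilon>]) simp
  ultimately show ?thesis unfolding eq using i1 by linarith
qed

text \<open>The second averaging is added and removed again at the cost 4 * B * \<eta> / h. Choosing
  \<eta> first and the time step afterwards gives equicontinuity.\<close>

lemma seg_mean_time_modulus: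
  assumes t0: "0 < t0" and h: "0 < h" and \<eta>: "0 < \<eta>" and B: "\<And>x t. t0 \<le> t \<Longrightarrow> \<bar>u x t\<bar> \<le> B"
    and t: "t0 \<le> t" "t0 \<le> t'"
  shows "\<bar>seg_mean h (\<lambda>y. u y t') x - seg_mean h (\<lambda>y. u y t) x\<bar> \<le> 4 * B * \<eta> / h + (2 * B * B / h
    + c * ((2 * (4 * B / (h * \<eta>)) + 4 * B) * (LINT z|lborel. dom_fun z * frac_ker s z)) + \<epsilon> * (4 * B / (h * \<eta>))) * \<bar>t' - t\<bar>"
    (is "_ \<le> _ + ?L * _")
proof -
  let ?Z = "\<lambda>\<tau>. seg_mean \<eta> (\<lambda>y. seg_mean h (\<lambda>y. u y \<tau>) y) x"
  have "norm (?Z t' - ?Z t) \<le> ?L * norm (t' - t)"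
  proof (rule field_differentiable_bound)
    fix \<tau> assume "\<tau> \<in> {t0..}"
    then have \<tau>: "0 < \<tau>" "t0 \<le> \<tau>" using t0 by auto
    have "(?Z has_real_derivative seg_mean \<eta> (\<lambda>y. seg_mean h (\<lambda>y. ut y \<tau>) y) x) (at \<tau>)"
    proof (rule seg_mean_DERIV_time[where T = "{0<..}" and v = "\<lambda>y \<tau>. seg_mean h (\<lambda>y. u y \<tau>) y" and vt = "\<lambda>y \<tau>. seg_mean h (\<lambda>y. ut y \<tau>) y"])
      show "continuous_on spacetime (\<lambda>p. seg_mean h (\<lambda>y. ut y (snd p)) (fst p))"
        by (rule continuous_seg_mean[OF cont_ut])
      show "continuous_on UNIV (\<lambda>y. seg_mean h (\<lambda>y. u y \<tau>) y)" if "\<tau> \<in> {0<..}" for \<tau>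
        using that h by (intro bdd_C2_continuous(1)[OF seg_mean_C2[OF slice_C2]]) auto
      show "((\<lambda>\<tau>. seg_mean h (\<lambda>y. u y \<tau>) y) has_real_derivative seg_mean h (\<lambda>y. ut y \<tau>) y) (at \<tau>)" if "\<tau> \<in> {0<..}" for y \<tau>
        using that by (intro seg_mean_time) auto
    qed (use \<tau> in auto)
    then show "(?Z has_real_derivative seg_mean \<eta> (\<lambda>y. seg_mean h (\<lambda>y. ut y \<tau>) y) x) (at \<tau> within {t0..})"
      by (rule has_field_derivative_at_within)
    show "norm (seg_mean \<eta> (\<lambda>y. seg_mean h (\<lambda>y. ut y \<tau>) y) x) \<le> ?L"
      unfolding real_norm_def by (rule double_mean_time_deriv_bound[OF \<tau>(1) h \<eta> B[OF \<tau>(2)]])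
  qed (use t in auto)
  moreover have "\<bar>?Z \<tau> - seg_mean h (\<lambda>y. u y \<tau>) x\<bar> \<le> 2 * B * \<eta> / h" if "t0 \<le> \<tau>" for \<tau>
    using that t0 by (intro seg_mean_near[OF slice_C2 B h \<eta>]) auto
  from this[OF t(1)] this[OF t(2)] have "\<bar>?Z t - seg_mean h (\<lambda>y. u y t) x\<bar> \<le> 2 * B * \<eta> / h" "\<bar>?Z t' - seg_mean h (\<lambda>y. u y t') x\<bar> \<le> 2 * B * \<eta> / h" .
  moreover have "4 * B * \<eta> / h = 2 * B * \<eta> / h + 2 * B * \<eta> / h" by simp
  ultimately show ?thesis unfolding real_norm_def by linarith
qed

end

section \<open>The vanishing viscosity limit\<close>

lemma lint_seg_mean:
  assumes h: "0 < h" and v: "continuous_on UNIV v"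
  shows "(LINT y|lborel. indicator {x..x + h} y * v y) = h * seg_mean h v x"
proof -
  have ind: "indicator {x..x + h} (x + h * r) = (indicator {0..1} r :: real)" for r
    using h by (auto simp: indicator_def zero_le_mult_iff)
  show ?thesis
    using lborel_integral_real_affine[of h "\<lambda>y. indicator {x..x + h} y * v y" x] h
      integrable_01_continuous(2)[OF continuous_shift[OF v, of "{0..1}" x h]]
    by (simp add: ind seg_mean_def)
qed

lemma seg_mean_linear: "0 < t \<Longrightarrow> seg_mean h (\<lambda>y. y / t) x = (x + h / 2) / t"
proof -
  assume "0 < t"
  have "((\<lambda>r. (x * r + h * r\<^sup>2 / 2) / t) has_real_derivative (x + h * r) / t) (at r within {0..1})" for r
    using \<open>0 < t\<close> by (auto intro!: derivative_eq_intros simp: field_simps)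
  then have "((\<lambda>r. (x + h * r) / t) has_integral ((x * 1 + h * 1\<^sup>2 / 2) / t - (x * 0 + h * 0\<^sup>2 / 2) / t)) {0..1}"
    by (intro fundamental_theorem_of_calculus) (simp_all flip: has_real_derivative_iff_has_vector_derivative)
  then show ?thesis by (simp add: seg_mean_def has_integral_iff)
qed

text \<open>The value of a nonincreasing function at x lies between its mean to the right and its
  mean to the left of x. Convergence of all means thus gives pointwise convergence wherever the
  limit profile is continuous. It is applied both to the viscosity limit and to limits in
  time.\<close>

lemma sandwich_tendsto:
  fixes f :: "nat \<Rightarrow> real \<Rightarrow> real" and q :: "nat \<Rightarrow> real \<Rightarrow> real \<Rightarrow> real"
  assumes lo: "\<And>j h x. 0 < h \<Longrightarrow> q j h x \<le> f j x" and hi: "\<And>j h x. 0 < h \<Longrightarrow> f j x \<le> q j h (x - h)"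
    and lim: "\<And>h x. 0 < h \<Longrightarrow> (\<lambda>j. q j h x) \<longlonglongrightarrow> Q h x"
    and F: "\<And>h x. 0 < h \<Longrightarrow> Q h x \<le> F x" and FQ: "(\<lambda>n. Q (1 / real (Suc n)) x) \<longlonglongrightarrow> F x" and cont: "isCont F x"
  shows "(\<lambda>j. f j x) \<longlonglongrightarrow> F x"
proof (rule order_tendstoI)
  fix a assume "a < F x"
  then have "\<forall>\<^sub>F n in sequentially. a < Q (1 / real (Suc n)) x" using FQ by (intro order_tendstoD)
  then obtain n where n: "a < Q (1 / real (Suc n)) x" using eventually_happens'[OF sequentially_bot] by blast
  have h: "0 < 1 / real (Suc n)" by simp
  from order_tendstoD(1)[OF lim[OF h] n] show "\<forall>\<^sub>F j in sequentially. a < f j x"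
    by eventually_elim (rule less_le_trans[OF _ lo[OF h]])
next
  fix a assume a: "F x < a"
  have "((\<lambda>h. F (x - h)) \<longlongrightarrow> F x) (at_right 0)"
    by (rule isCont_tendsto_compose[OF cont]) (auto intro!: tendsto_eq_intros)
  then have "\<forall>\<^sub>F h in at_right 0. F (x - h) < a" using a by (intro order_tendstoD(2)) auto
  then have "\<forall>\<^sub>F h in at_right 0. F (x - h) < a \<and> 0 < h"
    using eventually_at_right_less by (rule eventually_conj)
  then obtain h where h: "F (x - h) < a" "0 < h"
    using eventually_happens'[OF trivial_limit_at_right_real] by blast
  have "Q h (x - h) < a" using F[OF h(2), of "x - h"] h(1) by simp
  from order_tendstoD(2)[OF lim[OF h(2)] this] show "\<forall>\<^sub>F j in sequentially. f j x < a"
    by eventually_elim (rule le_less_trans[OF hi[OF h(2)]])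
qed

text \<open>What the compactness argument uses of the viscous family, with bounds independent of k.
  Weak-* convergence enters through \<open>rect\<close> only, that is, tested against indicators of
  rectangles.\<close>

locale visc_limit =
  fixes u :: "nat \<Rightarrow> real \<Rightarrow> real \<Rightarrow> real" and Bd :: "real \<Rightarrow> real"
  assumes bnd: "0 < t0 \<Longrightarrow> t0 \<le> t \<Longrightarrow> \<bar>u k x t\<bar> \<le> Bd t0"
    and cont: "continuous_on (UNIV \<times> {0<..}) (\<lambda>p. u k (fst p) (snd p))"
    and ole: "0 < t \<Longrightarrow> y \<le> x \<Longrightarrow> u k x t - u k y t \<le> (x - y) / t"
    and equi: "0 < t \<Longrightarrow> 0 < h \<Longrightarrow> 0 < e \<Longrightarrow>
      \<exists>d>0. d < t \<and> (\<forall>k x t'. \<bar>t' - t\<bar> < d \<longrightarrow> \<bar>seg_mean h (\<lambda>y. u k y t') x - seg_mean h (\<lambda>y. u k y t) x\<bar> \<le> e)"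
    and rect: "0 < t \<Longrightarrow> 0 < \<tau> \<Longrightarrow> 0 < h \<Longrightarrow>
      convergent (\<lambda>k. LINT p|lborel. indicator ({x..x + h} \<times> {t..t + \<tau>}) p * u k (fst p) (snd p))"
begin

lemma slice: "0 < t \<Longrightarrow> continuous_on UNIV (\<lambda>y. u k y t)"
  by (rule continuous_on_joint[OF cont]) (auto intro!: continuous_intros)

lemma u_measurable: "(\<lambda>p. indicator spacetime p *\<^sub>R u k (fst p) (snd p)) \<in> borel_measurable borel"
  by (intro borel_measurable_continuous_on_indicator cont borel_open open_spacetime)

lemma rect_integral:
  assumes t: "0 < t" "0 < \<tau>" and h: "0 < h"
  shows "(LINT p|lborel. indicator ({x..x + h} \<times> {t..t + \<tau>}) p * u k (fst p) (snd p))
      = (LINT t'|lborel. indicator {t..t + \<tau>} t' * (h * seg_mean h (\<lambda>y. u k y t') x))"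
    "integrable lborel (\<lambda>t'. indicator {t..t + \<tau>} t' * (h * seg_mean h (\<lambda>y. u k y t') x))"
proof -
  let ?R = "{x..x + h} \<times> {t..t + \<tau>}"
  let ?g = "\<lambda>y t'. indicator ?R (y, t') * u k y t'"
  have R: "?R \<in> sets lborel" by (intro sets_lborel[THEN equalityD2, THEN subsetD] borel_closed closed_Times) auto
  have Rfin: "emeasure lborel ?R < \<infinity>"
  proof -
    have "bounded ?R" by (intro bounded_Times) auto
    then show ?thesis by (rule emeasure_bounded_finite)
  qed
  have "integrable lborel (\<lambda>p. indicator ?R p *\<^sub>R (indicator spacetime p *\<^sub>R u k (fst p) (snd p)))"
  proof (rule integrableI_bounded_set_indicator[where B = "Bd t"])
    show "AE p in lborel. p \<in> ?R \<longrightarrow> norm (indicator spacetime p *\<^sub>R u k (fst p) (snd p)) \<le> Bd t"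
      using bnd[OF t(1)] t by (intro AE_I2) (auto simp: indicator_def)
  qed (use R Rfin u_measurable in auto)
  moreover have "(\<lambda>p. indicator ?R p *\<^sub>R (indicator spacetime p *\<^sub>R u k (fst p) (snd p))) = (\<lambda>p. indicator ?R p * u k (fst p) (snd p))"
    using t by (auto simp: indicator_def)
  ultimately have I: "integrable (lborel \<Otimes>\<^sub>M lborel) (\<lambda>(y, t'). ?g y t')"
    by (simp add: lborel_prod split_def)
  have inner: "(LINT y|lborel. ?g y t') = indicator {t..t + \<tau>} t' * (h * seg_mean h (\<lambda>y. u k y t') x)" for t'
  proof (cases "t' \<in> {t..t + \<tau>}")
    case True
    then have "0 < t'" using t by simp
    have "(LINT y|lborel. ?g y t') = (LINT y|lborel. indicator {x..x + h} y * u k y t')"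
      using True by (intro Bochner_Integration.integral_cong) (auto simp: indicator_def)
    also have "\<dots> = h * seg_mean h (\<lambda>y. u k y t') x" by (rule lint_seg_mean[OF h slice[OF \<open>0 < t'\<close>]])
    finally show ?thesis using True by simp
  next
    case False
    then have "?g y t' = 0" for y by (auto simp: indicator_def)
    then show ?thesis using False by simp
  qed
  have "(LINT p|lborel. indicator ?R p * u k (fst p) (snd p)) = integral\<^sup>L (lborel \<Otimes>\<^sub>M lborel) (\<lambda>(y, t'). ?g y t')"
    by (simp add: lborel_prod split_def)
  also have "\<dots> = (LINT t'|lborel. LINT y|lborel. ?g y t')" using lborel_pair.integral_snd[OF I] by simp
  finally show "(LINT p|lborel. indicator ?R p * u k (fst p) (snd p))
      = (LINT t'|lborel. indicator {t..t + \<tau>} t' * (h * seg_mean h (\<lambda>y. u k y t') x))" unfolding inner .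
  show "integrable lborel (\<lambda>t'. indicator {t..t + \<tau>} t' * (h * seg_mean h (\<lambda>y. u k y t') x))"
    using lborel_pair.integrable_snd[OF I] unfolding inner .
qed

text \<open>Rectangle averages converge. By equicontinuity a thin rectangle starting at time t
  approximates the mean at t, uniformly in k, so the means at the single time t are Cauchy.\<close>

lemma seg_mean_convergent:
  assumes t: "0 < t" and h: "0 < h"
  shows "convergent (\<lambda>k. seg_mean h (\<lambda>y. u k y t) x)"
proof -
  have "Cauchy (\<lambda>k. seg_mean h (\<lambda>y. u k y t) x)"
  proof (rule metric_CauchyI)
    fix e :: real assume e: "0 < e"
    then have e4: "0 < e / 4" by simp
    obtain d where d: "0 < d" "\<And>k x t'. \<bar>t' - t\<bar> < d \<Longrightarrow> \<bar>seg_mean h (\<lambda>y. u k y t') x - seg_mean h (\<lambda>y. u k y t) x\<bar> \<le> e / 4"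
      using equi[OF t h e4] by blast
    define \<tau> where "\<tau> = d / 2"
    have \<tau>: "0 < \<tau>" "\<tau> < d" using d(1) by (auto simp: \<tau>_def)
    define J where "J = (\<lambda>k. LINT p|lborel. indicator ({x..x + h} \<times> {t..t + \<tau>}) p * u k (fst p) (snd p))"
    define a where "a = (\<lambda>k. seg_mean h (\<lambda>y. u k y t) x)"
    have const: "(LINT t'|lborel. indicator {t..t + \<tau>} t' * C) = \<tau> * C" "integrable lborel (\<lambda>t'. indicator {t..t + \<tau>} t' * C)" for C :: real
      using \<tau> by auto
    have J: "\<bar>J k / (\<tau> * h) - a k\<bar> \<le> e / 4" for k
    proof -
      have near: "a k - e / 4 \<le> seg_mean h (\<lambda>y. u k y t') x \<and> seg_mean h (\<lambda>y. u k y t') x \<le> a k + e / 4" if "t' \<in> {t..t + \<tau>}" for t'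
      proof -
        have "\<bar>t' - t\<bar> < d" using that \<tau> by auto
        from d(2)[OF this, of k x] show ?thesis unfolding a_def by linarith
      qed
      have "J k \<le> (LINT t'|lborel. indicator {t..t + \<tau>} t' * (h * (a k + e / 4)))"
        unfolding J_def rect_integral(1)[OF t \<tau>(1) h]
        using near h by (intro integral_mono rect_integral(2)[OF t \<tau>(1) h] const) (auto simp: indicator_def)
      moreover have "(LINT t'|lborel. indicator {t..t + \<tau>} t' * (h * (a k - e / 4))) \<le> J k"
        unfolding J_def rect_integral(1)[OF t \<tau>(1) h]
        using near h by (intro integral_mono rect_integral(2)[OF t \<tau>(1) h] const) (auto simp: indicator_def)
      ultimately have "\<tau> * h * (a k - e / 4) \<le> J k" "J k \<le> \<tau> * h * (a k + e / 4)" unfolding const by (auto simp: mult.assoc)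
      then have "a k - e / 4 \<le> J k / (\<tau> * h)" "J k / (\<tau> * h) \<le> a k + e / 4"
        using \<tau> h by (auto simp: pos_le_divide_eq pos_divide_le_eq mult_ac)
      then show ?thesis unfolding abs_le_iff by linarith
    qed
    obtain L where "J \<longlonglongrightarrow> L"
      using rect[OF t \<tau>(1) h, of x] unfolding J_def[symmetric] convergent_def by blast
    then have "(\<lambda>k. J k / (\<tau> * h)) \<longlonglongrightarrow> L / (\<tau> * h)"
      by (intro tendsto_divide tendsto_const) (use \<tau> h in auto)
    then have "convergent (\<lambda>k. J k / (\<tau> * h))" by (rule convergentI)
    then have "Cauchy (\<lambda>k. J k / (\<tau> * h))" by (rule convergent_Cauchy)
    from metric_CauchyD[OF this e4] obtain N where N: "\<And>m n. N \<le> m \<Longrightarrow> N \<le> n \<Longrightarrow> \<bar>J m / (\<tau> * h) - J n / (\<tau> * h)\<bar> < e / 4"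
      unfolding dist_real_def by blast
    show "\<exists>N. \<forall>m\<ge>N. \<forall>n\<ge>N. dist (seg_mean h (\<lambda>y. u m y t) x) (seg_mean h (\<lambda>y. u n y t) x) < e"
    proof (intro exI allI impI)
      fix m n assume "N \<le> m" "N \<le> n"
      from N[OF this] J[of m] J[of n] e have "\<bar>a m - a n\<bar> < e" by linarith
      then show "dist (seg_mean h (\<lambda>y. u m y t) x) (seg_mean h (\<lambda>y. u n y t) x) < e" by (simp add: a_def dist_real_def)
    qed
  qed
  then show ?thesis by (rule Cauchy_convergent)
qed

definition mean_lim :: "real \<Rightarrow> real \<Rightarrow> real \<Rightarrow> real" where
  "mean_lim h x t = lim (\<lambda>k. seg_mean h (\<lambda>y. u k y t) x)"

lemma mean_lim_lim: "0 < t \<Longrightarrow> 0 < h \<Longrightarrow> (\<lambda>k. seg_mean h (\<lambda>y. u k y t) x) \<longlonglongrightarrow> mean_lim h x t"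
  unfolding mean_lim_def using seg_mean_convergent convergent_LIMSEQ_iff by blast

lemma mean_lim_bound: "0 < t0 \<Longrightarrow> t0 \<le> t \<Longrightarrow> 0 < h \<Longrightarrow> \<bar>mean_lim h x t\<bar> \<le> Bd t0"
  by (rule LIMSEQ_le_const2[OF tendsto_rabs[OF mean_lim_lim]]) (auto intro!: exI[of _ 0] seg_mean_bound slice bnd)

lemma mean_lim_time:
  assumes t: "0 < t" and h: "0 < h" and ts: "ts \<longlonglongrightarrow> t"
  shows "(\<lambda>j. mean_lim h x (ts j)) \<longlonglongrightarrow> mean_lim h x t"
proof (rule metric_LIMSEQ_I)
  fix e :: real assume "0 < e"
  then have e2: "0 < e / 2" by simp
  obtain d where d: "0 < d" "d < t" "\<And>k x t'. \<bar>t' - t\<bar> < d \<Longrightarrow> \<bar>seg_mean h (\<lambda>y. u k y t') x - seg_mean h (\<lambda>y. u k y t) x\<bar> \<le> e / 2"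
    using equi[OF t h e2] by blast
  from metric_LIMSEQ_D[OF ts d(1)] obtain N where N: "\<And>j. N \<le> j \<Longrightarrow> \<bar>ts j - t\<bar> < d"
    unfolding dist_real_def by blast
  show "\<exists>N. \<forall>j\<ge>N. dist (mean_lim h x (ts j)) (mean_lim h x t) < e"
  proof (intro exI allI impI)
    fix j assume "N \<le> j"
    then have j: "\<bar>ts j - t\<bar> < d" by (rule N)
    then have pos: "0 < ts j" using d(2) by linarith
    have "\<bar>mean_lim h x (ts j) - mean_lim h x t\<bar> \<le> e / 2"
      by (rule LIMSEQ_le_const2[OF tendsto_rabs[OF tendsto_diff[OF mean_lim_lim[OF pos h] mean_lim_lim[OF t h]]]])
         (use d(3)[OF j] in blast)
    then show "dist (mean_lim h x (ts j)) (mean_lim h x t) < e" using \<open>0 < e\<close> by (simp add: dist_real_def)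
  qed
qed

text \<open>By the one-sided Lipschitz bound, \<open>u - y / t\<close> is nonincreasing in space.\<close>

definition slope_mean :: "nat \<Rightarrow> real \<Rightarrow> real \<Rightarrow> real \<Rightarrow> real" where
  "slope_mean k h x t = seg_mean h (\<lambda>y. u k y t) x - (x + h / 2) / t"

definition slope_mean_lim :: "real \<Rightarrow> real \<Rightarrow> real \<Rightarrow> real" where
  "slope_mean_lim h x t = mean_lim h x t - (x + h / 2) / t"

lemma slope_mean_lim_lim: "0 < t \<Longrightarrow> 0 < h \<Longrightarrow> (\<lambda>k. slope_mean k h x t) \<longlonglongrightarrow> slope_mean_lim h x t"
  unfolding slope_mean_def slope_mean_lim_def by (intro tendsto_diff mean_lim_lim tendsto_const)

lemma slope_mean_eq:
  assumes t: "0 < t" shows "slope_mean k h x t = seg_mean h (\<lambda>y. u k y t - y / t) x"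
    "continuous_on UNIV (\<lambda>y. u k y t - y / t)"
proof -
  show "continuous_on UNIV (\<lambda>y. u k y t - y / t)"
    using t by (intro continuous_intros slice) auto
  have "continuous_on UNIV (\<lambda>y. y / t)" using t by (intro continuous_intros) auto
  from integrable_integral[OF integrable_continuous_real[OF continuous_shift[OF this, of "{0..1}" x h]]]
    integrable_integral[OF integrable_continuous_real[OF continuous_shift[OF slice[OF t, of k], of "{0..1}" x h]]]
  have "((\<lambda>r. u k (x + h * r) t - (x + h * r) / t) has_integral seg_mean h (\<lambda>y. u k y t) x - seg_mean h (\<lambda>y. y / t) x) {0..1}"
    unfolding seg_mean_def by (intro has_integral_diff)
  then show "slope_mean k h x t = seg_mean h (\<lambda>y. u k y t - y / t) x"
    unfolding seg_mean_linear[OF t] slope_mean_def by (simp add: seg_mean_def has_integral_iff)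
qed

lemma slope: "0 < t \<Longrightarrow> y \<le> x \<Longrightarrow> u k x t - x / t \<le> u k y t - y / t"
  using ole[of t y x k] by (simp add: diff_divide_distrib)

lemma slope_mean_le: "0 < t \<Longrightarrow> 0 < h \<Longrightarrow> slope_mean k h x t \<le> u k x t - x / t"
proof -
  assume t: "0 < t" and h: "0 < h"
  have "slope_mean k h x t \<le> seg_mean 0 (\<lambda>_. u k x t - x / t) 0"
    unfolding slope_mean_eq(1)[OF t] by (intro seg_mean_mono slope_mean_eq(2) slope t) (use h in auto)
  then show ?thesis by simp
qed

lemma slope_mean_ge: "0 < t \<Longrightarrow> 0 < h \<Longrightarrow> u k x t - x / t \<le> slope_mean k h (x - h) t"
proof -
  assume t: "0 < t" and h: "0 < h"
  have "seg_mean 0 (\<lambda>_. u k x t - x / t) 0 \<le> slope_mean k h (x - h) t"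
    unfolding slope_mean_eq(1)[OF t]
  proof (intro seg_mean_mono slope_mean_eq(2) slope t)
    fix r :: real assume "0 \<le> r" "r \<le> 1"
    then show "x - h + h * r \<le> x" using h by (simp add: mult_left_le)
  qed simp
  then show ?thesis by simp
qed

text \<open>For each k the point value at x separates the two means. The inequality between them
  survives the limit even where the point values do not converge.\<close>

lemma slope_mean_lim_step: "0 < t \<Longrightarrow> 0 < h \<Longrightarrow> 0 < h' \<Longrightarrow> slope_mean_lim h' x t \<le> slope_mean_lim h (x - h) t"
  by (rule LIMSEQ_le[OF slope_mean_lim_lim slope_mean_lim_lim]) (auto intro!: exI[of _ 0] order_trans[OF slope_mean_le slope_mean_ge])

lemma slope_mean_lim_antimono_h: "0 < t \<Longrightarrow> 0 < h \<Longrightarrow> h \<le> h' \<Longrightarrow> slope_mean_lim h' x t \<le> slope_mean_lim h x t"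
proof -
  assume t: "0 < t" and h: "0 < h" "h \<le> h'"
  have "slope_mean k h' x t \<le> slope_mean k h x t" for k
    unfolding slope_mean_eq(1)[OF t] by (intro seg_mean_mono slope_mean_eq(2) slope t) (use h in \<open>auto intro: mult_right_mono\<close>)
  then show ?thesis using h by (intro LIMSEQ_le[OF slope_mean_lim_lim slope_mean_lim_lim] t) auto
qed

lemma slope_mean_lim_antimono_x: "0 < t \<Longrightarrow> 0 < h \<Longrightarrow> x \<le> x' \<Longrightarrow> slope_mean_lim h x' t \<le> slope_mean_lim h x t"
proof -
  assume t: "0 < t" and h: "0 < h" "x \<le> x'"
  have "slope_mean k h x' t \<le> slope_mean k h x t" for k
    unfolding slope_mean_eq(1)[OF t] by (intro seg_mean_mono slope_mean_eq(2) slope t) (use h in auto)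
  then show ?thesis using h by (intro LIMSEQ_le[OF slope_mean_lim_lim slope_mean_lim_lim] t) auto
qed

text \<open>The limit means increase as h decreases, so this limit exists at every x. It selects a
  representative of the limit function that is defined everywhere and not just up to null
  sets.\<close>

definition slope_lim :: "real \<Rightarrow> real \<Rightarrow> real" where
  "slope_lim x t = lim (\<lambda>n. slope_mean_lim (1 / real (Suc n)) x t)"

definition pt_lim :: "real \<Rightarrow> real \<Rightarrow> real" where
  "pt_lim x t = lim (\<lambda>n. mean_lim (1 / real (Suc n)) x t)"

lemma slope_lim_lim: "0 < t \<Longrightarrow> (\<lambda>n. slope_mean_lim (1 / real (Suc n)) x t) \<longlonglongrightarrow> slope_lim x t"
proof -
  assume t: "0 < t"
  have inc: "incseq (\<lambda>n. slope_mean_lim (1 / real (Suc n)) x t)"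
    using t by (intro incseq_SucI slope_mean_lim_antimono_h) (auto simp: field_simps)
  have "slope_mean_lim (1 / real (Suc n)) x t \<le> slope_mean_lim 1 (x - 1) t" for n
    using t by (intro slope_mean_lim_step) auto
  from incseq_convergent[OF inc allI[OF this]] show ?thesis
    unfolding slope_lim_def by (metis limI)
qed

lemma inv_Suc: "(\<lambda>n. 1 / real (Suc n)) \<longlonglongrightarrow> 0"
  using LIMSEQ_inverse_real_of_nat by (simp add: inverse_eq_divide)

lemma pt_lim_lim: "0 < t \<Longrightarrow> (\<lambda>n. mean_lim (1 / real (Suc n)) x t) \<longlonglongrightarrow> slope_lim x t + x / t"
proof -
  assume t: "0 < t"
  have "(\<lambda>n. slope_mean_lim (1 / real (Suc n)) x t + (x + (1 / real (Suc n)) / 2) / t) \<longlonglongrightarrow> slope_lim x t + (x + 0 / 2) / t"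
    by (intro tendsto_intros slope_lim_lim inv_Suc t) (use t in auto)
  then show ?thesis by (simp add: slope_mean_lim_def)
qed

lemma pt_lim_eq: "0 < t \<Longrightarrow> pt_lim x t = slope_lim x t + x / t"
  unfolding pt_lim_def using pt_lim_lim by (rule limI)

lemma slope_lim_ge: "0 < t \<Longrightarrow> 0 < h \<Longrightarrow> slope_mean_lim h x t \<le> slope_lim x t"
proof (rule LIMSEQ_le_const[OF slope_lim_lim])
  assume t: "0 < t" and h: "0 < h"
  obtain N where N: "1 / real (Suc N) < h" using nat_approx_posE[OF h] by auto
  show "\<exists>N. \<forall>n\<ge>N. slope_mean_lim h x t \<le> slope_mean_lim (1 / real (Suc n)) x t"
  proof (intro exI allI impI slope_mean_lim_antimono_h t)
    fix n assume "N \<le> n"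
    then have "1 / real (Suc n) \<le> 1 / real (Suc N)" by (intro divide_left_mono) auto
    then show "1 / real (Suc n) \<le> h" using N by simp
  qed simp
qed

lemma slope_lim_le: "0 < t \<Longrightarrow> 0 < h \<Longrightarrow> slope_lim x t \<le> slope_mean_lim h (x - h) t"
  by (rule LIMSEQ_le_const2[OF slope_lim_lim]) (auto intro!: exI[of _ 0] slope_mean_lim_step)

lemma slope_lim_antimono: "0 < t \<Longrightarrow> x \<le> x' \<Longrightarrow> slope_lim x' t \<le> slope_lim x t"
  by (rule LIMSEQ_le[OF slope_lim_lim slope_lim_lim]) (auto intro!: exI[of _ 0] slope_mean_lim_antimono_x)

lemma AE_isCont_slope_lim: "0 < t \<Longrightarrow> AE x in lborel. isCont (\<lambda>x. slope_lim x t) x"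
proof -
  assume t: "0 < t"
  have "mono (\<lambda>x. - slope_lim x t)" using slope_lim_antimono[OF t] by (auto intro!: monoI)
  then have "countable {x. \<not> isCont (\<lambda>x. - slope_lim x t) x}" by (rule mono_ctble_discont)
  then have "{x. \<not> isCont (\<lambda>x. - slope_lim x t) x} \<in> null_sets lborel" by (rule countable_imp_null_set_lborel)
  then have "AE x in lborel. isCont (\<lambda>x. - slope_lim x t) x" by (rule AE_I'[of _ _ "\<lambda>x. isCont (\<lambda>x. - slope_lim x t) x"]) auto
  then show ?thesis
  proof eventually_elim
    case (elim x)
    from isCont_minus[OF this] show ?case by simp
  qed
qed

lemma AE_tendsto_pt_lim: "0 < t \<Longrightarrow> AE x in lborel. (\<lambda>k. u k x t) \<longlonglongrightarrow> pt_lim x t"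
proof -
  assume t: "0 < t"
  from AE_isCont_slope_lim[OF t] show ?thesis
  proof eventually_elim
    case (elim x)
    have "(\<lambda>k. u k x t - x / t) \<longlonglongrightarrow> slope_lim x t"
      by (rule sandwich_tendsto[where q = "\<lambda>k h x. slope_mean k h x t" and Q = "\<lambda>h x. slope_mean_lim h x t" and F = "\<lambda>x. slope_lim x t" and f = "\<lambda>k x. u k x t - x / t"],
          erule slope_mean_le[OF t], erule slope_mean_ge[OF t], erule slope_mean_lim_lim[OF t], erule slope_lim_ge[OF t], rule slope_lim_lim[OF t], rule elim)
    from tendsto_add[OF this tendsto_const[of "x / t"]] show ?case by (simp add: pt_lim_eq[OF t])
  qed
qed

text \<open>The same sandwich in the time variable. The exceptional points are the discontinuities
  of the profile at time t, whatever the sequence of times.\<close>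

lemma AE_pt_lim_time:
  assumes t: "0 < t" and ts: "ts \<longlonglongrightarrow> t" "\<And>j. 0 < ts j"
  shows "AE x in lborel. (\<lambda>j. pt_lim x (ts j)) \<longlonglongrightarrow> pt_lim x t"
  using AE_isCont_slope_lim[OF t]
proof eventually_elim
  case (elim x)
  have ql: "(\<lambda>j. slope_mean_lim h x (ts j)) \<longlonglongrightarrow> slope_mean_lim h x t" if "0 < h" for h x
    unfolding slope_mean_lim_def by (intro tendsto_intros mean_lim_time t that ts) (use t in auto)
  have "(\<lambda>j. slope_lim x (ts j)) \<longlonglongrightarrow> slope_lim x t"
    by (rule sandwich_tendsto[where q = "\<lambda>j h x. slope_mean_lim h x (ts j)" and Q = "\<lambda>h x. slope_mean_lim h x t" and F = "\<lambda>x. slope_lim x t" and f = "\<lambda>j x. slope_lim x (ts j)"],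
        erule slope_lim_ge[OF ts(2)], erule slope_lim_le[OF ts(2)], erule ql, erule slope_lim_ge[OF t], rule slope_lim_lim[OF t], rule elim)
  moreover have "(\<lambda>j. x / ts j) \<longlonglongrightarrow> x / t" by (intro tendsto_intros ts) (use t in auto)
  ultimately have "(\<lambda>j. slope_lim x (ts j) + x / ts j) \<longlonglongrightarrow> slope_lim x t + x / t" by (rule tendsto_add)
  then show ?case by (simp add: pt_lim_eq t ts)
qed

lemma pt_lim_bound: "0 < t0 \<Longrightarrow> t0 \<le> t \<Longrightarrow> \<bar>pt_lim x t\<bar> \<le> Bd t0"
proof -
  assume t0: "0 < t0" "t0 \<le> t"
  then have t: "0 < t" by simp
  have "\<bar>slope_lim x t + x / t\<bar> \<le> Bd t0"
    by (rule LIMSEQ_le_const2[OF tendsto_rabs[OF pt_lim_lim[OF t]]]) (use t0 in \<open>auto intro!: exI[of _ 0] mean_lim_bound\<close>)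
  then show ?thesis by (simp add: pt_lim_eq[OF t])
qed

text \<open>Means inherit the estimate, and \<open>pt_lim\<close> is a limit of means at every
  point, so the bound holds for all x and y without exceptional points.\<close>

lemma pt_lim_holder:
  assumes t: "0 < t" and hol: "\<And>k x y. \<bar>u k x t - u k y t\<bar> \<le> C * \<bar>x - y\<bar> powr a"
  shows "\<bar>pt_lim x t - pt_lim y t\<bar> \<le> C * \<bar>x - y\<bar> powr a"
proof -
  have "\<bar>mean_lim h x t - mean_lim h y t\<bar> \<le> C * \<bar>x - y\<bar> powr a" if h: "0 < h" for h
  proof (rule LIMSEQ_le_const2[OF tendsto_rabs[OF tendsto_diff[OF mean_lim_lim[OF t h] mean_lim_lim[OF t h]]]], intro exI allI impI)
    fix k
    show "\<bar>seg_mean h (\<lambda>y. u k y t) x - seg_mean h (\<lambda>y. u k y t) y\<bar> \<le> C * \<bar>x - y\<bar> powr a"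
    proof (rule seg_mean_diff_le[OF slice[OF t] slice[OF t]])
      fix r show "\<bar>u k (x + h * r) t - u k (y + h * r) t\<bar> \<le> C * \<bar>x - y\<bar> powr a"
        using hol[of k "x + h * r" "y + h * r"] by simp
    qed
  qed
  then have "\<bar>(slope_lim x t + x / t) - (slope_lim y t + y / t)\<bar> \<le> C * \<bar>x - y\<bar> powr a"
    by (intro LIMSEQ_le_const2[OF tendsto_rabs[OF tendsto_diff[OF pt_lim_lim[OF t] pt_lim_lim[OF t]]]]) auto
  then show ?thesis by (simp add: pt_lim_eq[OF t])
qed

text \<open>The function is an iterated sequential limit of continuous functions cut off to positive
  times.\<close>

lemma pt_lim_measurable: "(\<lambda>p. if 0 < snd p then pt_lim (fst p) (snd p) else 0) \<in> borel_measurable borel"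
proof -
  let ?g = "\<lambda>n k p. indicator spacetime p *\<^sub>R seg_mean (1 / real (Suc n)) (\<lambda>y. u k y (snd p)) (fst p)"
  have [measurable]: "?g n k \<in> borel_measurable borel" for n k
    by (intro borel_measurable_continuous_on_indicator continuous_seg_mean cont borel_open open_spacetime)
  have "(\<lambda>p. lim (\<lambda>n. lim (\<lambda>k. ?g n k p))) \<in> borel_measurable borel" by measurable
  moreover have "lim (\<lambda>n. lim (\<lambda>k. ?g n k p)) = (if 0 < snd p then pt_lim (fst p) (snd p) else 0)" for p
  proof (cases "0 < snd p")
    case True
    then have "p \<in> spacetime" by (cases p) auto
    then show ?thesis using True by (simp add: pt_lim_def mean_lim_def)
  next
    case False
    then have "p \<notin> spacetime" by (cases p) auto
    then have z: "?g n k p = 0" for n k by simp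
    show ?thesis unfolding z using False by (simp add: lim_const)
  qed
  ultimately show ?thesis by simp
qed

end

section \<open>Weak continuity in time and identification of the limit\<close>

lemma integrable_mult_L2:
  fixes f g :: "real \<Rightarrow> real"
  assumes [measurable]: "f \<in> borel_measurable borel" "g \<in> borel_measurable borel"
    and "integrable lborel (\<lambda>x. (f x)\<^sup>2)" "integrable lborel (\<lambda>x. (g x)\<^sup>2)"
  shows "integrable lborel (\<lambda>x. f x * g x)"
proof (rule Bochner_Integration.integrable_bound)
  show "integrable lborel (\<lambda>x. (f x)\<^sup>2 + (g x)\<^sup>2)" using assms by simp
  have "\<bar>a * b\<bar> \<le> a\<^sup>2 + b\<^sup>2" for a b :: real
  proof -
    have "0 \<le> (\<bar>a\<bar> - \<bar>b\<bar>)\<^sup>2" by simp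
    then have "2 * (\<bar>a\<bar> * \<bar>b\<bar>) \<le> a\<^sup>2 + b\<^sup>2" by (simp add: power2_diff)
    moreover have "0 \<le> \<bar>a\<bar> * \<bar>b\<bar>" by simp
    ultimately show ?thesis unfolding abs_mult by linarith
  qed
  then show "AE x in lborel. norm (f x * g x) \<le> norm ((f x)\<^sup>2 + (g x)\<^sup>2)" by (intro AE_I2) simp
qed measurable

text \<open>A sequence that is bounded in L2 and converges almost everywhere converges weakly. The
  product h * g is split into a part dominated by a multiple of g^2 and a part at most l * h^2,
  whose integral is small by the choice of l.\<close>

lemma weak_conv_of_AE:
  fixes f :: "nat \<Rightarrow> real \<Rightarrow> real" and f' g :: "real \<Rightarrow> real"
  assumes [measurable]: "\<And>j. f j \<in> borel_measurable borel" "f' \<in> borel_measurable borel" "g \<in> borel_measurable borel"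
    and fi: "\<And>j. integrable lborel (\<lambda>x. (f j x)\<^sup>2)" "integrable lborel (\<lambda>x. (f' x)\<^sup>2)"
    and gi: "integrable lborel (\<lambda>x. (g x)\<^sup>2)"
    and C: "\<And>j. (LINT x|lborel. (f j x)\<^sup>2) \<le> C" "(LINT x|lborel. (f' x)\<^sup>2) \<le> C"
    and lim: "AE x in lborel. (\<lambda>j. f j x) \<longlonglongrightarrow> f' x"
  shows "(\<lambda>j. LINT x|lborel. f j x * g x) \<longlonglongrightarrow> (LINT x|lborel. f' x * g x)"
proof (rule LIMSEQ_I)
  fix e :: real assume e: "0 < e"
  have "0 \<le> (LINT x|lborel. (f' x)\<^sup>2)" by (intro integral_nonneg_AE AE_I2) simp
  then have C0: "0 \<le> C" using C(2) by linarith
  define l where "l = e / (8 * C + 8)"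
  have l: "0 < l" using e C0 by (simp add: l_def)
  have lC: "l * (4 * C) \<le> e / 2"
    using e C0 by (simp add: l_def field_simps)
  define h where "h = (\<lambda>j x. f j x - f' x)"
  have [measurable]: "h j \<in> borel_measurable borel" for j unfolding h_def by measurable
  have hle: "(h j x)\<^sup>2 \<le> 2 * (f j x)\<^sup>2 + 2 * (f' x)\<^sup>2" for j x
  proof -
    have "0 \<le> (f j x + f' x)\<^sup>2" by simp
    then show ?thesis unfolding h_def by (simp add: power2_diff power2_sum)
  qed
  have hi: "integrable lborel (\<lambda>x. (h j x)\<^sup>2)" for j
  proof (rule Bochner_Integration.integrable_bound)
    show "integrable lborel (\<lambda>x. 2 * (f j x)\<^sup>2 + 2 * (f' x)\<^sup>2)" using fi by simp
    show "AE x in lborel. norm ((h j x)\<^sup>2) \<le> norm (2 * (f j x)\<^sup>2 + 2 * (f' x)\<^sup>2)"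
      using hle by (intro AE_I2) simp
  qed measurable
  have hC: "(LINT x|lborel. (h j x)\<^sup>2) \<le> 4 * C" for j
  proof -
    have "(LINT x|lborel. (h j x)\<^sup>2) \<le> (LINT x|lborel. 2 * (f j x)\<^sup>2 + 2 * (f' x)\<^sup>2)"
      using hle fi by (intro integral_mono hi) auto
    also have "\<dots> = 2 * (LINT x|lborel. (f j x)\<^sup>2) + 2 * (LINT x|lborel. (f' x)\<^sup>2)"
      using fi by simp
    finally show ?thesis using C(1)[of j] C(2) by linarith
  qed
  \<comment> \<open>The excess of \<bar>h * g\<bar> over l * h^2. Completing the square bounds it by
    g^2 / (4 * l), so dominated convergence applies to it, although it need not apply to h *
    g.\<close>
  define m where "m = (\<lambda>j x. max 0 (\<bar>h j x * g x\<bar> - l * (h j x)\<^sup>2))"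
  have mle: "m j x \<le> (g x)\<^sup>2 / (4 * l)" for j x
  proof -
    have "0 \<le> (2 * l * \<bar>h j x\<bar> - \<bar>g x\<bar>)\<^sup>2" by simp
    then have "4 * l * (\<bar>h j x\<bar> * \<bar>g x\<bar>) \<le> 4 * l * (l * (h j x)\<^sup>2) + (g x)\<^sup>2"
      by (simp add: power2_diff power_mult_distrib power2_eq_square algebra_simps)
    then have "\<bar>h j x\<bar> * \<bar>g x\<bar> - l * (h j x)\<^sup>2 \<le> (g x)\<^sup>2 / (4 * l)"
      using l by (simp add: field_simps)
    then show ?thesis using l by (simp add: m_def abs_mult)
  qed
  have m0: "0 \<le> m j x" for j x by (simp add: m_def)
  have mm[measurable]: "m j \<in> borel_measurable borel" for j unfolding m_def by measurable
  have g4: "integrable lborel (\<lambda>x. (g x)\<^sup>2 / (4 * l))" using gi by simp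
  have mi: "integrable lborel (m j)" for j
  proof (rule Bochner_Integration.integrable_bound[OF g4])
    have "norm (m j x) \<le> norm ((g x)\<^sup>2 / (4 * l))" for x using mle[of j x] m0[of j x] l by simp
    then show "AE x in lborel. norm (m j x) \<le> norm ((g x)\<^sup>2 / (4 * l))" by (rule AE_I2)
  qed measurable
  have "(\<lambda>j. LINT x|lborel. m j x) \<longlonglongrightarrow> integral\<^sup>L lborel (\<lambda>x::real. 0::real)"
  proof (rule integral_dominated_convergence[where s = m and f = "\<lambda>_. 0" and w = "\<lambda>x. (g x)\<^sup>2 / (4 * l)"])
    show "integrable lborel (\<lambda>x. (g x)\<^sup>2 / (4 * l))" by (rule g4)
    show "AE x in lborel. (\<lambda>j. m j x) \<longlonglongrightarrow> 0"
      using lim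
    proof eventually_elim
      case (elim x)
      have "(\<lambda>j. h j x) \<longlonglongrightarrow> f' x - f' x" unfolding h_def by (intro tendsto_intros elim)
      then have "(\<lambda>j. max 0 (\<bar>h j x * g x\<bar> - l * (h j x)\<^sup>2)) \<longlonglongrightarrow> max 0 (\<bar>(f' x - f' x) * g x\<bar> - l * (f' x - f' x)\<^sup>2)"
        by (intro tendsto_intros)
      then show ?case by (simp add: m_def)
    qed
    show "AE x in lborel. norm (m j x) \<le> (g x)\<^sup>2 / (4 * l)" for j using mle m0 by (intro AE_I2) auto
  qed measurable
  then have "\<forall>\<^sub>F j in sequentially. (LINT x|lborel. m j x) < e / 2"
    using e by (intro order_tendstoD(2)[of _ 0]) auto
  then obtain N where N: "\<And>j. N \<le> j \<Longrightarrow> (LINT x|lborel. m j x) < e / 2"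
    by (auto simp: eventually_sequentially)
  show "\<exists>N. \<forall>j\<ge>N. norm ((LINT x|lborel. f j x * g x) - (LINT x|lborel. f' x * g x)) < e"
  proof (intro exI allI impI)
    fix j assume j: "N \<le> j"
    have i: "integrable lborel (\<lambda>x. h j x * g x)" by (rule integrable_mult_L2) (use hi gi in measurable)
    have "(LINT x|lborel. f j x * g x) - (LINT x|lborel. f' x * g x) = (LINT x|lborel. h j x * g x)"
      unfolding h_def left_diff_distrib
      by (rule Bochner_Integration.integral_diff[symmetric]; rule integrable_mult_L2) (use fi gi in measurable)
    also have "\<bar>\<dots>\<bar> \<le> (LINT x|lborel. m j x + l * (h j x)\<^sup>2)"
      by (rule integral_abs_bound_integral[OF i]) (use mi hi in \<open>auto simp: m_def\<close>)
    also have "\<dots> = (LINT x|lborel. m j x) + l * (LINT x|lborel. (h j x)\<^sup>2)"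
      using mi hi by (subst Bochner_Integration.integral_add) auto
    also have "l * (LINT x|lborel. (h j x)\<^sup>2) \<le> l * (4 * C)" using hC l by (intro mult_left_mono) auto
    finally show "norm ((LINT x|lborel. f j x * g x) - (LINT x|lborel. f' x * g x)) < e"
      using N[OF j] lC unfolding real_norm_def by linarith
  qed
qed

lemma AE_exists_in_interval:
  assumes "AE t in lborel. P t" "a < (b::real)"
  shows "\<exists>t. a < t \<and> t < b \<and> P t"
proof (rule ccontr)
  assume n: "\<not> ?thesis"
  from assms(1) have "AE t in lborel. t \<notin> {a<..<b}" by eventually_elim (use n in auto)
  then have "{a<..<b} \<in> null_sets lborel" by (subst AE_iff_null_sets) auto
  then show False using assms(2) by (auto simp: null_sets_def)
qed

text \<open>Writes convergence with countable quantifiers only, so that the set of points of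
  convergence is visibly Borel.\<close>

lemma LIMSEQ_iff_countable:
  fixes X :: "nat \<Rightarrow> real"
  shows "X \<longlonglongrightarrow> L \<longleftrightarrow> (\<forall>n. \<exists>N. \<forall>k. N \<le> k \<longrightarrow> \<bar>X k - L\<bar> < 1 / real (Suc n))"
proof
  assume X: "X \<longlonglongrightarrow> L"
  show "\<forall>n. \<exists>N. \<forall>k. N \<le> k \<longrightarrow> \<bar>X k - L\<bar> < 1 / real (Suc n)"
  proof
    fix n
    have "0 < 1 / real (Suc n)" by simp
    from LIMSEQ_D[OF X this] show "\<exists>N. \<forall>k. N \<le> k \<longrightarrow> \<bar>X k - L\<bar> < 1 / real (Suc n)" by auto
  qed
next
  assume R: "\<forall>n. \<exists>N. \<forall>k. N \<le> k \<longrightarrow> \<bar>X k - L\<bar> < 1 / real (Suc n)"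
  show "X \<longlonglongrightarrow> L"
  proof (rule LIMSEQ_I)
    fix e :: real assume "0 < e"
    then obtain n where n: "1 / real (Suc n) < e" using nat_approx_posE by blast
    from R obtain N where "\<forall>k. N \<le> k \<longrightarrow> \<bar>X k - L\<bar> < 1 / real (Suc n)" by blast
    then show "\<exists>N. \<forall>k\<ge>N. norm (X k - L) < e" using n by (intro exI[of _ N]) force
  qed
qed

lemma AE_swap_pair:
  fixes P :: "real \<times> real \<Rightarrow> bool"
  assumes "{p. P p} \<in> sets borel"
  shows "(AE p in lborel. P p) \<longleftrightarrow> (AE t in lborel. AE x in lborel. P (x, t))"
proof -
  have m: "{p \<in> space (lborel \<Otimes>\<^sub>M lborel). P (fst p, snd p)} \<in> sets (lborel \<Otimes>\<^sub>M lborel)"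
    unfolding lborel_prod using assms by simp
  have "(AE p in lborel. P p) \<longleftrightarrow> (AE p in lborel \<Otimes>\<^sub>M lborel. P (fst p, snd p))"
    unfolding lborel_prod by simp
  also have "\<dots> \<longleftrightarrow> (AE x in lborel. AE t in lborel. P (x, t))"
    using lborel_pair.AE_pair_iff[OF m] by simp
  also have "\<dots> \<longleftrightarrow> (AE t in lborel. AE x in lborel. P (x, t))"
    by (rule lborel_pair.AE_commute[OF m])
  finally show ?thesis .
qed

context visc_limit
begin

definition \<Theta> :: "real \<times> real \<Rightarrow> real" where
  "\<Theta> p = (if 0 < snd p then pt_lim (fst p) (snd p) else 0)"

lemma \<Theta>_measurable [measurable]: "\<Theta> \<in> borel_measurable borel"
  using pt_lim_measurable by (simp add: \<Theta>_def[abs_def])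

lemma \<Theta>_slice_measurable [measurable]: "(\<lambda>x. \<Theta> (x, t)) \<in> borel_measurable borel"
proof -
  have "(\<lambda>x. (x, t)) \<in> borel_measurable borel"
    by (intro borel_measurable_continuous_onI continuous_intros)
  from measurable_compose[OF this \<Theta>_measurable] show ?thesis .
qed

lemma AE_tendsto_\<Theta>: "AE p in lborel. 0 < snd p \<longrightarrow> (\<lambda>k. u k (fst p) (snd p)) \<longlonglongrightarrow> \<Theta> p"
proof -
  let ?v = "\<lambda>k p. indicator spacetime p *\<^sub>R u k (fst p) (snd p)"
  note [measurable] = u_measurable
  have "{p. (\<lambda>k. ?v k p) \<longlonglongrightarrow> \<Theta> p} \<in> sets borel"
    unfolding LIMSEQ_iff_countable by measurable
  moreover have "AE t in lborel. AE x in lborel. (\<lambda>k. ?v k (x, t)) \<longlonglongrightarrow> \<Theta> (x, t)"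
  proof (rule AE_I2)
    fix t :: real
    show "AE x in lborel. (\<lambda>k. ?v k (x, t)) \<longlonglongrightarrow> \<Theta> (x, t)"
    proof (cases "0 < t")
      case True
      from AE_tendsto_pt_lim[OF True] show ?thesis
        by eventually_elim (use True in \<open>simp add: \<Theta>_def\<close>)
    qed (simp add: \<Theta>_def)
  qed
  ultimately have "AE p in lborel. (\<lambda>k. ?v k p) \<longlonglongrightarrow> \<Theta> p"
    by (subst AE_swap_pair) auto
  then show ?thesis
  proof eventually_elim
    case (elim p)
    show ?case
    proof
      assume "0 < snd p"
      then have "p \<in> spacetime" by (cases p) auto
      then show "(\<lambda>k. u k (fst p) (snd p)) \<longlonglongrightarrow> \<Theta> p" using elim by simp
    qed
  qed
qed

text \<open>Testing with the sign of \<Theta> - \<theta> on a rectangle: weak-* convergence gives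
  the limit with \<theta>, dominated convergence the limit with \<Theta>. Their equality says that
  \<bar>\<Theta> - \<theta>\<bar> has integral 0 there.\<close>

lemma \<Theta>_eq_AE:
  fixes \<theta> :: "real \<times> real \<Rightarrow> real"
  assumes ws: "\<And>t. 0 < t \<Longrightarrow> weak_star_conv_Linf_after t (\<lambda>k p. u k (fst p) (snd p)) \<theta>"
    and \<theta>m: "set_borel_measurable lborel spacetime \<theta>"
  shows "AE p in lborel. \<Theta> p = indicator spacetime p * \<theta> p"
proof -
  define \<theta>s where "\<theta>s = (\<lambda>p. indicator spacetime p * \<theta> p)"
  have [measurable]: "\<theta>s \<in> borel_measurable borel"
    using \<theta>m by (simp add: set_borel_measurable_def \<theta>s_def)
  \<comment> \<open>These rectangles exhaust the half plane. Each is bounded and stays away from t =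
    0, so that the test function is integrable and the family is uniformly bounded on it.\<close>
  have "AE p in lborel. p \<in> {- real m..real m} \<times> {1 / real (Suc m)<..real m} \<longrightarrow> \<Theta> p = \<theta>s p" for m :: nat
  proof -
    define t0 where "t0 = 1 / real (Suc m)"
    have t0: "0 < t0" by (simp add: t0_def)
    define R where "R = {- real m..real m} \<times> {t0<..real m}"
    define S where "S = (UNIV :: real set) \<times> {t0<..}"
    have Sm[measurable]: "S \<in> sets borel"
      unfolding S_def by (intro borel_open open_Times) auto
    have Rm[measurable]: "R \<in> sets borel"
    proof -
      have "R = ({- real m..real m} \<times> {..real m}) \<inter> S" by (auto simp: R_def S_def)
      moreover have "closed ({- real m..real m} \<times> {..real m})" by (intro closed_Times) auto
      ultimately show ?thesis using Sm by (simp add: sets.Int borel_closed)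
    qed
    have RS: "R \<subseteq> S" by (auto simp: R_def S_def)
    have Sspace: "S \<subseteq> spacetime" using t0 by (auto simp: S_def)
    have Rfin: "emeasure lborel R < \<infinity>"
    proof -
      have "bounded ({- real m..real m} \<times> {t0..real m})" by (intro bounded_Times) auto
      then have "bounded R" by (rule bounded_subset) (auto simp: R_def)
      then show ?thesis by (rule emeasure_bounded_finite)
    qed
    define \<psi> where "\<psi> = (\<lambda>p. indicator R p * sgn (\<Theta> p - \<theta>s p))"
    have [measurable]: "\<psi> \<in> borel_measurable borel" unfolding \<psi>_def by measurable
    have \<psi>1: "\<bar>\<psi> p\<bar> \<le> indicator R p" for p by (auto simp: \<psi>_def indicator_def abs_sgn_eq)
    have IR: "integrable lborel (\<lambda>p. indicator R p :: real)"
      using Rfin by (intro integrable_real_indicator) auto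
    have \<psi>i: "integrable lborel \<psi>"
      by (rule Bochner_Integration.integrable_bound[OF IR]) (use \<psi>1 in auto)
    have "set_integrable lborel S \<psi>"
      unfolding set_integrable_def by (rule integrable_mult_indicator[OF _ \<psi>i]) simp
    moreover note ws[OF t0]
    ultimately have lim1: "(\<lambda>k. LINT p:S|lborel. u k (fst p) (snd p) * \<psi> p) \<longlonglongrightarrow> (LINT p:S|lborel. \<theta> p * \<psi> p)"
      and Linf: "in_Linf_after t0 \<theta>"
      unfolding weak_star_conv_Linf_after_def S_def by blast+
    have ind: "indicator S p *\<^sub>R (v * \<psi> p) = v * \<psi> p" for p v
      using RS by (auto simp: \<psi>_def indicator_def)
    have ind\<theta>: "\<theta> p * \<psi> p = \<theta>s p * \<psi> p" for p
      using RS Sspace by (auto simp: \<psi>_def \<theta>s_def indicator_def)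
    let ?v = "\<lambda>k p. indicator spacetime p *\<^sub>R u k (fst p) (snd p)"
    have indv: "u k (fst p) (snd p) * \<psi> p = ?v k p * \<psi> p" for k p
      using RS Sspace by (auto simp: \<psi>_def indicator_def)
    note [measurable] = u_measurable
    have bR: "integrable lborel (\<lambda>p. Bd t0 * indicator R p)" using IR by simp
    have b0: "0 \<le> Bd t0" using bnd[OF t0, of t0 0 0] by linarith
    have "(\<lambda>k. LINT p|lborel. ?v k p * \<psi> p) \<longlonglongrightarrow> (LINT p|lborel. \<Theta> p * \<psi> p)"
    proof (rule integral_dominated_convergence[OF _ _ bR])
      show "AE p in lborel. (\<lambda>k. ?v k p * \<psi> p) \<longlonglongrightarrow> \<Theta> p * \<psi> p"
        using AE_tendsto_\<Theta>
      proof eventually_elim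
        case (elim p)
        show ?case
        proof (cases "0 < snd p")
          case True
          then have "p \<in> spacetime" by (cases p) auto
          then show ?thesis using elim True by (auto intro!: tendsto_mult_right)
        next
          case False
          then have "p \<notin> R" using t0 by (cases p) (auto simp: R_def)
          then show ?thesis by (simp add: \<psi>_def)
        qed
      qed
      show "AE p in lborel. norm (?v k p * \<psi> p) \<le> Bd t0 * indicator R p" for k
      proof (rule AE_I2)
        fix p
        show "norm (?v k p * \<psi> p) \<le> Bd t0 * indicator R p"
        proof (cases "p \<in> R")
          case True
          then have "\<bar>u k (fst p) (snd p)\<bar> \<le> Bd t0" using t0 by (intro bnd) (auto simp: R_def)
          then have "\<bar>?v k p\<bar> \<le> Bd t0" using b0 by (auto simp: indicator_def)
          then have "\<bar>?v k p\<bar> * \<bar>\<psi> p\<bar> \<le> Bd t0 * indicator R p" using \<psi>1[of p] b0 by (intro mult_mono) auto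
          then show ?thesis by (simp add: abs_mult)
        qed (simp add: \<psi>_def)
      qed
    qed measurable
    then have "(\<lambda>k. LINT p:S|lborel. u k (fst p) (snd p) * \<psi> p) \<longlonglongrightarrow> (LINT p|lborel. \<Theta> p * \<psi> p)"
      unfolding set_lebesgue_integral_def ind indv .
    from LIMSEQ_unique[OF lim1 this] have eq: "(LINT p|lborel. \<theta>s p * \<psi> p) = (LINT p|lborel. \<Theta> p * \<psi> p)"
      unfolding set_lebesgue_integral_def ind ind\<theta> .
    obtain C where C: "AE p in lborel. t0 < snd p \<longrightarrow> \<bar>\<theta> p\<bar> \<le> C" using Linf by (auto simp: in_Linf_after_def)
    have CR: "integrable lborel (\<lambda>p. \<bar>C\<bar> * indicator R p)" using IR by simp
    have i1: "integrable lborel (\<lambda>p. \<theta>s p * \<psi> p)"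
    proof (rule Bochner_Integration.integrable_bound[OF CR])
      show "AE p in lborel. norm (\<theta>s p * \<psi> p) \<le> norm (\<bar>C\<bar> * indicator R p)"
        using C
      proof eventually_elim
        case (elim p)
        show ?case
        proof (cases "p \<in> R")
          case True
          then have "t0 < snd p" by (auto simp: R_def)
          then have "\<bar>\<theta>s p\<bar> \<le> \<bar>C\<bar>" using elim by (auto simp: \<theta>s_def indicator_def)
          then have "\<bar>\<theta>s p\<bar> * \<bar>\<psi> p\<bar> \<le> \<bar>C\<bar> * indicator R p" using \<psi>1[of p] by (intro mult_mono) auto
          then show ?thesis by (simp add: abs_mult)
        qed (simp add: \<psi>_def)
      qed
    qed measurable
    have i2: "integrable lborel (\<lambda>p. \<Theta> p * \<psi> p)"
    proof (rule Bochner_Integration.integrable_bound[OF bR])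
      show "AE p in lborel. norm (\<Theta> p * \<psi> p) \<le> norm (Bd t0 * indicator R p)"
      proof (rule AE_I2)
        fix p
        show "norm (\<Theta> p * \<psi> p) \<le> norm (Bd t0 * indicator R p)"
        proof (cases "p \<in> R")
          case True
          then have "\<bar>\<Theta> p\<bar> \<le> Bd t0" using t0 pt_lim_bound[OF t0, of "snd p" "fst p"] by (auto simp: R_def \<Theta>_def)
          then have "\<bar>\<Theta> p\<bar> * \<bar>\<psi> p\<bar> \<le> Bd t0 * indicator R p" using \<psi>1[of p] b0 by (intro mult_mono) auto
          then show ?thesis using b0 by (simp add: abs_mult)
        qed (simp add: \<psi>_def)
      qed
    qed measurable
    have dif: "\<Theta> p * \<psi> p - \<theta>s p * \<psi> p = indicator R p * \<bar>\<Theta> p - \<theta>s p\<bar>" for p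
    proof -
      have "\<Theta> p * \<psi> p - \<theta>s p * \<psi> p = indicator R p * ((\<Theta> p - \<theta>s p) * sgn (\<Theta> p - \<theta>s p))"
        by (simp add: \<psi>_def algebra_simps)
      then show ?thesis by (simp add: abs_sgn)
    qed
    have "(LINT p|lborel. indicator R p * \<bar>\<Theta> p - \<theta>s p\<bar>) = 0"
      using Bochner_Integration.integral_diff[OF i2 i1] eq unfolding dif by simp
    moreover have "integrable lborel (\<lambda>p. indicator R p * \<bar>\<Theta> p - \<theta>s p\<bar>)"
      using Bochner_Integration.integrable_diff[OF i2 i1] unfolding dif .
    ultimately have "AE p in lborel. indicator R p * \<bar>\<Theta> p - \<theta>s p\<bar> = 0"
      by (subst (asm) integral_nonneg_eq_0_iff_AE) auto
    then show ?thesis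
      unfolding t0_def[symmetric] R_def[symmetric] by eventually_elim (auto simp: indicator_def split: if_splits)
  qed
  then have "AE p in lborel. \<forall>m::nat. p \<in> {- real m..real m} \<times> {1 / real (Suc m)<..real m} \<longrightarrow> \<Theta> p = \<theta>s p"
    by (simp only: AE_all_countable) blast
  then have "AE p in lborel. \<Theta> p = \<theta>s p"
  proof eventually_elim
    case (elim p)
    obtain x t where p: "p = (x, t)" by (cases p)
    show ?case
    proof (cases "0 < t")
      case True
      obtain n where n: "1 / real (Suc n) < t" using nat_approx_posE[OF True] by blast
      obtain n' where n': "max \<bar>x\<bar> t \<le> real n'" using real_arch_simple by blast
      let ?m = "max n n'"
      have "1 / real (Suc ?m) \<le> 1 / real (Suc n)" by (intro divide_left_mono) auto
      moreover have "real n' \<le> real ?m" by simp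
      ultimately have "p \<in> {- real ?m..real ?m} \<times> {1 / real (Suc ?m)<..real ?m}"
        using n n' unfolding p by (auto simp del: of_nat_Suc)
      then show ?thesis using elim by blast
    next
      case False
      then show ?thesis by (simp add: p \<Theta>_def \<theta>s_def)
    qed
  qed
  then show ?thesis by (simp add: \<theta>s_def)
qed

text \<open>The hypothesis bounds almost every time slice. Any other time is approached from the
  right by good times, along which the slices converge almost everywhere, and Fatou's lemma carries
  the bound over.\<close>

lemma \<Theta>_L2_bound:
  assumes eq: "AE p in lborel. \<Theta> p = indicator spacetime p * \<theta> p" and \<theta>: "in_Linf_L2 \<theta>"
  obtains C where "0 \<le> C" "\<And>t. 0 < t \<Longrightarrow> (\<integral>\<^sup>+x. ennreal ((\<Theta> (x, t))\<^sup>2) \<partial>lborel) \<le> ennreal C"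
proof -
  obtain C where C: "AE t in lborel. 0 < t \<longrightarrow> (\<integral>\<^sup>+x. ennreal ((\<theta> (x, t))\<^sup>2) \<partial>lborel) \<le> ennreal C"
    using \<theta> by (auto simp: in_Linf_L2_def)
  have [measurable]: "(\<lambda>p. indicator spacetime p * \<theta> p) \<in> borel_measurable borel"
    using \<theta> by (simp add: in_Linf_L2_def set_borel_measurable_def)
  have "{p. \<Theta> p = indicator spacetime p * \<theta> p} \<in> sets borel" by measurable
  from eq[unfolded AE_swap_pair[OF this]] C
  have good: "AE t in lborel. 0 < t \<longrightarrow> (\<integral>\<^sup>+x. ennreal ((\<Theta> (x, t))\<^sup>2) \<partial>lborel) \<le> ennreal C"
  proof eventually_elim
    case (elim t)
    show ?case
    proof
      assume t: "0 < t"
      from elim(1) have "AE x in lborel. ennreal ((\<Theta> (x, t))\<^sup>2) = ennreal ((\<theta> (x, t))\<^sup>2)"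
        by eventually_elim (use t in simp)
      from nn_integral_cong_AE[OF this] show "(\<integral>\<^sup>+x. ennreal ((\<Theta> (x, t))\<^sup>2) \<partial>lborel) \<le> ennreal C"
        using elim(2) t by simp
    qed
  qed
  have all: "(\<integral>\<^sup>+x. ennreal ((\<Theta> (x, t))\<^sup>2) \<partial>lborel) \<le> ennreal C" if t: "0 < t" for t
  proof -
    have "\<forall>j. \<exists>t'. t < t' \<and> t' < t + 1 / real (Suc j) \<and> (0 < t' \<longrightarrow> (\<integral>\<^sup>+x. ennreal ((\<Theta> (x, t'))\<^sup>2) \<partial>lborel) \<le> ennreal C)"
      by (intro allI AE_exists_in_interval[OF good]) simp
    then obtain ts where ts: "\<And>j. t < ts j" "\<And>j. ts j < t + 1 / real (Suc j)"
      "\<And>j. 0 < ts j \<longrightarrow> (\<integral>\<^sup>+x. ennreal ((\<Theta> (x, ts j))\<^sup>2) \<partial>lborel) \<le> ennreal C"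
      by metis
    have pos: "0 < ts j" for j using ts(1)[of j] t by linarith
    have lim: "ts \<longlonglongrightarrow> t"
    proof (rule tendsto_sandwich[where f = "\<lambda>_. t" and h = "\<lambda>j. t + 1 / real (Suc j)"])
      show "(\<lambda>j. t + 1 / real (Suc j)) \<longlonglongrightarrow> t"
        using tendsto_add[OF tendsto_const[of t] inv_Suc] by simp
      show "\<forall>\<^sub>F j in sequentially. t \<le> ts j" "\<forall>\<^sub>F j in sequentially. ts j \<le> t + 1 / real (Suc j)"
        using ts(1,2) by (auto intro!: always_eventually less_imp_le)
    qed simp
    have "AE x in lborel. ennreal ((\<Theta> (x, t))\<^sup>2) = liminf (\<lambda>j. ennreal ((\<Theta> (x, ts j))\<^sup>2))"
      using AE_pt_lim_time[OF t lim pos]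
    proof eventually_elim
      case (elim x)
      have "(\<lambda>j. ennreal ((\<Theta> (x, ts j))\<^sup>2)) \<longlonglongrightarrow> ennreal ((\<Theta> (x, t))\<^sup>2)"
        using elim pos t by (simp add: \<Theta>_def tendsto_power)
      from lim_imp_Liminf[OF _ this] show ?case by simp
    qed
    then have "(\<integral>\<^sup>+x. ennreal ((\<Theta> (x, t))\<^sup>2) \<partial>lborel) = (\<integral>\<^sup>+x. liminf (\<lambda>j. ennreal ((\<Theta> (x, ts j))\<^sup>2)) \<partial>lborel)"
      by (rule nn_integral_cong_AE)
    also have "\<dots> \<le> liminf (\<lambda>j. \<integral>\<^sup>+x. ennreal ((\<Theta> (x, ts j))\<^sup>2) \<partial>lborel)"
      by (rule nn_integral_liminf) measurable
    also have "\<dots> \<le> limsup (\<lambda>j. \<integral>\<^sup>+x. ennreal ((\<Theta> (x, ts j))\<^sup>2) \<partial>lborel)"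
      by (rule Liminf_le_Limsup) simp
    also have "\<dots> \<le> ennreal C" by (rule Limsup_bounded) (use ts(3) pos in auto)
    finally show ?thesis .
  qed
  show thesis
  proof (rule that[of "\<bar>C\<bar>"])
    fix t :: real assume "0 < t"
    from all[OF this] show "(\<integral>\<^sup>+x. ennreal ((\<Theta> (x, t))\<^sup>2) \<partial>lborel) \<le> ennreal \<bar>C\<bar>"
      by (rule order_trans) (rule ennreal_leI, simp)
  qed simp
qed

lemma \<Theta>_time_continuous_version:
  assumes ws: "\<And>t. 0 < t \<Longrightarrow> weak_star_conv_Linf_after t (\<lambda>k p. u k (fst p) (snd p)) \<theta>"
    and \<theta>: "in_Linf_L2 \<theta>"
  shows "time_continuous_version \<theta> \<Theta>"
proof -
  have \<theta>m: "set_borel_measurable lborel spacetime \<theta>" using \<theta> by (simp add: in_Linf_L2_def)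
  have eq: "AE p in lborel. \<Theta> p = indicator spacetime p * \<theta> p" by (rule \<Theta>_eq_AE[OF ws \<theta>m])
  obtain C where C: "0 \<le> C" "\<And>t. 0 < t \<Longrightarrow> (\<integral>\<^sup>+x. ennreal ((\<Theta> (x, t))\<^sup>2) \<partial>lborel) \<le> ennreal C"
    using \<Theta>_L2_bound[OF eq \<theta>] by blast
  have i: "integrable lborel (\<lambda>x. (\<Theta> (x, t))\<^sup>2)" and iC: "(LINT x|lborel. (\<Theta> (x, t))\<^sup>2) \<le> C" if t: "0 < t" for t
  proof -
    show i: "integrable lborel (\<lambda>x. (\<Theta> (x, t))\<^sup>2)"
    proof (rule integrableI_bounded)
      show "(\<integral>\<^sup>+x. ennreal (norm ((\<Theta> (x, t))\<^sup>2)) \<partial>lborel) < \<infinity>"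
        using C(2)[OF t] by (simp add: le_less_trans[OF _ ennreal_less_top])
    qed measurable
    show "(LINT x|lborel. (\<Theta> (x, t))\<^sup>2) \<le> C"
      using C(2)[OF t] nn_integral_eq_integral[OF i] C(1) by simp
  qed
  show ?thesis
    unfolding time_continuous_version_def
  proof (intro conjI allI impI)
    have [measurable]: "spacetime \<in> sets borel" by (intro borel_open open_spacetime)
    show "set_borel_measurable lborel spacetime \<Theta>"
      unfolding set_borel_measurable_def by measurable
    show "AE p in lborel. 0 < snd p \<longrightarrow> \<Theta> p = \<theta> p"
      using eq
    proof eventually_elim
      case (elim p)
      show ?case
      proof
        assume "0 < snd p"
        then have "p \<in> spacetime" by (cases p) auto
        then show "\<Theta> p = \<theta> p" using elim by simp
      qed
    qed
    show "in_L2 (\<lambda>x. \<Theta> (x, t))" if "0 < t" for t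
      using i[OF that] by (simp add: in_L2_def)
    fix g assume "in_L2 g"
    then have g: "g \<in> borel_measurable borel" "integrable lborel (\<lambda>x. (g x)\<^sup>2)" by (auto simp: in_L2_def)
    show "continuous_on {0<..} (\<lambda>t. LINT x|lborel. \<Theta> (x, t) * g x)"
      unfolding continuous_on_sequentially
    proof (intro allI ballI impI, elim conjE)
      fix ts t assume "t \<in> {0<..}" and ts: "\<forall>j. ts j \<in> {0<..}" "ts \<longlonglongrightarrow> (t::real)"
      then have t: "0 < t" and pos: "\<And>j. 0 < ts j" by auto
      have "AE x in lborel. (\<lambda>j. \<Theta> (x, ts j)) \<longlonglongrightarrow> \<Theta> (x, t)"
        using AE_pt_lim_time[OF t ts(2) pos] by eventually_elim (simp add: \<Theta>_def t pos)
      then show "((\<lambda>t. LINT x|lborel. \<Theta> (x, t) * g x) \<circ> ts) \<longlonglongrightarrow> (LINT x|lborel. \<Theta> (x, t) * g x)"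
        unfolding comp_def
        by (intro weak_conv_of_AE[where C = C] \<Theta>_slice_measurable g i iC t pos)
    qed
  qed
qed

end

section \<open>Uniformity in the viscosity, and conclusion\<close>

lemma visc_limit_of_viscous_solutions:
  assumes s: "9/20 < s" "s \<le> 1/2" and \<theta>0: "in_L2 \<theta>\<^sub>0"
    and eps: "\<And>k. 0 < \<epsilon> k" "\<epsilon> \<longlonglongrightarrow> 0" and U: "\<And>k. viscous_solution s (\<epsilon> k) \<theta>\<^sub>0 (U k)"
    and ws: "\<And>t. 0 < t \<Longrightarrow> weak_star_conv_Linf_after t U \<theta>"
  shows "visc_limit (\<lambda>k x t. U k (x, t)) (\<lambda>t. 100 * (L2_norm \<theta>\<^sub>0 + 1) * t powr (-1 / (4 * s)))"
proof -
  let ?Bd = "\<lambda>t. 100 * (L2_norm \<theta>\<^sub>0 + 1) * t powr (-1 / (4 * s))"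
  have M: "0 \<le> L2_norm \<theta>\<^sub>0" by (simp add: L2_norm_def)
  have Linf: "in_Linf_after t (U k)" if "0 < t" for t k
    using ws[OF that] by (simp add: weak_star_conv_Linf_after_def)
  have V: "visc_burgers s (\<epsilon> k) (frac_lap_const s) (\<lambda>x t. U k (x, t)) (\<lambda>x t. dt (U k) (x, t)) (\<lambda>x t. dx (U k) (x, t))
    (\<lambda>x t. dx (dx (U k)) (x, t))" for k
    by (rule viscous_solution_visc_burgers[OF s eps(1) U Linf])
  have bnd: "\<bar>U k (x, t)\<bar> \<le> ?Bd t0" if "0 < t0" "t0 \<le> t" for k x t t0
  proof -
    have "\<bar>U k (x, t)\<bar> \<le> ?Bd t"
      using that by (intro viscous_solution_decay[OF s eps(1) U Linf \<theta>0]) auto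
    also have "\<dots> \<le> ?Bd t0"
      using that M s by (intro mult_left_mono powr_mono2') auto
    finally show ?thesis .
  qed
  obtain E where E: "\<And>k. \<epsilon> k \<le> E"
  proof -
    have "Bseq \<epsilon>" using eps(2) by (intro convergent_imp_Bseq) (rule convergentI)
    then obtain K where "\<And>k. \<bar>\<epsilon> k\<bar> \<le> K" unfolding Bseq_def real_norm_def by blast
    then show thesis by (intro that[of K]) (blast dest: abs_le_D1)
  qed
  show ?thesis
  proof
    show "\<bar>U k (x, t)\<bar> \<le> ?Bd t0" if "0 < t0" "t0 \<le> t" for t0 t k x by (rule bnd[OF that])
    show "continuous_on spacetime (\<lambda>p. U k (fst p, snd p))" for k by (rule visc_burgers.cont_u[OF V])
    show "U k (x, t) - U k (y, t) \<le> (x - y) / t" if "0 < t" "y \<le> x" for t y x k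
      by (rule visc_burgers.oleinik[OF V that])
  next
    fix t h e :: real assume t: "0 < t" and h: "0 < h" and e: "0 < e"
    define B where "B = ?Bd (t / 2)"
    have B0: "0 \<le> B" using M by (simp add: B_def)
    \<comment> \<open>Makes the error 4 * B * \<eta> / h of the double averaging at most e / 2; the
      B + 1 avoids division by 0.\<close>
    define \<eta> where "\<eta> = e * h / (8 * (B + 1))"
    have \<eta>: "0 < \<eta>" using e h B0 by (simp add: \<eta>_def)
    have "4 * B * (e * h / (8 * b)) / h = e / 2 * (B / b)" if "0 < b" for b using h that by (simp add: field_simps)
    from this[of "B + 1"] have "4 * B * \<eta> / h = e / 2 * (B / (B + 1))" using B0 unfolding \<eta>_def by simp
    also have "\<dots> \<le> e / 2 * 1" using e B0 by (intro mult_left_mono) auto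
    finally have B\<eta>: "4 * B * \<eta> / h \<le> e / 2" by simp
    define G where "G = frac_lap_const s * ((2 * (4 * B / (h * \<eta>)) + 4 * B) * (LINT z|lborel. dom_fun z * frac_ker s z))"
    \<comment> \<open>A positive rate independent of k, since \<epsilon> k \<le> E. It is allowed to
      depend on e through \<eta>, as d is chosen last.\<close>
    define L where "L = \<bar>2 * B * B / h + G + E * (4 * B / (h * \<eta>))\<bar> + 1"
    have L: "0 < L" by (simp add: L_def)
    define d where "d = min (t / 2) (e / (2 * L))"
    have d: "0 < d" "d < t" "d \<le> t / 2" "L * d \<le> e / 2"
      using t e L by (auto simp: d_def min_def field_simps)
    have "\<bar>seg_mean h (\<lambda>y. U k (y, t')) x - seg_mean h (\<lambda>y. U k (y, t)) x\<bar> \<le> e" if t': "\<bar>t' - t\<bar> < d" for k x t'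
    proof -
      have "\<bar>seg_mean h (\<lambda>y. U k (y, t')) x - seg_mean h (\<lambda>y. U k (y, t)) x\<bar> \<le> 4 * B * \<eta> / h
          + (2 * B * B / h + G + \<epsilon> k * (4 * B / (h * \<eta>))) * \<bar>t' - t\<bar>"
        unfolding G_def
      proof (rule visc_burgers.seg_mean_time_modulus[OF V _ h \<eta>])
        show "0 < t / 2" "t / 2 \<le> t" "t / 2 \<le> t'" using t t' d(3) by auto
        show "\<bar>U k (x, \<tau>)\<bar> \<le> B" if "t / 2 \<le> \<tau>" for x \<tau>
          unfolding B_def by (rule bnd[OF _ that]) (use t in simp)
      qed
      also have "\<dots> \<le> e / 2 + L * d"
      proof (intro add_mono B\<eta> mult_mono)
        have "\<epsilon> k * (4 * B / (h * \<eta>)) \<le> E * (4 * B / (h * \<eta>))" using E B0 h \<eta> by (intro mult_right_mono) auto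
        then show "2 * B * B / h + G + \<epsilon> k * (4 * B / (h * \<eta>)) \<le> L" unfolding L_def by linarith
      qed (use t' L in auto)
      finally show ?thesis using d(4) by linarith
    qed
    then show "\<exists>d>0. d < t \<and> (\<forall>k x t'. \<bar>t' - t\<bar> < d \<longrightarrow> \<bar>seg_mean h (\<lambda>y. U k (y, t')) x - seg_mean h (\<lambda>y. U k (y, t)) x\<bar> \<le> e)"
      using d by blast
  next
    fix t \<tau> h x :: real assume t: "0 < t" "0 < \<tau>" and h: "0 < h"
    \<comment> \<open>The half plane starts at t / 2 so that it contains the closed rectangle, whose
      lower edge is at time t.\<close>
    let ?R = "{x..x + h} \<times> {t..t + \<tau>}" and ?S = "(UNIV :: real set) \<times> {t / 2<..}"
    have R: "?R \<in> sets borel" by (intro borel_closed closed_Times) auto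
    have S: "?S \<in> sets borel" by (intro borel_open open_Times) auto
    have "bounded ?R" by (intro bounded_Times) auto
    then have "emeasure lborel ?R < \<infinity>" by (rule emeasure_bounded_finite)
    then have "integrable lborel (\<lambda>p. indicator ?R p :: real)"
      using R by (intro integrable_real_indicator) auto
    then have "set_integrable lborel ?S (\<lambda>p. indicator ?R p :: real)"
      unfolding set_integrable_def by (rule integrable_mult_indicator[rotated]) (use S in simp)
    moreover have "weak_star_conv_Linf_after (t / 2) U \<theta>" using t by (intro ws) simp
    ultimately have "(\<lambda>k. LINT p:?S|lborel. U k p * indicator ?R p) \<longlonglongrightarrow> (LINT p:?S|lborel. \<theta> p * indicator ?R p)"
      unfolding weak_star_conv_Linf_after_def by blast
    moreover have "(LINT p:?S|lborel. U k p * indicator ?R p) = (LINT p|lborel. indicator ?R p * U k (fst p, snd p))" for k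
      unfolding set_lebesgue_integral_def
      using t by (intro Bochner_Integration.integral_cong) (auto simp: indicator_def)
    ultimately show "convergent (\<lambda>k. LINT p|lborel. indicator ?R p * U k (fst p, snd p))"
      by (auto intro: convergentI)
  qed
qed

theorem theorem1p1:
  shows "\<exists>(\<alpha>::real) (T::real \<Rightarrow> real).
    0 < \<alpha> \<and> \<alpha> < 1 / 2 \<and> (\<forall>M\<ge>0. 0 < T M) \<and>
    (\<forall>(s::real) (\<theta>\<^sub>0::real \<Rightarrow> real) (\<theta>::real \<times> real \<Rightarrow> real).
       (1 - \<alpha>) / 2 < s \<longrightarrow> s \<le> 1 / 2 \<longrightarrow> in_L2 \<theta>\<^sub>0 \<longrightarrow>
       vanishing_viscosity_solution s \<theta>\<^sub>0 \<theta> \<longrightarrow>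
       (\<exists>\<theta>'. time_continuous_version \<theta> \<theta>' \<and>
          (\<forall>t>T (L2_norm \<theta>\<^sub>0). holder_continuous \<alpha> (\<lambda>x. \<theta>' (x, t)))))"
proof (rule exI[of _ "1/10"], rule exI[of _ "\<lambda>M. (3000 * (M + 1))\<^sup>2 + 10"], intro conjI allI impI)
  \<comment> \<open>With \<alpha> = 1/10 the hypothesis on s reads s > 9/20. The time splits into
    the decay of u below 1/30 and the 10 units during which the jump of the modulus closes.\<close>
  show "0 < (3000 * (M + 1))\<^sup>2 + 10" for M :: real by (rule add_nonneg_pos) auto
  fix s :: real and \<theta>\<^sub>0 \<theta>
  assume "(1 - 1/10) / 2 < s" and s2: "s \<le> 1/2" and \<theta>0: "in_L2 \<theta>\<^sub>0" and v: "vanishing_viscosity_solution s \<theta>\<^sub>0 \<theta>"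
  then have s: "9/20 < s" "s \<le> 1/2" by auto
  obtain \<epsilon> U where eps: "\<And>k. 0 < \<epsilon> k" "\<epsilon> \<longlonglongrightarrow> 0" and U: "\<And>k. viscous_solution s (\<epsilon> k) \<theta>\<^sub>0 (U k)"
    and \<theta>: "in_Linf_L2 \<theta>" and ws: "\<And>t. 0 < t \<Longrightarrow> weak_star_conv_Linf_after t U \<theta>"
    using v unfolding vanishing_viscosity_solution_def weak_solution_def by blast
  interpret L: visc_limit "\<lambda>k x t. U k (x, t)" "\<lambda>t. 100 * (L2_norm \<theta>\<^sub>0 + 1) * t powr (-1 / (4 * s))"
    by (rule visc_limit_of_viscous_solutions[OF s \<theta>0 eps U ws])
  have Linf: "in_Linf_after t (U k)" if "0 < t" for t k
    using ws[OF that] by (simp add: weak_star_conv_Linf_after_def)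
  have "time_continuous_version \<theta> L.\<Theta>"
    by (rule L.\<Theta>_time_continuous_version[OF _ \<theta>]) (use ws in simp)
  moreover have "holder_continuous (1/10) (\<lambda>x. L.\<Theta> (x, t))" if t: "(3000 * (L2_norm \<theta>\<^sub>0 + 1))\<^sup>2 + 10 < t" for t
  proof -
    have pos: "0 < t" by (rule order_le_less_trans[OF _ t]) simp
    have "\<bar>L.pt_lim x t - L.pt_lim y t\<bar> \<le> 1/10 * \<bar>x - y\<bar> powr (1/10)" for x y
      using t by (intro L.pt_lim_holder[OF pos] viscous_solution_holder[OF s eps(1) U Linf \<theta>0]) auto
    then show ?thesis using pos unfolding holder_continuous_def L.\<Theta>_def by (intro exI[of _ "1/10"]) simp
  qed
  ultimately show "\<exists>\<theta>'. time_continuous_version \<theta> \<theta>' \<and>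
      (\<forall>t>(3000 * (L2_norm \<theta>\<^sub>0 + 1))\<^sup>2 + 10. holder_continuous (1/10) (\<lambda>x. \<theta>' (x, t)))"
    by blast
qed auto

end
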